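(* Let $p$ and $q$ be monic polynomials of degree $2$ in $\mathbb{F}[t]$. Let $u$ be an endomorphism of a finite-dimensional vector space $V$ over $\mathbb{F}$. Assume that $u$ is d-regular with respect to $(p,q)$ and set $\delta:=\operatorname{tr}(p)-\operatorname{tr}(q)$. The following conditions are equivalent: (i) The endomorphism $u$ is a $(p,q)$-difference. (ii) The invariant factors of $u$ read $p_1(t^2-\delta t),\dots,p_{2n-1}(t^2-\delta t),p_{2n}(t^2-\delta t),\dots$ (for monic polynomials $p_1,p_2,\dots$ of $\mathbb{F}[t]$) where, for every irreducible monic polynomial $r\in\mathbb{F}[t]$ that has Type $2$ with respect to $(p,q)$ and every positive integer $n$, the polynomials $p_{2n-1}$ and $p_{2n}$ have the same valuation with respect to $r$. (iii) There is a basis of $V$ in which $u$ is represented by a block-diagonal matrix in which every diagonal block equals either $C\bigl(r^n(t^2-\delta t)\bigr)$ for some irreducible monic polynomial $r\in\mathbb{F}[t]$ of Type $1$ with respect to $(p,q)$ and some positive integer $n$, or $C\bigl(r^n(t^2-\delta t)\bigr)\oplus C\bigl(r^n(t^2-\delta t)\bigr)$ for some irreducible monic polynomial $r\in\mathbb{F}[t]$ and some positive integer $n$.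
   Context: $\mathbb{F}$ is an arbitrary field (any characteristic) with algebraic closure $\overline{\mathbb{F}}$. For a monic polynomial $p$ of degree $n\geq 1$, $\operatorname{tr}(p)$ is the opposite of the coefficient of $p$ on $t^{n-1}$; $\operatorname{Root}(p)$ is the set of roots of $p$ in $\overline{\mathbb{F}}$, and $\operatorname{Root}(p)-\operatorname{Root}(q)=\{x-y : x\in\operatorname{Root}(p),\,y\in\operatorname{Root}(q)\}$. An endomorphism $u$ of $V$ is a $(p,q)$-difference if $u=a-b$ for some endomorphisms $a,b$ of $V$ with $p(a)=0$ and $q(b)=0$. It is d-regular with respect to $(p,q)$ if no eigenvalue of $u$ in $\overline{\mathbb{F}}$ belongs to $\operatorname{Root}(p)-\operatorname{Root}(q)$. $C(r)$ is the companion matrix of the monic polynomial $r$ ($C(1)$ is the $0\times 0$ matrix); $r^n(t^2-\delta t)$ means the polynomial $r^n$ evaluated at $t^2-\delta t$; $\oplus$ denotes block-diagonal sum. The invariant factors of $u$ are the monic polynomials $r_1,r_2,\dots$ with $r_{i+1}\mid r_i$ such that $u$ is represented in some basis by $C(r_1)\oplus C(r_2)\oplus\cdots$; the finite list of nonconstant ones is extended to an infinite sequence by $r_i=1$. The norm form. Write $p(t)=t^2-\lambda t+\alpha$ and $q(t)=t^2-\mu t+\beta$. For a field extension $\mathbb{L}$ of $\mathbb{F}$ and $x\in\mathbb{L}$, let $\mathcal{W}(p,q,x)_{\mathbb{L}}$ be the $4$-dimensional subalgebra of $\mathrm{M}_4(\mathbb{L})$ with $\mathbb{L}$-basis $(I_4,A,B,AB)$,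 where $$A=\begin{bmatrix}0&-\alpha&0&0\\1&\lambda&0&0\\0&0&0&-\alpha\\0&0&1&\lambda\end{bmatrix},\qquad B=\begin{bmatrix}0&-x&-\beta&-\lambda\beta\\0&\mu&0&\beta\\1&\lambda&\mu&\lambda\mu-x\\0&-1&0&0\end{bmatrix}.$$ Its norm is the quadratic form over $\mathbb{L}$ $$aI_4+bA+cB+dAB\mapsto a\bigl(a+\lambda b+\mu c+(\lambda\mu-x)d\bigr)+b\bigl(\alpha b+xc+\alpha\mu d\bigr)+\beta c^2+\bigl(\lambda\beta c+\alpha\beta d\bigr)d .$$ A quadratic form is isotropic if it vanishes at some nonzero vector. Types. Let $r\in\mathbb{F}[t]$ be irreducible and monic, $\mathbb{L}:=\mathbb{F}[t]/(r)$, and $\overline{t}$ the class of $t$ in $\mathbb{L}$. Then $r$ has Type $1$ (respectively, Type $2$) with respect to $(p,q)$ if $r(t^2-\delta t)$ has no root in $\operatorname{Root}(p)-\operatorname{Root}(q)$ and the norm of $\mathcal{W}\bigl(p,q,\overline{t}+p(0)+q(0)\bigr)_{\mathbb{L}}$ is isotropic (respectively, non-isotropic). *)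

theory Defs
  imports
    "HOL-Algebra.Algebraic_Closure_Type"
    "HOL-Algebra.QuotRing"
    "Jordan_Normal_Form.Char_Poly"
begin

text \<open>Several names (\<open>degree\<close>, \<open>coeff\<close>, \<open>irreducible\<close>, \<dots>) exist both for type-class
  polynomials and in HOL-Algebra, hence the qualified names below.\<close>

section \<open>Polynomials\<close>

definition poly_trace :: "'a::field poly \<Rightarrow> 'a" where
  "poly_trace p = - Polynomial.coeff p (Polynomial.degree p - 1)"

definition ac_roots :: "'a::field poly \<Rightarrow> 'a alg_closure set" where
  "ac_roots p = {x. poly (map_poly to_ac p) x = 0}"

definition root_diff :: "'a::field poly \<Rightarrow> 'a poly \<Rightarrow> 'a alg_closure set" where
  "root_diff p q = {x - y | x y. x \<in> ac_roots p \<and> y \<in> ac_roots q}"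

text \<open>\<open>subst_quad d f\<close> is \<open>f(t\<^sup>2 - d t)\<close>.\<close>

definition subst_quad :: "'a::field \<Rightarrow> 'a poly \<Rightarrow> 'a poly" where
  "subst_quad d f = pcompose f [:0, - d, 1:]"

text \<open>Ones on the subdiagonal and minus the coefficients in the last column.\<close>

definition companion :: "'a::field poly \<Rightarrow> 'a mat" where
  "companion f = (let n = Polynomial.degree f in
     mat n n (\<lambda>(i, j). if j = n - 1 then - Polynomial.coeff f i
                        else if i = j + 1 then 1 else 0))"

text \<open>The library's \<open>multiplicity\<close> needs a GCD structure on the coefficient type, which an
  arbitrary field does not carry. The value is meaningful for \<open>f \<noteq> 0\<close> and nonconstant \<open>r\<close>.\<close>

definition poly_valuation :: "'a::field poly \<Rightarrow> 'a poly \<Rightarrow> nat" where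
  "poly_valuation r f = (GREATEST k. r ^ k dvd f)"

section \<open>Endomorphisms\<close>

definition is_basis_list ::
  "('a::field \<Rightarrow> 'b::ab_group_add \<Rightarrow> 'b) \<Rightarrow> 'b list \<Rightarrow> bool" where
  "is_basis_list scale bs \<longleftrightarrow> distinct bs \<and> \<not> module.dependent scale (set bs) \<and>
     module.span scale (set bs) = UNIV"

definition represented_by ::
  "('a::field \<Rightarrow> 'b::ab_group_add \<Rightarrow> 'b) \<Rightarrow> ('b \<Rightarrow> 'b) \<Rightarrow> 'a mat \<Rightarrow> bool" where
  "represented_by scale u M \<longleftrightarrow> (\<exists>bs. is_basis_list scale bs \<and>
     M \<in> carrier_mat (length bs) (length bs) \<and>
     (\<forall>j<length bs. u (bs ! j) = (\<Sum>i<length bs. scale (M $$ (i, j)) (bs ! i))))"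

definition poly_end ::
  "('a::field \<Rightarrow> 'b::ab_group_add \<Rightarrow> 'b) \<Rightarrow> 'a poly \<Rightarrow> ('b \<Rightarrow> 'b) \<Rightarrow> 'b \<Rightarrow> 'b" where
  "poly_end scale p f v = (\<Sum>i\<le>Polynomial.degree p. scale (Polynomial.coeff p i) ((f ^^ i) v))"

definition pq_difference ::
  "('a::field \<Rightarrow> 'b::ab_group_add \<Rightarrow> 'b) \<Rightarrow> 'a poly \<Rightarrow> 'a poly \<Rightarrow> ('b \<Rightarrow> 'b) \<Rightarrow> bool" where
  "pq_difference scale p q u \<longleftrightarrow> (\<exists>a b. Vector_Spaces.linear scale scale a \<and>
     Vector_Spaces.linear scale scale b \<and>
     (\<forall>v. poly_end scale p a v = 0) \<and> (\<forall>v. poly_end scale q b v = 0) \<and> (\<forall>v. u v = a v - b v))"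

text \<open>Eigenvalues of \<open>u\<close> in the algebraic closure are those of a matrix representing \<open>u\<close>,
  regarded as a matrix over the closure; they do not depend on the chosen basis.\<close>

definition ac_eigenvalue ::
  "('a::field \<Rightarrow> 'b::ab_group_add \<Rightarrow> 'b) \<Rightarrow> ('b \<Rightarrow> 'b) \<Rightarrow> 'a alg_closure \<Rightarrow> bool" where
  "ac_eigenvalue scale u x \<longleftrightarrow> (\<exists>M. represented_by scale u M \<and> eigenvalue (map_mat to_ac M) x)"

definition d_regular ::
  "('a::field \<Rightarrow> 'b::ab_group_add \<Rightarrow> 'b) \<Rightarrow> 'a poly \<Rightarrow> 'a poly \<Rightarrow> ('b \<Rightarrow> 'b) \<Rightarrow> bool" where
  "d_regular scale p q u \<longleftrightarrow> (\<forall>x. ac_eigenvalue scale u x \<longrightarrow> x \<notin> root_diff p q)"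

text \<open>The sequence of invariant factors is \<open>R 1, R 2, \<dots>\<close>; the value \<open>R 0\<close> is irrelevant. As
  \<open>companion 1\<close> is the \<open>0 \<times> 0\<close> matrix, the choice of \<open>N\<close> is immaterial.\<close>

definition invariant_factors ::
  "('a::field \<Rightarrow> 'b::ab_group_add \<Rightarrow> 'b) \<Rightarrow> ('b \<Rightarrow> 'b) \<Rightarrow> (nat \<Rightarrow> 'a poly) \<Rightarrow> bool" where
  "invariant_factors scale u R \<longleftrightarrow>
     (\<forall>i\<ge>1. monic (R i)) \<and> (\<forall>i\<ge>1. R (Suc i) dvd R i) \<and>
     (\<exists>N. (\<forall>i>N. R i = 1) \<and>
          represented_by scale u (diag_block_mat (map (\<lambda>i. companion (R i)) [1..<Suc N])))"

section \<open>The algebra $\mathcal{W}(p,q,x)$ and its norm\<close>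

text \<open>\<open>L\<close> is an extension of the ground field, given as a HOL-Algebra ring together with the
  embedding \<open>e\<close> of the ground field. Matrices over \<open>L\<close> use only the container type \<open>mat\<close>; their
  arithmetic is that of the record \<open>L\<close>.\<close>

definition ring_mat_mult :: "('l, 'm) ring_scheme \<Rightarrow> 'l mat \<Rightarrow> 'l mat \<Rightarrow> 'l mat" where
  "ring_mat_mult L M N = mat (dim_row M) (dim_col N)
     (\<lambda>(i, j). \<Oplus>\<^bsub>L\<^esub>k\<in>{..<dim_col M}. M $$ (i, k) \<otimes>\<^bsub>L\<^esub> N $$ (k, j))"

definition W_A :: "('l, 'm) ring_scheme \<Rightarrow> ('a::field \<Rightarrow> 'l) \<Rightarrow> 'a poly \<Rightarrow> 'l mat" where
  "W_A L e p = (let lam = e (poly_trace p); al = e (Polynomial.coeff p 0);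
                    z = \<zero>\<^bsub>L\<^esub>; o1 = \<one>\<^bsub>L\<^esub> in
     mat_of_rows_list 4
       [[z,  \<ominus>\<^bsub>L\<^esub> al, z,  z],
        [o1, lam,     z,  z],
        [z,  z,       z,  \<ominus>\<^bsub>L\<^esub> al],
        [z,  z,       o1, lam]])"

definition W_B ::
  "('l, 'm) ring_scheme \<Rightarrow> ('a::field \<Rightarrow> 'l) \<Rightarrow> 'a poly \<Rightarrow> 'a poly \<Rightarrow> 'l \<Rightarrow> 'l mat" where
  "W_B L e p q x = (let lam = e (poly_trace p);
                        mu = e (poly_trace q); be = e (Polynomial.coeff q 0);
                        z = \<zero>\<^bsub>L\<^esub>; o1 = \<one>\<^bsub>L\<^esub> in
     mat_of_rows_list 4
       [[z,  \<ominus>\<^bsub>L\<^esub> x,  \<ominus>\<^bsub>L\<^esub> be, \<ominus>\<^bsub>L\<^esub> (lam \<otimes>\<^bsub>L\<^esub> be)],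
        [z,  mu,      z,       be],
        [o1, lam,     mu,      (lam \<otimes>\<^bsub>L\<^esub> mu) \<ominus>\<^bsub>L\<^esub> x],
        [z,  \<ominus>\<^bsub>L\<^esub> o1, z,       z]])"

text \<open>\<open>W_elem L e p q x (a, b, c, d)\<close> is \<open>a I + b A + c B + d A B\<close>.\<close>

definition W_elem ::
  "('l, 'm) ring_scheme \<Rightarrow> ('a::field \<Rightarrow> 'l) \<Rightarrow> 'a poly \<Rightarrow> 'a poly \<Rightarrow> 'l
    \<Rightarrow> 'l \<times> 'l \<times> 'l \<times> 'l \<Rightarrow> 'l mat" where
  "W_elem L e p q x = (\<lambda>(a, b, c, d).
     let A = W_A L e p; B = W_B L e p q x; AB = ring_mat_mult L A B in
     mat 4 4 (\<lambda>(i, j). a \<otimes>\<^bsub>L\<^esub> (if i = j then \<one>\<^bsub>L\<^esub> else \<zero>\<^bsub>L\<^esub>) \<oplus>\<^bsub>L\<^esub> b \<otimes>\<^bsub>L\<^esub> A $$ (i, j)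
        \<oplus>\<^bsub>L\<^esub> c \<otimes>\<^bsub>L\<^esub> B $$ (i, j) \<oplus>\<^bsub>L\<^esub> d \<otimes>\<^bsub>L\<^esub> AB $$ (i, j)))"

definition W_coords :: "('l, 'm) ring_scheme \<Rightarrow> ('l \<times> 'l \<times> 'l \<times> 'l) set" where
  "W_coords L = carrier L \<times> carrier L \<times> carrier L \<times> carrier L"

definition W_algebra ::
  "('l, 'm) ring_scheme \<Rightarrow> ('a::field \<Rightarrow> 'l) \<Rightarrow> 'a poly \<Rightarrow> 'a poly \<Rightarrow> 'l \<Rightarrow> 'l mat set" where
  "W_algebra L e p q x = W_elem L e p q x ` W_coords L"

definition norm_form ::
  "('l, 'm) ring_scheme \<Rightarrow> ('a::field \<Rightarrow> 'l) \<Rightarrow> 'a poly \<Rightarrow> 'a poly \<Rightarrow> 'l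
    \<Rightarrow> 'l \<times> 'l \<times> 'l \<times> 'l \<Rightarrow> 'l" where
  "norm_form L e p q x = (\<lambda>(a, b, c, d).
     let lam = e (poly_trace p); al = e (Polynomial.coeff p 0);
         mu = e (poly_trace q); be = e (Polynomial.coeff q 0) in
       a \<otimes>\<^bsub>L\<^esub> (a \<oplus>\<^bsub>L\<^esub> lam \<otimes>\<^bsub>L\<^esub> b \<oplus>\<^bsub>L\<^esub> mu \<otimes>\<^bsub>L\<^esub> c \<oplus>\<^bsub>L\<^esub> ((lam \<otimes>\<^bsub>L\<^esub> mu) \<ominus>\<^bsub>L\<^esub> x) \<otimes>\<^bsub>L\<^esub> d)
       \<oplus>\<^bsub>L\<^esub> b \<otimes>\<^bsub>L\<^esub> (al \<otimes>\<^bsub>L\<^esub> b \<oplus>\<^bsub>L\<^esub> x \<otimes>\<^bsub>L\<^esub> c \<oplus>\<^bsub>L\<^esub> al \<otimes>\<^bsub>L\<^esub> mu \<otimes>\<^bsub>L\<^esub> d)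
       \<oplus>\<^bsub>L\<^esub> be \<otimes>\<^bsub>L\<^esub> (c \<otimes>\<^bsub>L\<^esub> c)
       \<oplus>\<^bsub>L\<^esub> (lam \<otimes>\<^bsub>L\<^esub> be \<otimes>\<^bsub>L\<^esub> c \<oplus>\<^bsub>L\<^esub> al \<otimes>\<^bsub>L\<^esub> be \<otimes>\<^bsub>L\<^esub> d) \<otimes>\<^bsub>L\<^esub> d)"

definition W_norm ::
  "('l, 'm) ring_scheme \<Rightarrow> ('a::field \<Rightarrow> 'l) \<Rightarrow> 'a poly \<Rightarrow> 'a poly \<Rightarrow> 'l \<Rightarrow> 'l mat \<Rightarrow> 'l" where
  "W_norm L e p q x w =
     norm_form L e p q x (THE v. v \<in> W_coords L \<and> w = W_elem L e p q x v)"

definition W_norm_isotropic ::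
  "('l, 'm) ring_scheme \<Rightarrow> ('a::field \<Rightarrow> 'l) \<Rightarrow> 'a poly \<Rightarrow> 'a poly \<Rightarrow> 'l \<Rightarrow> bool" where
  "W_norm_isotropic L e p q x \<longleftrightarrow>
     (\<exists>w\<in>W_algebra L e p q x. w \<noteq> mat 4 4 (\<lambda>_. \<zero>\<^bsub>L\<^esub>) \<and> W_norm L e p q x w = \<zero>\<^bsub>L\<^esub>)"

text \<open>The matrices \<open>I, A, B, A B\<close> are linearly independent (their first columns are the unit
  vectors), so the coordinates used in \<open>W_norm\<close> are unique.\<close>

lemma W_elem_column0:
  assumes "cring L" "range e \<subseteq> carrier L" "x \<in> carrier L"
    and "a \<in> carrier L" "b \<in> carrier L" "c \<in> carrier L" "d \<in> carrier L"
  shows "W_elem L e p q x (a, b, c, d) $$ (0, 0) = a"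
    and "W_elem L e p q x (a, b, c, d) $$ (1, 0) = b"
    and "W_elem L e p q x (a, b, c, d) $$ (2, 0) = c"
    and "W_elem L e p q x (a, b, c, d) $$ (3, 0) = d"
proof -
  interpret cring L by fact
  have e: "e y \<in> carrier L" for y using assms(2) by auto
  have set4: "{..<4} = {0, 1, 2, 3::nat}" by auto
  note defs = W_elem_def W_A_def W_B_def ring_mat_mult_def Let_def mat_of_rows_list_def set4
    numeral_2_eq_2 numeral_3_eq_3
  show "W_elem L e p q x (a, b, c, d) $$ (0, 0) = a"
    and "W_elem L e p q x (a, b, c, d) $$ (1, 0) = b"
    and "W_elem L e p q x (a, b, c, d) $$ (2, 0) = c"
    and "W_elem L e p q x (a, b, c, d) $$ (3, 0) = d"
    using assms(3-) e by (simp_all add: defs)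
qed

lemma inj_on_W_elem:
  assumes "cring L" "range e \<subseteq> carrier L" "x \<in> carrier L"
  shows "inj_on (W_elem L e p q x) (W_coords L)"
proof (rule inj_onI)
  fix v w assume vw: "v \<in> W_coords L" "w \<in> W_coords L"
    and eq: "W_elem L e p q x v = W_elem L e p q x w"
  obtain a b c d where v: "v = (a, b, c, d)" by (cases v)
  obtain a' b' c' d' where w: "w = (a', b', c', d')" by (cases w)
  have in_L: "a \<in> carrier L" "b \<in> carrier L" "c \<in> carrier L" "d \<in> carrier L"
    "a' \<in> carrier L" "b' \<in> carrier L" "c' \<in> carrier L" "d' \<in> carrier L"
    using vw by (auto simp: v w W_coords_def)
  note cols = W_elem_column0[OF assms in_L(1-4), of p q] W_elem_column0[OF assms in_L(5-8), of p q]
  show "v = w" using cols eq unfolding v w by simp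
qed

lemma W_norm_W_elem:
  assumes "cring L" "range e \<subseteq> carrier L" "x \<in> carrier L" "v \<in> W_coords L"
  shows "W_norm L e p q x (W_elem L e p q x v) = norm_form L e p q x v"
proof -
  have "(THE v'. v' \<in> W_coords L \<and> W_elem L e p q x v = W_elem L e p q x v') = v"
    using inj_on_W_elem[OF assms(1-3)] assms(4) by (intro the_equality) (auto dest: inj_onD)
  thus ?thesis by (simp add: W_norm_def)
qed

section \<open>Types of irreducible polynomials\<close>

definition residue_field :: "'a::field poly \<Rightarrow> 'a poly set ring" where
  "residue_field r = (ring_of_type_algebra :: 'a poly ring) Quot (PIdl\<^bsub>ring_of_type_algebra\<^esub> r)"

definition residue_class :: "'a::field poly \<Rightarrow> 'a poly \<Rightarrow> 'a poly set" where
  "residue_class r f = (PIdl\<^bsub>ring_of_type_algebra\<^esub> r) +>\<^bsub>ring_of_type_algebra\<^esub> f"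

text \<open>The element of \<open>F[t]/(r)\<close> used is the class of \<open>t + p(0) + q(0)\<close>.\<close>

definition type_norm_isotropic :: "'a::field poly \<Rightarrow> 'a poly \<Rightarrow> 'a poly \<Rightarrow> bool" where
  "type_norm_isotropic p q r \<longleftrightarrow>
     W_norm_isotropic (residue_field r) (\<lambda>c. residue_class r [:c:]) p q
       (residue_class r [:0, 1:] \<oplus>\<^bsub>residue_field r\<^esub> residue_class r [:poly p 0:]
          \<oplus>\<^bsub>residue_field r\<^esub> residue_class r [:poly q 0:])"

definition no_root_in_diff :: "'a::field poly \<Rightarrow> 'a poly \<Rightarrow> 'a poly \<Rightarrow> bool" where
  "no_root_in_diff p q r \<longleftrightarrow>
     ac_roots (subst_quad (poly_trace p - poly_trace q) r) \<inter> root_diff p q = {}"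

definition has_type1 :: "'a::field poly \<Rightarrow> 'a poly \<Rightarrow> 'a poly \<Rightarrow> bool" where
  "has_type1 p q r \<longleftrightarrow> Factorial_Ring.irreducible r \<and> monic r \<and>
     no_root_in_diff p q r \<and> type_norm_isotropic p q r"

definition has_type2 :: "'a::field poly \<Rightarrow> 'a poly \<Rightarrow> 'a poly \<Rightarrow> bool" where
  "has_type2 p q r \<longleftrightarrow> Factorial_Ring.irreducible r \<and> monic r \<and>
     no_root_in_diff p q r \<and> \<not> type_norm_isotropic p q r"

end

theory Submission
  imports Defs
begin

text \<open>Write \<open>p = t\<^sup>2 - \<lambda> t + \<alpha>\<close> and \<open>q = t\<^sup>2 - \<mu> t + \<beta>\<close>. If \<open>u = a - b\<close> with \<open>p(a) = 0\<close> and
  \<open>q(b) = 0\<close>, then \<open>v = u\<^sup>2 - \<delta> u\<close> commutes with \<open>a\<close> and \<open>b\<close>, and the space becomes a module over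
  the algebra \<open>W(p, q, t + \<alpha> + \<beta>)\<close> over \<open>F[t]\<close>, where \<open>t\<close> acts as \<open>v\<close>. Conversely, \<open>u\<close> is a
  difference as soon as some \<open>a\<close> satisfies \<open>a\<^sup>2 = \<lambda> a - \<alpha>\<close> and
  \<open>a u + u a = \<delta> a + \<lambda> u + v + \<beta> - \<alpha>\<close>. One treats the \<open>r\<close>-primary components of \<open>v\<close> one at a time;
  regularity kills those for which \<open>r\<close> divides the discriminant of the conic \<open>N(A - y - w u) = 0\<close>.

  If the norm is isotropic modulo \<open>r\<close>, this conic has a smooth point modulo \<open>r\<close>, which lifts to
  every power of \<open>r\<close>. The kernel \<open>M\<close> of \<open>a - y - w u\<close> is then an \<open>F[t]\<close>-module with \<open>S = M \<oplus> u M\<close>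
  for the primary component \<open>S\<close>, and a cyclic decomposition of \<open>M\<close> yields blocks
  \<open>C(r\<^sup>n(t\<^sup>2 - \<delta> t))\<close>. Conversely a point of the conic provides \<open>a\<close> on such a block. If the norm is
  anisotropic modulo \<open>r\<close>, every element of the algebra is a power of \<open>r\<close> times a unit on \<open>S\<close>, so
  \<open>S\<close> is a direct sum of cyclic modules over the algebra, and each of them consists of two equal
  blocks. For every \<open>r\<close>, two equal blocks form such a cyclic module. The passage to invariant
  factors is the Chinese remainder theorem.\<close>

section \<open>Coprimality and factorization of polynomials over a field\<close>

text \<open>The irreducible polynomials of the theorem are polynomials in \<open>v\<close>, not in
  \<open>u\<close>: \<open>r(t^2 - \<delta> t)\<close> may well be reducible. So the space carries
  two \<open>F[t]\<close>-module structures, with \<open>t\<close> acting as \<open>u\<close> or as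
  \<open>v\<close>. As \<open>F[t]\<close> is free over \<open>F[t^2 - \<delta> t]\<close> with
  basis \<open>1, t\<close>, a block \<open>C(r^n(t^2 - \<delta> t))\<close> consists of two cyclic
  summands for \<open>v\<close>. On it \<open>a\<close> becomes a 2 by 2 matrix over
  \<open>F[t]/(r^n)\<close>, and its existence is the question whether the conic has a point.

  No square is completed, because the characteristic may be 2. Up to sign, the discriminant is the
  half-discriminant of the homogenized conic, and smoothness is read off a polynomial identity,
  \<open>conic_gradient\<close>.

  The algebra is not commutative, so the structure theorem comes from an exchange argument in which
  every nonzero operator is a power of a central one times an invertible one; \<open>F[t]\<close> is
  a special case. Conditions (i), (ii) and (iii) are all compared with one property: the space is a
  direct sum of cyclic modules whose annihilators form an \<open>admissible\<close>
  multiset.\<close>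

lemma field_poly_bezout:
  fixes r f :: "'a::field poly"
  assumes "Factorial_Ring.irreducible r" "\<not> r dvd f"
  obtains g h where "g * f + h * r = 1"
proof -
  define I where "I = {x. \<exists>g h. x = g * f + h * r}"
  have r0: "r \<noteq> 0" using assms(1) by auto
  have "r \<in> I" unfolding I_def by (auto intro: exI[of _ 0] exI[of _ 1])
  hence ex: "\<exists>x. x \<in> I \<and> x \<noteq> 0" using r0 by blast
  \<comment> \<open>A nonzero element of least degree in the ideal divides every element, in
    particular \<open>f\<close> and \<open>r\<close>.\<close>
  define d where "d = (ARG_MIN Polynomial.degree x. x \<in> I \<and> x \<noteq> 0)"
  have d: "d \<in> I" "d \<noteq> 0" and dmin: "\<And>x. x \<in> I \<Longrightarrow> x \<noteq> 0 \<Longrightarrow> Polynomial.degree d \<le> Polynomial.degree x"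
    using arg_min_natI[of "\<lambda>x. x \<in> I \<and> x \<noteq> 0" _ Polynomial.degree]
      arg_min_nat_le[of "\<lambda>x. x \<in> I \<and> x \<noteq> 0" _ Polynomial.degree] ex
    unfolding d_def by blast+
  obtain dg dh where dd: "d = dg * f + dh * r" using d(1) by (auto simp: I_def)
  have dvd: "d dvd x" if x: "x \<in> I" for x
  proof -
    obtain xg xh where xx: "x = xg * f + xh * r" using x by (auto simp: I_def)
    have "x mod d = x - (x div d) * d" by (simp add: minus_div_mult_eq_mod)
    also have "\<dots> = (xg - (x div d) * dg) * f + (xh - (x div d) * dh) * r"
      unfolding xx dd by (simp add: algebra_simps)
    finally have "x mod d \<in> I" unfolding I_def by blast
    hence "x mod d = 0" using dmin[of "x mod d"] degree_mod_less'[of d x] d(2) by force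
    thus ?thesis by auto
  qed
  have "d dvd r" using dvd \<open>r \<in> I\<close> by blast
  moreover have "f = 1 * f + 0 * r" by simp
  hence "d dvd f" by (intro dvd) (unfold I_def, blast)
  hence "\<not> r dvd d" using assms(2) dvd_trans by blast
  ultimately have "is_unit d" using irreducibleD'[OF assms(1)] by blast
  then obtain e where "1 = d * e" by (auto simp: dvd_def)
  hence "(e * dg) * f + (e * dh) * r = 1" by (simp add: dd algebra_simps)
  thus ?thesis by (rule that)
qed

text \<open>Comaximality as an explicit Bezout relation: such a relation is carried along by ring
  homomorphisms, in particular by the substitution of \<open>t^2 - \<delta> t\<close> for
  \<open>t\<close>.\<close>

definition comax :: "'a::comm_ring_1 \<Rightarrow> 'a \<Rightarrow> bool" where
  "comax f g \<longleftrightarrow> (\<exists>s t. s * f + t * g = 1)"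

lemma comax_sym: "comax f g \<Longrightarrow> comax g f"
  unfolding comax_def by (metis add.commute)

lemma comax_1 [simp]: "comax f 1" "comax 1 f"
  unfolding comax_def by (metis add.commute add_0 mult_1 mult_zero_left)+

lemma comax_mult_left:
  assumes "comax f h" "comax g h" shows "comax (f * g) h"
proof -
  obtain s t s' t' where st: "s * f + t * h = 1" "s' * g + t' * h = 1"
    using assms by (auto simp: comax_def)
  have "1 = (s * f + t * h) * (s' * g + t' * h)" by (simp add: st)
  also have "\<dots> = (s * s') * (f * g) + (s * f * t' + t * s' * g + t * h * t') * h"
    by (simp add: algebra_simps)
  finally show ?thesis unfolding comax_def by metis
qed

lemma comax_mult_right: "comax h f \<Longrightarrow> comax h g \<Longrightarrow> comax h (f * g)"
  using comax_mult_left comax_sym by blast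

lemma comax_power_left: "comax f h \<Longrightarrow> comax (f ^ n) h"
  by (induction n) (auto intro: comax_mult_left)

lemma comax_power: "comax f h \<Longrightarrow> comax (f ^ n) (h ^ m)"
  by (meson comax_power_left comax_sym)

lemma comax_prod_right: "(\<And>i. i \<in> I \<Longrightarrow> comax h (f i)) \<Longrightarrow> comax h (prod f I)"
  by (induction I rule: infinite_finite_induct) (auto intro: comax_mult_right)

lemma comax_dvd_mult:
  assumes "comax f g" "f dvd h" "g dvd h" shows "f * g dvd h"
proof -
  obtain s t where st: "s * f + t * g = 1" using assms by (auto simp: comax_def)
  have "h = h * (s * f + t * g)" by (simp add: st)
  also have "\<dots> = s * (h * f) + t * (h * g)" by (simp add: algebra_simps)
  finally have "h = s * (h * f) + t * (h * g)" .
  moreover have "f * g dvd h * f" "f * g dvd h * g" using mult_dvd_mono[OF assms(3) dvd_refl[of f]] mult_dvd_mono[OF assms(2) dvd_refl[of g]]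
    by (simp_all add: mult.commute[of g f])
  ultimately show ?thesis by (metis dvd_add dvd_mult)
qed

lemma comax_dvd_cancel:
  assumes "comax f g" "f dvd g * h" shows "f dvd h"
proof -
  obtain s t where st: "s * f + t * g = 1" using assms by (auto simp: comax_def)
  have "h = h * (s * f + t * g)" by (simp add: st)
  also have "\<dots> = (s * h) * f + t * (g * h)" by (simp add: algebra_simps)
  finally show ?thesis using assms(2) by (metis dvd_add dvd_mult dvd_triv_right)
qed

lemma irreducible_comax_iff:
  fixes r f :: "'a::field poly"
  assumes "Factorial_Ring.irreducible r"
  shows "comax r f \<longleftrightarrow> \<not> r dvd f"
proof
  assume "comax r f"
  show "\<not> r dvd f"
  proof
    assume "r dvd f"
    hence "r dvd 1" using \<open>comax r f\<close> unfolding comax_def by (metis dvd_add dvd_mult dvd_refl)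
    thus False using irreducible_not_unit[OF assms] by blast
  qed
next
  assume "\<not> r dvd f"
  thus "comax r f" using field_poly_bezout[OF assms] unfolding comax_def by (metis add.commute)
qed

lemma irreducible_dvd_multD:
  fixes r f :: "'a::field poly"
  assumes "Factorial_Ring.irreducible r" "r dvd f * g" shows "r dvd f \<or> r dvd g"
  using assms comax_dvd_cancel irreducible_comax_iff by blast

lemma irreducible_dvd_irreducible_monic:
  fixes r s :: "'a::field poly"
  assumes "Factorial_Ring.irreducible r" "monic r" "Factorial_Ring.irreducible s" "monic s" "r dvd s"
  shows "r = s"
proof -
  obtain c where c: "s = r * c" using assms(5) by (elim dvdE)
  have "is_unit c" using assms(1,3) c by (metis irreducible_not_unit irreducibleD)
  then obtain k where k: "c = [:k:]" by (metis is_unit_polyE)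
  have "lead_coeff s = lead_coeff r * k" using c k by (metis lead_coeff_mult lead_coeff_pCons(2) pCons_0_0 mult.commute mult_zero_right coeff_0 lead_coeff_pCons(1))
  thus ?thesis using assms c k by simp
qed

lemma irreducible_comax:
  fixes r s :: "'a::field poly"
  assumes "Factorial_Ring.irreducible r" "monic r" "Factorial_Ring.irreducible s" "monic s" "r \<noteq> s"
  shows "comax r s"
  using assms irreducible_comax_iff irreducible_dvd_irreducible_monic by blast

section \<open>Factorization into powers of monic irreducible polynomials\<close>

lemma monic_irreducible_factor:
  fixes f :: "'a::field poly"
  assumes "f \<noteq> 0" "\<not> is_unit f"
  shows "\<exists>r. Factorial_Ring.irreducible r \<and> monic r \<and> r dvd f"
  using assms
proof (induction "Polynomial.degree f" arbitrary: f rule: less_induct)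
  case (less f)
  show ?case
  proof (cases "Factorial_Ring.irreducible f")
    case True
    define c where "c = inverse (lead_coeff f)"
    have c: "c \<noteq> 0" using less.prems by (simp add: c_def)
    have eq: "smult c f = [:c:] * f" by simp
    have "is_unit [:c:]" using c by (simp add: is_unit_const_poly_iff dvd_field_iff)
    hence "Factorial_Ring.irreducible (smult c f)" unfolding eq
      using True irreducible_mult_unit_left by blast
    moreover have "monic (smult c f)" using less.prems by (simp add: c_def)
    moreover have "smult c f dvd f" using c by (simp add: smult_dvd_iff)
    ultimately show ?thesis by blast
  next
    case False
    then obtain a b where ab: "f = a * b" "\<not> is_unit a" "\<not> is_unit b"
      using less.prems by (auto simp: Factorial_Ring.irreducible_def)
    have nz: "a \<noteq> 0" "b \<noteq> 0" using ab less.prems by auto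
    have "Polynomial.degree b > 0" using ab(3) nz by (simp add: is_unit_iff_degree)
    hence "Polynomial.degree a < Polynomial.degree f" using ab nz by (simp add: degree_mult_eq)
    from less.hyps[OF this nz(1) ab(2)] show ?thesis using ab by auto
  qed
qed

lemma irreducible_poly_degree_pos:
  fixes r :: "'a::field poly"
  assumes "Factorial_Ring.irreducible r"
  shows "Polynomial.degree r > 0"
proof -
  have "r \<noteq> 0" using assms by auto
  moreover have "\<not> is_unit r" using assms by (rule irreducible_not_unit)
  ultimately
  show ?thesis using is_unit_iff_degree[of r] by blast
qed

lemma irreducible_power_split:
  fixes f :: "'a::field poly"
  assumes "Factorial_Ring.irreducible r" "f \<noteq> 0"
  obtains k g where "f = r ^ k * g" "\<not> r dvd g"
proof -
  have "\<exists>k g. f = r ^ k * g \<and> \<not> r dvd g" using assms(2)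
  proof (induction "Polynomial.degree f" arbitrary: f rule: less_induct)
    case (less f)
    show ?case
    proof (cases "r dvd f")
      case False thus ?thesis by (intro exI[of _ 0] exI[of _ f]) simp
    next
      case True
      then obtain g where g: "f = r * g" by (elim dvdE)
      hence "Polynomial.degree g < Polynomial.degree f" "g \<noteq> 0"
        using less.prems irreducible_poly_degree_pos[OF assms(1)] by (auto simp: degree_mult_eq)
      from less.hyps[OF this] obtain k h where "g = r ^ k * h" "\<not> r dvd h" by auto
      thus ?thesis using g by (intro exI[of _ "Suc k"] exI[of _ h]) (simp add: mult.assoc)
    qed
  qed
  thus ?thesis using that by blast
qed

text \<open>The index set is given in advance and may be larger than the set of factors of
  \<open>f\<close>, so that several polynomials can be factored over the same set and their
  exponents compared.\<close>

lemma prod_power_decomposition: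
  fixes f :: "'a::field poly"
  assumes "finite Rs" "\<And>r. r \<in> Rs \<Longrightarrow> Factorial_Ring.irreducible r \<and> monic r"
    and "\<And>r. Factorial_Ring.irreducible r \<Longrightarrow> monic r \<Longrightarrow> r dvd f \<Longrightarrow> r \<in> Rs" and "monic f"
  shows "\<exists>e. f = (\<Prod>r\<in>Rs. r ^ e r)"
  using assms
proof (induction Rs arbitrary: f rule: finite_induct)
  case empty
  hence "is_unit f" using monic_irreducible_factor[of f] by force
  then obtain c where c: "f = [:c:]" by (metis is_unit_polyE)
  with empty.prems have "f = 1" by (simp add: one_pCons)
  thus ?case by simp
next
  case (insert r Rs)
  have ir: "Factorial_Ring.irreducible r" "monic r" using insert.prems by auto
  have "f \<noteq> 0" using insert.prems by auto
  then obtain k g where kg: "f = r ^ k * g" "\<not> r dvd g" using irreducible_power_split[OF ir(1)] by metis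
  have "monic g" using kg(1) insert.prems(3) ir(2) monic_power[OF ir(2), of k] by (simp add: lead_coeff_mult lead_coeff_power)
  moreover have "s \<in> Rs" if "Factorial_Ring.irreducible s" "monic s" "s dvd g" for s
    using insert.prems(2)[of s] that kg by (metis dvd_mult insertE)
  ultimately obtain e where e: "g = (\<Prod>r\<in>Rs. r ^ e r)" using insert.IH[of g] insert.prems by blast
  have "(\<Prod>s\<in>insert r Rs. s ^ (e(r := k)) s) = r ^ k * (\<Prod>s\<in>Rs. s ^ (e(r := k)) s)"
    using insert.hyps by simp
  also have "(\<Prod>s\<in>Rs. s ^ (e(r := k)) s) = (\<Prod>s\<in>Rs. s ^ e s)"
    using insert.hyps by (intro prod.cong) auto
  finally have "f = (\<Prod>s\<in>insert r Rs. s ^ (e(r := k)) s)" using kg e by simp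
  thus ?case by blast
qed

lemma poly_valuation_prod_power:
  fixes e :: "'a::field poly \<Rightarrow> nat"
  assumes "finite Rs" "\<And>r. r \<in> Rs \<Longrightarrow> Factorial_Ring.irreducible r \<and> monic r"
    and "Factorial_Ring.irreducible r" "monic r"
  shows "poly_valuation r (\<Prod>s\<in>Rs. s ^ e s) = (if r \<in> Rs then e r else 0)"
proof -
  define k where "k = (if r \<in> Rs then e r else 0)"
  define g where "g = (\<Prod>s\<in>Rs - {r}. s ^ e s)"
  have eq: "(\<Prod>s\<in>Rs. s ^ e s) = r ^ k * g"
    unfolding k_def g_def using assms(1) by (auto simp: prod.remove)
  have cg: "comax r g" unfolding g_def
    by (intro comax_prod_right) (metis DiffD1 DiffD2 assms comax_power_left comax_sym irreducible_comax singletonI)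
  show ?thesis unfolding poly_valuation_def eq k_def[symmetric]
  proof (rule Greatest_equality)
    show "r ^ k dvd r ^ k * g" by simp
  next
    fix j assume j: "r ^ j dvd r ^ k * g"
    show "j \<le> k"
    proof (rule ccontr)
      assume "\<not> j \<le> k"
      hence "r ^ k * r dvd r ^ j" by (metis le_imp_power_dvd not_less_eq_eq power_Suc2)
      hence "r ^ k * r dvd r ^ k * g" using j dvd_trans by blast
      hence "r dvd g" using assms(3) by auto
      thus False using cg irreducible_comax_iff[OF assms(3)] by blast
    qed
  qed
qed

section \<open>Direct sums of cyclic modules\<close>

locale poly_module = Modules.module act
  for act :: "'a::field poly \<Rightarrow> 'v::ab_group_add \<Rightarrow> 'v"
begin

definition adjoin :: "'v \<Rightarrow> 'v set \<Rightarrow> 'v set" where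
  "adjoin x S = {act g x + s | g s. s \<in> S}"

definition ssum :: "'v set \<Rightarrow> 'v set \<Rightarrow> 'v set" where
  "ssum S T = {s + t | s t. s \<in> S \<and> t \<in> T}"

text \<open>\<open>S\<close> is an internal direct sum of cyclic submodules whose annihilators are generated by the
  members of \<open>F\<close>: the condition on \<open>g\<close> expresses both that \<open>f\<close> generates the annihilator of \<open>x\<close> and
  that the sum is direct.\<close>

inductive cyclic_sum :: "'v set \<Rightarrow> 'a poly multiset \<Rightarrow> bool" where
  cyclic_sum_empty: "cyclic_sum {0} {#}"
| cyclic_sum_adjoin: "cyclic_sum S F \<Longrightarrow> act f x = 0 \<Longrightarrow> (\<And>g. act g x \<in> S \<Longrightarrow> f dvd g) \<Longrightarrow>
    cyclic_sum (adjoin x S) (add_mset f F)"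

lemma adjoinI: "s \<in> S \<Longrightarrow> act g x + s \<in> adjoin x S"
  by (auto simp: adjoin_def)

lemma subspace_adjoin:
  assumes "subspace S" shows "subspace (adjoin x S)"
proof (rule subspaceI)
  show "0 \<in> adjoin x S" using adjoinI[of 0 S 0 x] assms subspace_0 by simp
next
  fix a b assume "a \<in> adjoin x S" "b \<in> adjoin x S"
  then obtain g s g' s' where ab: "a = act g x + s" "s \<in> S" "b = act g' x + s'" "s' \<in> S"
    unfolding adjoin_def by blast
  have eq: "a + b = act (g + g') x + (s + s')" by (simp add: ab scale_left_distrib algebra_simps)
  show "a + b \<in> adjoin x S" unfolding eq using ab assms by (intro adjoinI subspace_add)
next
  fix c a assume "a \<in> adjoin x S"
  then obtain g s where ab: "a = act g x + s" "s \<in> S" unfolding adjoin_def by blast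
  have eq: "act c a = act (c * g) x + act c s" by (simp add: ab scale_right_distrib)
  show "act c a \<in> adjoin x S" unfolding eq using ab assms by (intro adjoinI subspace_scale)
qed

lemma adjoin_mono: "s \<in> S \<Longrightarrow> s \<in> adjoin x S"
  using adjoinI[of s S 0 x] by simp

lemma adjoin_self: "subspace S \<Longrightarrow> x \<in> adjoin x S"
  using adjoinI[of 0 S 1 x] subspace_0 by simp

lemma adjoin_least: "subspace T \<Longrightarrow> S \<subseteq> T \<Longrightarrow> x \<in> T \<Longrightarrow> adjoin x S \<subseteq> T"
  unfolding adjoin_def by (auto intro!: subspace_add subspace_scale)

lemma cyclic_sum_subspace: "cyclic_sum S F \<Longrightarrow> subspace S"
  by (induction rule: cyclic_sum.induct) (auto intro: subspace_adjoin)

lemma act_dvd_eq_0: "act f x = 0 \<Longrightarrow> f dvd g \<Longrightarrow> act g x = 0"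
  by (metis dvdE mult.commute scale_scale scale_zero_right)

lemma adjoin_commute: "adjoin x (adjoin y S) = adjoin y (adjoin x S)"
proof -
  have "adjoin a (adjoin b S) \<subseteq> adjoin b (adjoin a S)" for a b
  proof
    fix z assume "z \<in> adjoin a (adjoin b S)"
    then obtain g h s where "z = act g a + (act h b + s)" and s: "s \<in> S" unfolding adjoin_def by blast
    hence z: "z = act h b + (act g a + s)" by (simp add: algebra_simps)
    show "z \<in> adjoin b (adjoin a S)" unfolding z by (intro adjoinI s)
  qed
  thus ?thesis by blast
qed

text \<open>Generators are adjoined in some order, but directness does not depend on it, so any of
  them can be made the last one. This justifies recording the annihilators in a multiset.\<close>

lemma cyclic_sum_extract:
  assumes "cyclic_sum S H" "H = add_mset f F"
  shows "\<exists>x S'. S = adjoin x S' \<and> cyclic_sum S' F \<and> act f x = 0 \<and> (\<forall>g. act g x \<in> S' \<longrightarrow> f dvd g)"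
  using assms
proof (induction arbitrary: F rule: cyclic_sum.induct)
  case cyclic_sum_empty thus ?case by simp
next
  case (cyclic_sum_adjoin S0 F0 f0 x0)
  show ?case
  proof (cases "f0 = f")
    case True
    thus ?thesis using cyclic_sum_adjoin by auto
  next
    case False
    then obtain F' where F': "F0 = add_mset f F'" "F = add_mset f0 F'"
      using cyclic_sum_adjoin.prems by (metis add_eq_conv_ex)
    obtain x S' where S': "S0 = adjoin x S'" "cyclic_sum S' F'" "act f x = 0"
      "\<And>g. act g x \<in> S' \<Longrightarrow> f dvd g" using cyclic_sum_adjoin.IH[OF F'(1)] by blast
    have 1: "cyclic_sum (adjoin x0 S') (add_mset f0 F')"
      using cyclic_sum_adjoin.hyps S' by (intro cyclic_sum.cyclic_sum_adjoin) (auto intro: adjoin_mono)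
    \<comment> \<open>The component along \<open>x0\<close> lies in \<open>S0\<close>, hence
      vanishes because \<open>x0\<close> is independent of \<open>S0\<close>; then the independence
      of \<open>x\<close> from \<open>S'\<close> applies.\<close>
    have 2: "f dvd g" if gx: "act g x \<in> adjoin x0 S'" for g
    proof -
      obtain h s where hs: "act g x = act h x0 + s" "s \<in> S'" using gx unfolding adjoin_def by blast
      have "act h x0 = act g x + (- s)" using hs by simp
      also have "\<dots> \<in> S0" unfolding S'(1)
        using hs(2) cyclic_sum_subspace[OF S'(2)] by (intro adjoinI) (auto intro: subspace_neg)
      finally have "f0 dvd h" using cyclic_sum_adjoin.hyps by blast
      hence "act h x0 = 0" using cyclic_sum_adjoin.hyps act_dvd_eq_0 by blast
      thus ?thesis using hs S'(4) by simp
    qed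
    show ?thesis
      by (rule exI[of _ x], rule exI[of _ "adjoin x0 S'"])
        (use 1 2 S' F' adjoin_commute in auto)
  qed
qed

lemma cyclic_sum_add_msetE:
  assumes "cyclic_sum S (add_mset f F)"
  obtains x S' where "S = adjoin x S'" "cyclic_sum S' F" "subspace S'" "act f x = 0"
    "\<And>g. act g x \<in> S' \<Longrightarrow> f dvd g"
  using cyclic_sum_extract[OF assms refl] cyclic_sum_subspace by metis

lemma cyclic_sum_emptyE: "cyclic_sum S {#} \<Longrightarrow> S = {0}"
  by (erule cyclic_sum.cases) auto

lemma adjoin_ssum: "adjoin x (ssum S T) = ssum (adjoin x S) T"
proof (intro equalityI subsetI)
  fix z assume "z \<in> adjoin x (ssum S T)"
  then obtain g s t where "z = act g x + (s + t)" "s \<in> S" "t \<in> T" unfolding adjoin_def ssum_def by blast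
  thus "z \<in> ssum (adjoin x S) T" unfolding ssum_def using adjoinI[of s S g x]
    by (auto simp flip: add.assoc)
next
  fix z assume "z \<in> ssum (adjoin x S) T"
  then obtain g s t where "z = (act g x + s) + t" "s \<in> S" "t \<in> T" unfolding adjoin_def ssum_def by blast
  hence z: "z = act g x + (s + t)" and "s + t \<in> ssum S T" by (auto simp: ssum_def add.assoc)
  thus "z \<in> adjoin x (ssum S T)" unfolding z by (intro adjoinI)
qed

lemma cyclic_sum_ssum:
  assumes "cyclic_sum S F" "cyclic_sum T G" "S \<inter> T \<subseteq> {0}"
  shows "cyclic_sum (ssum S T) (F + G)"
  using assms
proof (induction rule: cyclic_sum.induct)
  case cyclic_sum_empty
  have "ssum {0} T = T" by (auto simp: ssum_def)
  thus ?case using cyclic_sum_empty by simp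
next
  case (cyclic_sum_adjoin S F f x)
  have T: "subspace T" using cyclic_sum_adjoin cyclic_sum_subspace by blast
  have "S \<inter> T \<subseteq> {0}" using cyclic_sum_adjoin.prems adjoin_mono by blast
  hence IH: "cyclic_sum (ssum S T) (F + G)" using cyclic_sum_adjoin by blast
  have "cyclic_sum (adjoin x (ssum S T)) (add_mset f (F + G))"
  proof (rule cyclic_sum.cyclic_sum_adjoin[OF IH cyclic_sum_adjoin.hyps(2)])
    fix g assume "act g x \<in> ssum S T"
    then obtain s t where st: "act g x = s + t" "s \<in> S" "t \<in> T" by (auto simp: ssum_def)
    have S: "subspace S" using cyclic_sum_adjoin cyclic_sum_subspace by blast
    have "t = act g x + (- s)" using st by simp
    also have "\<dots> \<in> adjoin x S" using st S by (intro adjoinI subspace_neg)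
    finally have "t = 0" using st cyclic_sum_adjoin.prems by blast
    thus "f dvd g" using st cyclic_sum_adjoin.hyps by simp
  qed
  thus ?case by (simp add: adjoin_ssum)
qed

section \<open>The Chinese remainder theorem for cyclic summands\<close>

lemma cyclic_sum_merge_forward:
  assumes "comax f g" "cyclic_sum S (add_mset f (add_mset g F))"
  shows "cyclic_sum S (add_mset (f * g) F)"
proof -
  obtain s t where st: "s * f + t * g = 1" using assms(1) unfolding comax_def by blast
  from assms(2) obtain x S1 where x: "S = adjoin x S1" "cyclic_sum S1 (add_mset g F)" "act f x = 0"
    "\<And>h. act h x \<in> S1 \<Longrightarrow> f dvd h" by (metis cyclic_sum_add_msetE)
  from x(2) obtain y S' where y: "S1 = adjoin y S'" "cyclic_sum S' F" "subspace S'" "act g y = 0"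
    "\<And>h. act h y \<in> S' \<Longrightarrow> g dvd h" by (metis cyclic_sum_add_msetE)
  \<comment> \<open>Since \<open>s * f + t * g = 1\<close>, the multipliers \<open>t * g\<close> and
    \<open>s * f\<close> recover \<open>x\<close> and \<open>y\<close> from \<open>z\<close>, so one
    generator suffices.\<close>
  define z where "z = x + y"
  have "act (t * g) z = act (s * f + t * g) x"
    using y(4) x(3) by (simp add: z_def scale_right_distrib scale_left_distrib flip: scale_scale)
  hence zx: "act (t * g) z = x" by (simp add: st)
  have "act (s * f) z = act (s * f + t * g) y"
    using y(4) x(3) by (simp add: z_def scale_right_distrib scale_left_distrib flip: scale_scale)
  hence zy: "act (s * f) z = y" by (simp add: st)
  have sub: "subspace (adjoin z S')" "subspace S"
    using y(3) x(1) y(1) by (auto intro: subspace_adjoin)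
  have zin: "z \<in> adjoin z S'" using y(3) by (rule adjoin_self)
  have "S = adjoin z S'"
  proof
    have "x \<in> adjoin z S'" "y \<in> adjoin z S'"
      using subspace_scale[OF sub(1) zin, of "t * g"] subspace_scale[OF sub(1) zin, of "s * f"] zx zy by auto
    thus "S \<subseteq> adjoin z S'" unfolding x(1) y(1) using sub(1) by (intro adjoin_least) (auto intro: adjoin_mono)
    show "adjoin z S' \<subseteq> S"
    proof (intro adjoin_least sub)
      show "S' \<subseteq> S" unfolding x(1) y(1) by (auto intro!: adjoin_mono)
      have "x \<in> S" unfolding x(1) y(1) by (intro adjoin_self subspace_adjoin y(3))
      moreover have "y \<in> S" unfolding x(1) y(1) by (intro adjoin_mono adjoin_self y(3))
      ultimately show "z \<in> S" unfolding z_def using sub by (intro subspace_add)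
    qed
  qed
  moreover have "cyclic_sum (adjoin z S') (add_mset (f * g) F)"
  proof (intro cyclic_sum.cyclic_sum_adjoin y(2))
    show "act (f * g) z = 0"
      using act_dvd_eq_0[OF x(3), of "f * g"] act_dvd_eq_0[OF y(4), of "f * g"]
      by (simp add: z_def scale_right_distrib)
    fix h assume h: "act h z \<in> S'"
    have "act h x = act (- h) y + act h z" by (simp add: z_def scale_right_distrib)
    hence "act h x \<in> S1" unfolding y(1) using adjoinI[OF h, of "- h" y] by simp
    hence f: "f dvd h" using x(4) by blast
    hence "act h x = 0" using x(3) act_dvd_eq_0 by blast
    hence "g dvd h" using h y(5) by (simp add: z_def scale_right_distrib)
    with f show "f * g dvd h" using assms(1) comax_dvd_mult by blast
  qed
  ultimately show "cyclic_sum S (add_mset (f * g) F)" by simp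
qed

lemma cyclic_sum_merge_backward:
  assumes "comax f g" "cyclic_sum S (add_mset (f * g) F)"
  shows "cyclic_sum S (add_mset f (add_mset g F))"
proof -
  obtain s t where st: "s * f + t * g = 1" using assms(1) unfolding comax_def by blast
  from assms(2) obtain z S' where z: "S = adjoin z S'" "cyclic_sum S' F" "subspace S'" "act (f * g) z = 0"
    "\<And>h. act h z \<in> S' \<Longrightarrow> f * g dvd h" by (metis cyclic_sum_add_msetE)
  define x where "x = act g z"
  define y where "y = act f z"
  have cross: "g dvd h" if "f * g dvd h * f" for h
  proof -
    have "g dvd f * h" using dvd_mult_right[OF that] by (simp add: mult.commute)
    thus ?thesis using comax_dvd_cancel comax_sym assms(1) by blast
  qed
  have D1: "cyclic_sum (adjoin y S') (add_mset g F)"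
  proof (intro cyclic_sum.cyclic_sum_adjoin z(2))
    show "act g y = 0" using z(4) by (simp add: y_def mult.commute)
    fix h assume "act h y \<in> S'"
    thus "g dvd h" using z(5)[of "h * f"] cross by (simp add: y_def)
  qed
  have D2: "cyclic_sum (adjoin x (adjoin y S')) (add_mset f (add_mset g F))"
  proof (rule cyclic_sum.cyclic_sum_adjoin[OF D1])
    show "act f x = 0" using z(4) by (simp add: x_def)
    fix h assume "act h x \<in> adjoin y S'"
    then obtain k s' where k: "act (h * g) z = act (k * f) z + s'" "s' \<in> S'"
      unfolding adjoin_def x_def y_def by auto
    hence "act (h * g - k * f) z \<in> S'" by (simp add: scale_left_diff_distrib)
    hence "f dvd h * g - k * f" using z(5) dvd_mult_left by blast
    hence "f dvd h * g - k * f + k * f" by (intro dvd_add) auto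
    hence "f dvd g * h" by (simp add: mult.commute)
    thus "f dvd h" using assms(1) comax_dvd_cancel by blast
  qed
  have sub: "subspace (adjoin x (adjoin y S'))" "subspace S"
    unfolding z(1) by (intro subspace_adjoin z(3))+
  have xy: "x \<in> adjoin x (adjoin y S')" "y \<in> adjoin x (adjoin y S')"
    by (intro adjoin_self subspace_adjoin z(3), intro adjoin_mono adjoin_self z(3))
  have "adjoin x (adjoin y S') = S"
  proof
    have "z \<in> S" unfolding z(1) using z(3) by (rule adjoin_self)
    hence "x \<in> S" "y \<in> S" using sub by (auto simp: x_def y_def subspace_scale)
    thus "adjoin x (adjoin y S') \<subseteq> S" using sub z(1) by (intro adjoin_least) (auto intro: adjoin_mono)
    have "z = act (s * f + t * g) z" by (simp add: st)
    also have "\<dots> = act s y + act t x" by (simp add: x_def y_def scale_left_distrib)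
    also have "\<dots> \<in> adjoin x (adjoin y S')" using xy sub by (intro subspace_add subspace_scale)
    finally show "S \<subseteq> adjoin x (adjoin y S')"
      unfolding z(1) using sub by (intro adjoin_least) (auto intro: adjoin_mono)
  qed
  with D2 show "cyclic_sum S (add_mset f (add_mset g F))" by simp
qed

lemma cyclic_sum_merge: "comax f g \<Longrightarrow> cyclic_sum S (add_mset f (add_mset g F)) \<longleftrightarrow> cyclic_sum S (add_mset (f * g) F)"
  using cyclic_sum_merge_forward cyclic_sum_merge_backward by blast

text \<open>A generator killed by 1 is zero. Trivial summands can thus be added as padding and
  removed again.\<close>

lemma cyclic_sum_one: "cyclic_sum S (add_mset 1 F) \<longleftrightarrow> cyclic_sum S F"
proof
  assume "cyclic_sum S (add_mset 1 F)"
  then obtain x S' where x: "S = adjoin x S'" "cyclic_sum S' F" "act 1 x = 0" by (metis cyclic_sum_add_msetE)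
  hence "adjoin x S' = S'" unfolding adjoin_def by auto
  thus "cyclic_sum S F" using x by simp
next
  assume "cyclic_sum S F"
  hence "cyclic_sum (adjoin 0 S) (add_mset 1 F)" by (intro cyclic_sum.cyclic_sum_adjoin) auto
  moreover have "adjoin 0 S = S" unfolding adjoin_def by auto
  ultimately show "cyclic_sum S (add_mset 1 F)" by simp
qed

text \<open>Quantifying over arbitrary further summands \<open>G\<close> makes this a congruence for
  sums of multisets, so that replacements can be made inside a larger direct sum.\<close>

definition cyclic_equiv :: "'a poly multiset \<Rightarrow> 'a poly multiset \<Rightarrow> bool" where
  "cyclic_equiv F F' \<longleftrightarrow> (\<forall>S G. cyclic_sum S (F + G) \<longleftrightarrow> cyclic_sum S (F' + G))"

lemma cyclic_equiv_refl [simp]: "cyclic_equiv F F" and cyclic_equiv_sym: "cyclic_equiv F F' \<Longrightarrow> cyclic_equiv F' F"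
  and cyclic_equiv_trans [trans]: "cyclic_equiv F F' \<Longrightarrow> cyclic_equiv F' F'' \<Longrightarrow> cyclic_equiv F F''"
  by (auto simp: cyclic_equiv_def)

lemma cyclic_equiv_sum_iff: "cyclic_equiv F F' \<Longrightarrow> cyclic_sum S F \<longleftrightarrow> cyclic_sum S F'"
  unfolding cyclic_equiv_def by (metis add.right_neutral)

lemma cyclic_equiv_add: "cyclic_equiv F F' \<Longrightarrow> cyclic_equiv G G' \<Longrightarrow> cyclic_equiv (F + G) (F' + G')"
  unfolding cyclic_equiv_def by (metis add.assoc add.commute)

lemma cyclic_equiv_merge: "comax f g \<Longrightarrow> cyclic_equiv {#f, g#} {#f * g#}"
  by (simp add: cyclic_equiv_def cyclic_sum_merge)

lemma cyclic_equiv_one: "cyclic_equiv {#1#} {#}"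
  by (simp add: cyclic_equiv_def cyclic_sum_one)

lemma cyclic_equiv_sum: "(\<And>i. i \<in> I \<Longrightarrow> cyclic_equiv (F i) (G i)) \<Longrightarrow> cyclic_equiv (\<Sum>i\<in>I. F i) (\<Sum>i\<in>I. G i)"
  by (induction I rule: infinite_finite_induct) (auto intro: cyclic_equiv_add)

lemma cyclic_equiv_prod:
  assumes "finite R" "\<And>r s. r \<in> R \<Longrightarrow> s \<in> R \<Longrightarrow> r \<noteq> s \<Longrightarrow> comax (g r) (g s)"
  shows "cyclic_equiv (\<Sum>r\<in>R. {#g r#}) {#\<Prod>r\<in>R. g r#}"
  using assms
proof (induction rule: finite_induct)
  case empty thus ?case using cyclic_equiv_one cyclic_equiv_sym by simp
next
  case (insert r R)
  have cm: "comax (g r) (\<Prod>r\<in>R. g r)"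
    using insert by (intro comax_prod_right) auto
  have "cyclic_equiv ({#g r#} + (\<Sum>r\<in>R. {#g r#})) ({#g r#} + {#\<Prod>r\<in>R. g r#})"
    using insert by (intro cyclic_equiv_add) auto
  also have "cyclic_equiv ({#g r#} + {#\<Prod>r\<in>R. g r#}) {#g r * (\<Prod>r\<in>R. g r)#}"
    using cyclic_equiv_merge[OF cm] by (simp add: add_mset_commute)
  finally show ?case using insert by simp
qed

text \<open>The witness is the multiple of a generator by \<open>f / r\<close>. It turns a divisor
  of an invariant factor into a vector, which regularity can then exclude.\<close>

lemma cyclic_sum_torsion:
  assumes "cyclic_sum S (add_mset f F)" "r dvd f" "f \<noteq> 0" "\<not> is_unit r"
  obtains y where "y \<noteq> 0" "act r y = 0"
proof -
  obtain x S' where x: "cyclic_sum S' F" "subspace S'" "act f x = 0" "\<And>g. act g x \<in> S' \<Longrightarrow> f dvd g"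
    using assms(1) by (metis cyclic_sum_add_msetE)
  obtain k where k: "f = r * k" using assms(2) by (elim dvdE)
  show ?thesis
  proof (rule that[of "act k x"])
    show "act r (act k x) = 0" using x k by simp
    show "act k x \<noteq> 0"
    proof
      assume "act k x = 0"
      hence "act k x \<in> S'" using x(2) subspace_0 by simp
      hence "r * k dvd 1 * k" using x(4) k by simp
      thus False using assms(3,4) k dvd_times_right_cancel_iff[of k r 1] by auto
    qed
  qed
qed

section \<open>Homomorphisms defined on submodules, and kernels\<close>

definition hom_on :: "'v set \<Rightarrow> ('v \<Rightarrow> 'v) \<Rightarrow> bool" where
  "hom_on S \<phi> \<longleftrightarrow> (\<forall>x\<in>S. \<forall>y\<in>S. \<phi> (x + y) = \<phi> x + \<phi> y) \<and> (\<forall>x\<in>S. \<forall>g. \<phi> (act g x) = act g (\<phi> x))"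

text \<open>The expression \<open>act g x + s\<close> determines \<open>g\<close> modulo
  \<open>f\<close>, and then \<open>s\<close>, because \<open>f\<close> kills \<open>x\<close>. As
  \<open>f\<close> also kills \<open>y\<close>, the obvious formula is well defined.\<close>

lemma hom_on_extend:
  assumes S: "subspace S" and "hom_on S \<phi>" and x: "act f x = 0" "\<And>g. act g x \<in> S \<Longrightarrow> f dvd g"
    and y: "act f y = 0"
  obtains \<psi> where "hom_on (adjoin x S) \<psi>" "\<And>s. s \<in> S \<Longrightarrow> \<psi> s = \<phi> s" "\<psi> x = y"
proof -
  define \<psi> where "\<psi> z = (THE w. \<exists>g s. s \<in> S \<and> z = act g x + s \<and> w = act g y + \<phi> s)" for z
  have add: "\<phi> (a + b) = \<phi> a + \<phi> b" if "a \<in> S" "b \<in> S" for a b using assms(2) that by (auto simp: hom_on_def)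
  have hom: "\<phi> (act g a) = act g (\<phi> a)" if "a \<in> S" for a g using assms(2) that by (auto simp: hom_on_def)
  have eq: "\<psi> (act g x + s) = act g y + \<phi> s" if s: "s \<in> S" for g s
  proof (unfold \<psi>_def, rule the_equality)
    show "\<exists>g' s'. s' \<in> S \<and> act g x + s = act g' x + s' \<and> act g y + \<phi> s = act g' y + \<phi> s'" using s by blast
    fix w assume "\<exists>g' s'. s' \<in> S \<and> act g x + s = act g' x + s' \<and> w = act g' y + \<phi> s'"
    then obtain g' s' where w: "s' \<in> S" "act g x + s = act g' x + s'" "w = act g' y + \<phi> s'" by blast
    have e: "act (g - g') x = s' - s" using w(2) by (simp add: scale_left_diff_distrib algebra_simps)
    hence "act (g - g') x \<in> S" using w(1) s S by (simp add: subspace_diff)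
    hence d: "f dvd g - g'" by (rule x(2))
    hence "act (g - g') y = 0" "act (g - g') x = 0" using x(1) y act_dvd_eq_0 by blast+
    thus "w = act g y + \<phi> s" using e w(3) by (simp add: scale_left_diff_distrib)
  qed
  have 0: "\<phi> 0 = 0" using hom[OF subspace_0[OF S], of 0] by simp
  show ?thesis
  proof (rule that[of \<psi>])
    show "\<psi> s = \<phi> s" if "s \<in> S" for s using eq[OF that, of 0] by simp
    show "\<psi> x = y" using eq[OF subspace_0[OF S], of 1] 0 by simp
    show "hom_on (adjoin x S) \<psi>"
      unfolding hom_on_def
    proof safe
      fix a b assume "a \<in> adjoin x S" "b \<in> adjoin x S"
      then obtain g s g' s' where ab: "a = act g x + s" "s \<in> S" "b = act g' x + s'" "s' \<in> S"
        by (auto simp: adjoin_def)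
      have "a + b = act (g + g') x + (s + s')" by (simp add: ab scale_left_distrib algebra_simps)
      hence "\<psi> (a + b) = act (g + g') y + \<phi> (s + s')" using eq[of "s + s'"] ab(2,4) S subspace_add by metis
      thus "\<psi> (a + b) = \<psi> a + \<psi> b" using ab eq add by (simp add: scale_left_distrib algebra_simps)
    next
      fix a h assume "a \<in> adjoin x S"
      then obtain g s where ab: "a = act g x + s" "s \<in> S" by (auto simp: adjoin_def)
      have "act h a = act (h * g) x + act h s" by (simp add: ab scale_right_distrib)
      hence "\<psi> (act h a) = act (h * g) y + \<phi> (act h s)" using eq ab S by (simp add: subspace_scale)
      thus "\<psi> (act h a) = act h (\<psi> a)" using ab eq hom by (simp add: scale_right_distrib)
    qed
  qed
qed

lemma ker_split:
  assumes "comax f g"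
  shows "{x. act (f * g) x = 0} = ssum {x. act f x = 0} {x. act g x = 0}"
    and "{x. act f x = 0} \<inter> {x. act g x = 0} \<subseteq> {0}"
proof -
  obtain s t where st: "s * f + t * g = 1" using assms by (auto simp: comax_def)
  have dec: "x = act (s * f) x + act (t * g) x" for x
  proof -
    have "x = act (s * f + t * g) x" by (simp add: st)
    thus ?thesis by (simp only: scale_left_distrib)
  qed
  show "{x. act f x = 0} \<inter> {x. act g x = 0} \<subseteq> {0}"
  proof safe
    fix x assume "act f x = 0" "act g x = 0"
    hence "act (s * f) x = 0" "act (t * g) x = 0" by (simp_all flip: scale_scale)
    thus "x = 0" using dec[of x] by simp
  qed
  show "{x. act (f * g) x = 0} = ssum {x. act f x = 0} {x. act g x = 0}"
  proof safe
    fix x assume x: "act (f * g) x = 0"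
    have "act g (act (s * f) x) = act s (act (f * g) x)" "act f (act (t * g) x) = act t (act (f * g) x)"
      by (simp_all add: ac_simps)
    hence "act g (act (s * f) x) = 0" "act f (act (t * g) x) = 0" using x by simp_all
    hence "act (t * g) x + act (s * f) x \<in> ssum {x. act f x = 0} {x. act g x = 0}"
      unfolding ssum_def by blast
    thus "x \<in> ssum {x. act f x = 0} {x. act g x = 0}"
      using dec[of x] by (simp add: add.commute)
  next
    fix x assume "x \<in> ssum {x. act f x = 0} {x. act g x = 0}"
    then obtain a b where ab: "x = a + b" "act f a = 0" "act g b = 0" unfolding ssum_def by blast
    have "act (f * g) a = 0" using act_dvd_eq_0[OF ab(2), of "f * g"] by simp
    moreover have "act (f * g) b = 0" using act_dvd_eq_0[OF ab(3), of "f * g"] by simp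
    ultimately show "act (f * g) x = 0" by (simp add: ab(1) scale_right_distrib)
  qed
qed

end

section \<open>Independent generators over a local operator ring\<close>

text \<open>A ring is represented by the set of its operators on the space. It need not be
  commutative: the locale serves both for \<open>F[t]\<close> and for the algebra
  \<open>W(p, q, t + \<alpha> + \<beta>)\<close>.\<close>

locale operator_ring =
  fixes W :: "('v::ab_group_add \<Rightarrow> 'v) set"
  assumes W_additive: "w \<in> W \<Longrightarrow> w (x + y) = w x + w y"
    and W_id: "(\<lambda>x. x) \<in> W" and W_zero: "(\<lambda>x. 0) \<in> W"
    and W_comp: "w \<in> W \<Longrightarrow> w' \<in> W \<Longrightarrow> (\<lambda>x. w (w' x)) \<in> W"
    and W_add: "w \<in> W \<Longrightarrow> w' \<in> W \<Longrightarrow> (\<lambda>x. w x + w' x) \<in> W"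
    and W_uminus: "w \<in> W \<Longrightarrow> (\<lambda>x. - w x) \<in> W"
begin

lemma W_at_zero: "w \<in> W \<Longrightarrow> w 0 = 0"
  using W_additive[of w 0 0] by simp

lemma W_sum: "w \<in> W \<Longrightarrow> w (sum f A) = (\<Sum>a\<in>A. w (f a))"
  by (induction A rule: infinite_finite_induct) (auto simp: W_at_zero W_additive)

definition stable :: "'v set \<Rightarrow> bool" where
  "stable T \<longleftrightarrow> 0 \<in> T \<and> (\<forall>x\<in>T. \<forall>y\<in>T. x + y \<in> T) \<and> (\<forall>w\<in>W. \<forall>x\<in>T. w x \<in> T)"

definition wspan :: "nat \<Rightarrow> (nat \<Rightarrow> 'v) \<Rightarrow> 'v set" where
  "wspan n x = {\<Sum>i<n. w i (x i) | w. \<forall>i<n. w i \<in> W}"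

lemma stable_uminus: "stable T \<Longrightarrow> x \<in> T \<Longrightarrow> - x \<in> T"
  using W_uminus[OF W_id] unfolding stable_def by blast

lemma stable_diff: "stable T \<Longrightarrow> x \<in> T \<Longrightarrow> y \<in> T \<Longrightarrow> x - y \<in> T"
  using stable_uminus[of T y] unfolding stable_def by (metis diff_conv_add_uminus)

lemma stable_sum: "stable T \<Longrightarrow> (\<And>i. i \<in> I \<Longrightarrow> f i \<in> T) \<Longrightarrow> sum f I \<in> T"
  by (induction I rule: infinite_finite_induct) (auto simp: stable_def)

lemma wspanI: "(\<And>i. i < n \<Longrightarrow> w i \<in> W) \<Longrightarrow> (\<Sum>i<n. w i (x i)) \<in> wspan n x"
  unfolding wspan_def by blast

lemma stable_wspan: "stable (wspan n x)"
  unfolding stable_def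
proof (intro conjI ballI)
  have "(\<Sum>i<n. (\<lambda>_. 0) (x i)) \<in> wspan n x" by (rule wspanI) (rule W_zero)
  thus "0 \<in> wspan n x" by simp
next
  fix a b assume "a \<in> wspan n x" "b \<in> wspan n x"
  then obtain w w' where w: "a = (\<Sum>i<n. w i (x i))" "b = (\<Sum>i<n. w' i (x i))"
    "\<forall>i<n. w i \<in> W" "\<forall>i<n. w' i \<in> W" unfolding wspan_def by blast
  have "(\<Sum>i<n. (\<lambda>v. w i v + w' i v) (x i)) \<in> wspan n x"
    using w W_add by (intro wspanI[of n "\<lambda>i v. w i v + w' i v"]) blast
  thus "a + b \<in> wspan n x" by (simp add: w sum.distrib)
next
  fix v a assume v: "v \<in> W" and "a \<in> wspan n x"
  then obtain w where w: "a = (\<Sum>i<n. w i (x i))" "\<forall>i<n. w i \<in> W" unfolding wspan_def by blast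
  have "(\<Sum>i<n. (\<lambda>z. v (w i z)) (x i)) \<in> wspan n x"
    using w W_comp[OF v] by (intro wspanI[of n "\<lambda>i z. v (w i z)"]) blast
  thus "v a \<in> wspan n x" by (simp add: w W_sum[OF v])
qed

lemma wspan_generator: "i < n \<Longrightarrow> x i \<in> wspan n x"
proof -
  assume i: "i < n"
  have "(\<Sum>j<n. (if j = i then (\<lambda>v. v) else (\<lambda>v. 0)) (x j)) \<in> wspan n x"
    by (rule wspanI[of n "\<lambda>j. if j = i then (\<lambda>v. v) else (\<lambda>v. 0)"]) (simp add: W_id W_zero)
  also have "(\<Sum>j<n. (if j = i then (\<lambda>v. v) else (\<lambda>v. 0)) (x j)) = (\<Sum>j<n. if j = i then x j else 0)"
    by (intro sum.cong) auto
  also have "\<dots> = x i" using i by simp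
  finally show ?thesis .
qed

lemma wspan_least: "stable T \<Longrightarrow> (\<And>i. i < n \<Longrightarrow> x i \<in> T) \<Longrightarrow> wspan n x \<subseteq> T"
proof
  fix v assume T: "stable T" "\<And>i. i < n \<Longrightarrow> x i \<in> T" and "v \<in> wspan n x"
  then obtain w where w: "v = (\<Sum>i<n. w i (x i))" "\<forall>i<n. w i \<in> W" unfolding wspan_def by blast
  show "v \<in> T" unfolding w(1)
  proof (rule stable_sum[OF T(1)])
    fix i assume "i \<in> {..<n}"
    thus "w i (x i) \<in> T" using T w(2) unfolding stable_def by blast
  qed
qed

text \<open>Among all generating families of a given length, one with minimal total order is
  independent: in a nontrivial relation, the term divisible by the least power of \<open>\<pi>\<close> has a
  generator that can be exchanged for one of smaller order.\<close>

lemma independent_generators: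
  assumes S: "stable S" and pi: "\<pi> \<in> W"
    and central: "\<And>w x. w \<in> W \<Longrightarrow> x \<in> S \<Longrightarrow> w (\<pi> x) = \<pi> (w x)"
    and nil: "\<And>x. x \<in> S \<Longrightarrow> (\<pi> ^^ N) x = 0"
    and factor: "\<And>w. w \<in> W \<Longrightarrow> (\<forall>x\<in>S. w x = 0) \<or>
      (\<exists>k h h'. h \<in> W \<and> h' \<in> W \<and> (\<forall>x\<in>S. w x = (\<pi> ^^ k) (h x) \<and> h' (h x) = x))"
    and gen: "wspan n x0 = S"
  obtains x where "wspan n x = S"
    "\<And>w. (\<And>i. i < n \<Longrightarrow> w i \<in> W) \<Longrightarrow> (\<Sum>i<n. w i (x i)) = 0 \<Longrightarrow> (\<And>i. i < n \<Longrightarrow> w i (x i) = 0)"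
proof -
  define ord where "ord v = (LEAST k. (\<pi> ^^ k) v = 0)" for v
  define tot where "tot x = (\<Sum>i<n. ord (x i))" for x :: "nat \<Rightarrow> 'v"
  have "\<exists>x. wspan n x = S \<and> (\<forall>y. wspan n y = S \<longrightarrow> tot x \<le> tot y)"
    by (rule ex_has_least_nat[of "\<lambda>x. wspan n x = S", OF gen])
  then obtain x where x: "wspan n x = S" and xmin: "\<And>y. wspan n y = S \<Longrightarrow> tot x \<le> tot y" by blast
  have xS: "x i \<in> S" if "i < n" for i using wspan_generator[OF that, of x] x by simp
  have powW: "(\<pi> ^^ k) \<in> W" for k
  proof (induction k)
    case 0 thus ?case using W_id by (simp add: id_def)
  next
    case (Suc k) thus ?case using W_comp[OF pi Suc] by (simp add: o_def)
  qed
  have WS: "w v \<in> S" if "w \<in> W" "v \<in> S" for w v using S that by (auto simp: stable_def)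
  have comm: "w ((\<pi> ^^ k) v) = (\<pi> ^^ k) (w v)" if "w \<in> W" "v \<in> S" for w k v
  proof (induction k)
    case (Suc k)
    have "(\<pi> ^^ k) v \<in> S" using WS[OF powW that(2)] .
    thus ?case using Suc central[OF that(1)] by simp
  qed simp
  have ord0: "(\<pi> ^^ ord v) v = 0" if "v \<in> S" for v
    unfolding ord_def by (rule LeastI[of "\<lambda>k. (\<pi> ^^ k) v = 0"]) (rule nil[OF that])
  have ordle: "(\<pi> ^^ k) v = 0 \<Longrightarrow> ord v \<le> k" for k v unfolding ord_def by (rule Least_le)
  show ?thesis
  proof (rule that[OF x], rule ccontr)
    fix w j assume wW: "\<And>i. i < n \<Longrightarrow> w i \<in> W" and relations: "(\<Sum>i<n. w i (x i)) = 0"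
      and j: "j < n" and wj: "w j (x j) \<noteq> 0"
    define J where "J = {i. i < n \<and> w i (x i) \<noteq> 0}"
    have J: "finite J" "J \<noteq> {}" using j wj by (auto simp: J_def)
    have "\<forall>i\<in>J. \<exists>k h h'. h \<in> W \<and> h' \<in> W \<and> (\<forall>x\<in>S. w i x = (\<pi> ^^ k) (h x) \<and> h' (h x) = x)"
    proof
      fix i assume i: "i \<in> J"
      have in': "i < n" "w i (x i) \<noteq> 0" using i by (auto simp: J_def)
      have "\<not> (\<forall>x\<in>S. w i x = 0)" using in' xS by blast
      thus "\<exists>k h h'. h \<in> W \<and> h' \<in> W \<and> (\<forall>x\<in>S. w i x = (\<pi> ^^ k) (h x) \<and> h' (h x) = x)"
        using factor[OF wW[OF in'(1)]] by blast
    qed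
    from bchoice[OF this] obtain k where "\<forall>i\<in>J. \<exists>h h'. h \<in> W \<and> h' \<in> W \<and>
      (\<forall>x\<in>S. w i x = (\<pi> ^^ k i) (h x) \<and> h' (h x) = x)" by blast
    from bchoice[OF this] obtain h where "\<forall>i\<in>J. \<exists>h'. h i \<in> W \<and> h' \<in> W \<and>
      (\<forall>x\<in>S. w i x = (\<pi> ^^ k i) (h i x) \<and> h' (h i x) = x)" by blast
    from bchoice[OF this] obtain h' where kh: "\<And>i. i \<in> J \<Longrightarrow> h i \<in> W" "\<And>i. i \<in> J \<Longrightarrow> h' i \<in> W"
      "\<And>i v. i \<in> J \<Longrightarrow> v \<in> S \<Longrightarrow> w i v = (\<pi> ^^ k i) (h i v)"
      "\<And>i v. i \<in> J \<Longrightarrow> v \<in> S \<Longrightarrow> h' i (h i v) = v" by blast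
    obtain i0 where i0: "i0 \<in> J" and kmin: "\<And>i. i \<in> J \<Longrightarrow> k i0 \<le> k i"
      using ex_has_least_nat[of "\<lambda>i. i \<in> J" _ k] J(2) by blast
    have Jn: "i < n" "x i \<in> S" if "i \<in> J" for i using that xS by (auto simp: J_def)
    \<comment> \<open>The relation divided by \<open>\<pi> ^^ k i0\<close>. At \<open>i0\<close>
      only the invertible \<open>h i0\<close> is left, so \<open>y\<close> can replace
      \<open>x i0\<close> as a generator, and \<open>\<pi> ^^ k i0\<close> kills
      \<open>y\<close>.\<close>
    define y where "y = (\<Sum>i\<in>J. (\<pi> ^^ (k i - k i0)) (h i (x i)))"
    define x' where "x' = x(i0 := y)"
    have termS: "(\<pi> ^^ m) (h i (x i)) \<in> S" if "i \<in> J" for i m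
      by (rule WS[OF powW WS[OF kh(1)[OF that] Jn(2)[OF that]]])
    have yS: "y \<in> S" unfolding y_def using S termS by (intro stable_sum) auto
    have "(\<pi> ^^ k i0) y = (\<Sum>i\<in>J. (\<pi> ^^ k i0) ((\<pi> ^^ (k i - k i0)) (h i (x i))))"
      unfolding y_def by (rule W_sum[OF powW])
    also have "\<dots> = (\<Sum>i\<in>J. w i (x i))"
    proof (rule sum.cong)
      fix i assume i: "i \<in> J"
      have "(\<pi> ^^ k i0) ((\<pi> ^^ (k i - k i0)) (h i (x i))) = (\<pi> ^^ (k i0 + (k i - k i0))) (h i (x i))"
        by (simp add: funpow_add)
      also have "\<dots> = w i (x i)" using kmin[OF i] kh(3)[OF i Jn(2)[OF i]] by simp
      finally show "(\<pi> ^^ k i0) ((\<pi> ^^ (k i - k i0)) (h i (x i))) = w i (x i)" .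
    qed simp
    also have "\<dots> = (\<Sum>i<n. w i (x i))"
      by (rule sum.mono_neutral_left) (auto simp: J_def)
    finally have y0: "(\<pi> ^^ k i0) y = 0" using relations by simp
    \<comment> \<open>Otherwise the term of the relation at \<open>i0\<close> would vanish, against
      the choice of \<open>J\<close>. So the exchange strictly lowers the order.\<close>
    have "k i0 < ord (x i0)"
    proof (rule ccontr)
      assume "\<not> k i0 < ord (x i0)"
      then obtain d where d: "k i0 = d + ord (x i0)" by (metis add.commute le_Suc_ex not_less)
      have "(\<pi> ^^ k i0) (x i0) = (\<pi> ^^ d) ((\<pi> ^^ ord (x i0)) (x i0))" by (simp add: d funpow_add)
      also have "\<dots> = 0" using ord0[OF Jn(2)[OF i0]] W_at_zero[OF powW] by simp
      finally have "(\<pi> ^^ k i0) (x i0) = 0" .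
      hence "w i0 (x i0) = 0"
        using kh(3)[OF i0 Jn(2)[OF i0]] comm[OF kh(1)[OF i0] Jn(2)[OF i0], of "k i0"]
          W_at_zero[OF kh(1)[OF i0]] by simp
      thus False using i0 by (simp add: J_def)
    qed
    hence lt: "ord y < ord (x i0)" using ordle[OF y0] by simp
    have "tot x' < tot x" unfolding tot_def
    proof (rule sum_strict_mono_ex1)
      show "\<forall>i\<in>{..<n}. ord (x' i) \<le> ord (x i)" using lt by (auto simp: x'_def)
      show "\<exists>i\<in>{..<n}. ord (x' i) < ord (x i)"
        using lt Jn(1)[OF i0] by (intro bexI[of _ i0]) (auto simp: x'_def)
    qed simp
    moreover have "wspan n x' = S"
    proof
      show "wspan n x' \<subseteq> S" using S xS yS by (intro wspan_least) (auto simp: x'_def)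
      let ?T = "wspan n x'"
      have T: "stable ?T" by (rule stable_wspan)
      have TW: "v \<in> W \<Longrightarrow> z \<in> ?T \<Longrightarrow> v z \<in> ?T" for v z using T by (auto simp: stable_def)
      have other: "x i \<in> ?T" if "i < n" "i \<noteq> i0" for i
        using wspan_generator[OF that(1), of x'] that by (simp add: x'_def)
      have yT: "y \<in> ?T" using wspan_generator[OF Jn(1)[OF i0], of x'] by (simp add: x'_def)
      have "y = h i0 (x i0) + (\<Sum>i\<in>J - {i0}. (\<pi> ^^ (k i - k i0)) (h i (x i)))"
        unfolding y_def using J(1) i0 by (simp add: sum.remove)
      hence "h i0 (x i0) = y - (\<Sum>i\<in>J - {i0}. (\<pi> ^^ (k i - k i0)) (h i (x i)))" by simp
      also have "\<dots> \<in> ?T"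
      proof (intro stable_diff[OF T yT] stable_sum[OF T])
        fix i assume i: "i \<in> J - {i0}"
        hence "x i \<in> ?T" using Jn(1) other by blast
        thus "(\<pi> ^^ (k i - k i0)) (h i (x i)) \<in> ?T" using TW[OF powW] TW[OF kh(1)] i by blast
      qed
      finally have "h' i0 (h i0 (x i0)) \<in> ?T" using TW kh(2)[OF i0] by blast
      hence "x i0 \<in> ?T" using kh(4)[OF i0 Jn(2)[OF i0]] by simp
      hence "wspan n x \<subseteq> ?T" using T other by (intro wspan_least) auto
      thus "S \<subseteq> ?T" using x by simp
    qed
    ultimately show False using xmin[of x'] by simp
  qed
qed

end

section \<open>Representing matrices and cyclic decompositions\<close>

locale endo = vector_space scale for scale :: "'a::field \<Rightarrow> 'v::ab_group_add \<Rightarrow> 'v" (infixr "*s" 75) +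
  fixes u :: "'v \<Rightarrow> 'v"
  assumes linear_u: "Vector_Spaces.linear scale scale u"
begin

lemma u_add: "u (x + y) = u x + u y" and u_scale: "u (c *s x) = c *s u x"
  using linear_u by (simp_all add: Vector_Spaces.linear_iff)

lemma u_zero [simp]: "u 0 = 0"
  using u_scale[of 0 0] by simp

lemma u_uminus: "u (- x) = - u x"
  using u_scale[of "-1" x] by simp

lemma u_diff: "u (x - y) = u x - u y"
  using u_add[of x "- y"] by (simp add: u_uminus)

lemma u_sum: "u (sum f A) = (\<Sum>a\<in>A. u (f a))"
  by (induction A rule: infinite_finite_induct) (auto simp: u_add)

definition act :: "'a poly \<Rightarrow> 'v \<Rightarrow> 'v" where
  "act f x = poly_end scale f u x"

lemma act_bound:
  assumes "Polynomial.degree f \<le> n"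
  shows "act f x = (\<Sum>i\<le>n. Polynomial.coeff f i *s (u ^^ i) x)"
  unfolding act_def poly_end_def
  by (rule sum.mono_neutral_left) (use assms in \<open>auto simp: coeff_eq_0\<close>)

lemma act_less:
  assumes "f = 0 \<or> Polynomial.degree f < n"
  shows "act f x = (\<Sum>i<n. Polynomial.coeff f i *s (u ^^ i) x)"
proof (cases n)
  case 0
  thus ?thesis using assms by (simp add: act_def poly_end_def)
next
  case (Suc m)
  thus ?thesis using act_bound[of f m x] assms by (auto simp: lessThan_Suc_atMost)
qed

lemma act_0 [simp]: "act 0 x = 0"
  by (simp add: act_def poly_end_def)

lemma act_pCons: "act (pCons c f) x = c *s x + u (act f x)"
proof -
  have "act (pCons c f) x = (\<Sum>i\<le>Suc (Polynomial.degree f). Polynomial.coeff (pCons c f) i *s (u ^^ i) x)"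
    by (rule act_bound) (rule degree_pCons_le)
  also have "\<dots> = c *s x + (\<Sum>i\<le>Polynomial.degree f. Polynomial.coeff f i *s (u ^^ Suc i) x)"
    by (subst sum.atMost_Suc_shift) simp
  also have "\<dots> = c *s x + u (act f x)"
    by (simp add: act_def poly_end_def u_sum u_scale)
  finally show ?thesis .
qed

lemma act_add_right: "act f (x + y) = act f x + act f y"
  by (induction f) (auto simp: act_pCons scale_right_distrib u_add algebra_simps)

lemma act_scale: "act f (c *s x) = c *s act f x"
  by (induction f) (auto simp: act_pCons scale_right_distrib u_scale mult.commute)

lemma act_add_left: "act (f + g) x = act f x + act g x"
proof (induction f arbitrary: g)
  case (pCons c f)
  obtain d g' where g: "g = pCons d g'" by (cases g)
  show ?case using pCons.IH[of g'] by (simp add: g act_pCons u_add scale_left_distrib algebra_simps)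
qed simp

lemma act_smult: "act (smult c f) x = c *s act f x"
  by (induction f) (auto simp: act_pCons scale_right_distrib u_scale)

lemma act_mult: "act f (act g x) = act (f * g) x"
  by (induction f) (auto simp: act_pCons act_add_left act_smult)

sublocale U: poly_module act
  by unfold_locales (auto simp: act_add_right act_add_left act_mult act_pCons one_pCons)

lemma act_const [simp]: "act [:c:] x = c *s x"
  by (simp add: act_pCons)

lemma act_X: "act [:0, 1:] x = u x"
  by (simp add: act_pCons)

text \<open>Coefficients are indexed by positions, so a repeated vector counts as a dependence. This
  suits concatenations of lists.\<close>

definition lindep_list :: "'v list \<Rightarrow> bool" where
  "lindep_list bs \<longleftrightarrow> (\<exists>c. (\<Sum>i<length bs. c i *s bs ! i) = 0 \<and> (\<exists>i<length bs. c i \<noteq> 0))"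

lemma lindep_listD:
  "\<not> lindep_list bs \<Longrightarrow> (\<Sum>i<length bs. c i *s bs ! i) = 0 \<Longrightarrow> i < length bs \<Longrightarrow> c i = 0"
  unfolding lindep_list_def by blast

lemma lindep_list_iff: "\<not> lindep_list bs \<longleftrightarrow> distinct bs \<and> \<not> dependent (set bs)"
proof
  assume nd: "\<not> lindep_list bs"
  have "distinct bs"
  proof (rule ccontr)
    assume "\<not> distinct bs"
    then obtain i j where ij: "i < length bs" "j < length bs" "i \<noteq> j" "bs ! i = bs ! j"
      by (auto simp: distinct_conv_nth)
    define c where "c k = (if k = i then 1 else 0) - (if k = j then 1 else (0::'a))" for k
    have "(\<Sum>k<length bs. c k *s bs ! k) =
      (\<Sum>k<length bs. (if k = i then bs ! k else 0)) - (\<Sum>k<length bs. (if k = j then bs ! k else 0))"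
      unfolding c_def sum_subtractf[symmetric] by (intro sum.cong) (auto simp: scale_left_diff_distrib)
    also have "\<dots> = 0" using ij by simp
    finally have "c i = 0" using lindep_listD[OF nd _ ij(1)] by blast
    thus False using ij(3) by (simp add: c_def)
  qed
  moreover have "\<not> dependent (set bs)"
  proof
    assume "dependent (set bs)"
    then obtain c v where c: "v \<in> set bs" "c v \<noteq> 0" "(\<Sum>v\<in>set bs. c v *s v) = 0"
      using dependent_finite[of "set bs"] by auto
    have "(\<Sum>i<length bs. c (bs ! i) *s bs ! i) = (\<Sum>v\<in>set bs. c v *s v)"
      by (rule sum.reindex_bij_betw) (rule bij_betw_nth[OF \<open>distinct bs\<close>], auto)
    moreover obtain i where "i < length bs" "v = bs ! i" using c(1) by (metis in_set_conv_nth)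
    ultimately show False using lindep_listD[OF nd, of "\<lambda>i. c (bs ! i)" i] c by simp
  qed
  ultimately show "distinct bs \<and> \<not> dependent (set bs)" by blast
next
  assume d: "distinct bs \<and> \<not> dependent (set bs)"
  have bij: "bij_betw ((!) bs) {..<length bs} (set bs)" using d by (intro bij_betw_nth) auto
  show "\<not> lindep_list bs"
  proof
    assume "lindep_list bs"
    then obtain c i where c: "(\<Sum>i<length bs. c i *s bs ! i) = 0" "i < length bs" "c i \<noteq> 0"
      unfolding lindep_list_def by blast
    define e where "e v = c (the_inv_into {..<length bs} ((!) bs) v)" for v
    have e: "e (bs ! k) = c k" if "k < length bs" for k
      unfolding e_def using bij that by (simp add: the_inv_into_f_f bij_betw_def)
    have "(\<Sum>v\<in>set bs. e v *s v) = (\<Sum>i<length bs. e (bs ! i) *s bs ! i)"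
      by (rule sum.reindex_bij_betw[OF bij, symmetric])
    also have "\<dots> = 0" using c(1) e by simp
    finally have "(\<Sum>v\<in>set bs. e v *s v) = 0" .
    moreover have "\<exists>v\<in>set bs. e v \<noteq> 0" using c(2,3) e by (intro bexI[of _ "bs ! i"]) simp_all
    ultimately have "dependent (set bs)" using dependent_finite[of "set bs"] by blast
    thus False using d by blast
  qed
qed

lemma span_list: "span (set bs) = {\<Sum>i<length bs. c i *s bs ! i | c. True}" (is "_ = ?R")
proof
  have RI: "(\<Sum>i<length bs. c i *s bs ! i) \<in> ?R" for c
    by (intro CollectI exI[of _ c] conjI refl TrueI)
  have "subspace ?R"
  proof (rule subspaceI)
    show "0 \<in> ?R" using RI[of "\<lambda>_. 0"] by simp
  next
    fix x y assume "x \<in> ?R" "y \<in> ?R"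
    then obtain c d where "x = (\<Sum>i<length bs. c i *s bs ! i)" "y = (\<Sum>i<length bs. d i *s bs ! i)" by blast
    hence "x + y = (\<Sum>i<length bs. (\<lambda>i. c i + d i) i *s bs ! i)"
      by (simp add: scale_left_distrib sum.distrib)
    thus "x + y \<in> ?R" using RI by (simp only:)
  next
    fix a x assume "x \<in> ?R"
    then obtain c where "x = (\<Sum>i<length bs. c i *s bs ! i)" by blast
    hence "a *s x = (\<Sum>i<length bs. (\<lambda>i. a * c i) i *s bs ! i)" by (simp add: scale_sum_right)
    thus "a *s x \<in> ?R" using RI by (simp only:)
  qed
  moreover have "set bs \<subseteq> ?R"
  proof
    fix v assume "v \<in> set bs"
    then obtain k where k: "k < length bs" "v = bs ! k" by (metis in_set_conv_nth)
    have "(\<Sum>i<length bs. (\<lambda>i. if i = k then 1 else 0) i *s bs ! i) = (\<Sum>i<length bs. if i = k then bs ! i else 0)"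
      by (intro sum.cong) auto
    also have "\<dots> = v" using k by simp
    finally show "v \<in> ?R" using RI[of "\<lambda>i. if i = k then 1 else 0"] by simp
  qed
  ultimately show "span (set bs) \<subseteq> ?R" by (intro span_minimal)
  show "?R \<subseteq> span (set bs)" by (auto intro!: span_sum span_scale span_base[OF nth_mem])
qed

lemma span_listI: "(\<Sum>i<length bs. c i *s bs ! i) \<in> span (set bs)"
  unfolding span_list by (intro CollectI exI[of _ c] conjI refl TrueI)

text \<open>The matrix equation alone, without the requirement of a basis, so that it can be split
  along a concatenation of lists.\<close>

definition intertwines :: "'v list \<Rightarrow> 'a mat \<Rightarrow> bool" where
  "intertwines bs M \<longleftrightarrow> (\<forall>j<length bs. u (bs ! j) = (\<Sum>i<length bs. M $$ (i, j) *s bs ! i))"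

lemma represented_by_iff:
  "represented_by scale u M \<longleftrightarrow> (\<exists>bs. \<not> lindep_list bs \<and> span (set bs) = UNIV \<and>
     M \<in> carrier_mat (length bs) (length bs) \<and> intertwines bs M)"
  unfolding represented_by_def is_basis_list_def intertwines_def lindep_list_iff by blast

lemma sum_lessThan_add: "(\<Sum>i<n + m. f i) = (\<Sum>i<n. f i) + (\<Sum>i<m. f (n + i))" for f :: "nat \<Rightarrow> 'v"
  by (induction m) (auto simp: add.assoc)

lemma all_less_add_iff: "(\<forall>j<n + m. P j) \<longleftrightarrow> (\<forall>j<n. P j) \<and> (\<forall>j<m. P (n + j))" for n m :: nat
proof (intro iffI conjI allI impI)
  fix j assume P: "(\<forall>j<n. P j) \<and> (\<forall>j<m. P (n + j))" and j: "j < n + m"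
  show "P j"
  proof (cases "j < n")
    case False
    hence "j - n < m" "n + (j - n) = j" using j by auto
    thus ?thesis using P by metis
  qed (use P in blast)
qed auto

lemma intertwines_block:
  assumes A: "A \<in> carrier_mat n n" and D: "D \<in> carrier_mat m m"
    and l: "length bs = n" "length cs = m"
  shows "intertwines (bs @ cs) (four_block_mat A (0\<^sub>m n m) (0\<^sub>m m n) D) \<longleftrightarrow> intertwines bs A \<and> intertwines cs D"
proof -
  let ?M = "four_block_mat A (0\<^sub>m n m) (0\<^sub>m m n) D"
  have 1: "(\<Sum>i<n + m. ?M $$ (i, j) *s (bs @ cs) ! i) = (\<Sum>i<n. A $$ (i, j) *s bs ! i)" if "j < n" for j
    unfolding sum_lessThan_add using A D l that by (simp add: nth_append)
  have 2: "(\<Sum>i<n + m. ?M $$ (i, n + j) *s (bs @ cs) ! i) = (\<Sum>i<m. D $$ (i, j) *s cs ! i)" if "j < m" for j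
    unfolding sum_lessThan_add using A D l that by (simp add: nth_append)
  have "intertwines (bs @ cs) ?M \<longleftrightarrow>
     (\<forall>j<n. u ((bs @ cs) ! j) = (\<Sum>i<n + m. ?M $$ (i, j) *s (bs @ cs) ! i)) \<and>
     (\<forall>j<m. u ((bs @ cs) ! (n + j)) = (\<Sum>i<n + m. ?M $$ (i, n + j) *s (bs @ cs) ! i))"
    unfolding intertwines_def length_append l by (rule all_less_add_iff)
  also have "\<dots> \<longleftrightarrow> intertwines bs A \<and> intertwines cs D"
    unfolding intertwines_def l using 1 2 l by (simp add: nth_append)
  finally show ?thesis .
qed

section \<open>Krylov lists and companion matrices\<close>

definition krylov :: "'v \<Rightarrow> nat \<Rightarrow> 'v list" where
  "krylov x n = map (\<lambda>i. (u ^^ i) x) [0..<n]"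

lemma length_krylov [simp]: "length (krylov x n) = n"
  and krylov_nth [simp]: "i < n \<Longrightarrow> krylov x n ! i = (u ^^ i) x"
  by (simp_all add: krylov_def)

lemma companion_carrier: "companion f \<in> carrier_mat (Polynomial.degree f) (Polynomial.degree f)"
  by (simp add: companion_def Let_def)

lemma act_monic:
  assumes "monic f"
  shows "act f x = (\<Sum>i<Polynomial.degree f. Polynomial.coeff f i *s (u ^^ i) x) + (u ^^ Polynomial.degree f) x"
  using assms by (simp add: act_bound[OF order_refl] flip: lessThan_Suc_atMost)

text \<open>The subdiagonal makes every vector the image of its predecessor, and the last column
  then says that \<open>f\<close> kills the first one. In degree 0, \<open>f = 1\<close> and
  \<open>x = 0\<close> is the witness.\<close>

lemma intertwines_companion:
  assumes f: "monic f" and n: "Polynomial.degree f = n" and l: "length bs = n"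
  shows "intertwines bs (companion f) \<longleftrightarrow> (\<exists>x. bs = krylov x n \<and> act f x = 0)"
proof -
  have col1: "(\<Sum>i<n. companion f $$ (i, j) *s bs ! i) = bs ! Suc j" if "Suc j < n" for j
  proof -
    have "(\<Sum>i<n. companion f $$ (i, j) *s bs ! i) = (\<Sum>i<n. if i = Suc j then bs ! i else 0)"
      using that n by (intro sum.cong) (auto simp: companion_def)
    thus ?thesis using that by simp
  qed
  have col2: "(\<Sum>i<n. companion f $$ (i, n - 1) *s bs ! i) = - (\<Sum>i<n. Polynomial.coeff f i *s bs ! i)"
    using n by (auto simp: companion_def sum_negf[symmetric] intro!: sum.cong)
  show ?thesis
  proof (cases "n = 0")
    case True
    hence "f = 1" using f n by (metis degree_eq_zeroE lead_coeff_pCons(2) lead_coeff_pCons(1) one_pCons pCons_0_0 pCons_one)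
    thus ?thesis using True l by (auto simp: intertwines_def krylov_def)
  next
    case False
    show ?thesis
    proof
      assume it: "intertwines bs (companion f)"
      define x where "x = bs ! 0"
      have pow: "j < n \<Longrightarrow> bs ! j = (u ^^ j) x" for j
      proof (induction j)
        case (Suc j)
        have "u (bs ! j) = (\<Sum>i<n. companion f $$ (i, j) *s bs ! i)"
          using it Suc.prems l unfolding intertwines_def by simp
        also have "\<dots> = bs ! Suc j" by (rule col1[OF Suc.prems])
        finally show ?case using Suc by simp
      qed (simp add: x_def)
      have "u (bs ! (n - 1)) = - (\<Sum>i<n. Polynomial.coeff f i *s bs ! i)"
        using it False l col2 by (simp add: intertwines_def)
      moreover have "u (bs ! (n - 1)) = (u ^^ n) x" using pow[of "n - 1"] False
        by (metis One_nat_def Suc_pred diff_Suc_less funpow.simps(2) neq0_conv o_apply)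
      ultimately have s: "(u ^^ n) x = - (\<Sum>i<n. Polynomial.coeff f i *s (u ^^ i) x)" using pow by simp
      have "act f x = 0" unfolding act_monic[OF f] n s by simp
      moreover have "bs = krylov x n" using pow l by (auto simp: list_eq_iff_nth_eq)
      ultimately show "\<exists>x. bs = krylov x n \<and> act f x = 0" by blast
    next
      assume "\<exists>x. bs = krylov x n \<and> act f x = 0"
      then obtain x where x: "bs = krylov x n" "act f x = 0" by blast
      show "intertwines bs (companion f)"
        unfolding intertwines_def l
      proof (intro allI impI)
        fix j assume j: "j < n"
        show "u (bs ! j) = (\<Sum>i<n. companion f $$ (i, j) *s bs ! i)"
        proof (cases "Suc j < n")
          case True thus ?thesis using col1[OF True] x by simp
        next
          case False
          hence jn: "j = n - 1" "Suc j = n" using j by auto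
          have "u (bs ! j) = (u ^^ n) x" using x j jn(2) by (metis funpow.simps(2) krylov_nth o_apply)
          also have "\<dots> = - (\<Sum>i<n. Polynomial.coeff f i *s bs ! i)"
            using act_monic[OF f, of x] x n by (simp add: eq_neg_iff_add_eq_0 add.commute)
          finally show ?thesis using col2 jn by simp
        qed
      qed
    qed
  qed
qed

lemma act_mod:
  assumes "act f x = 0" shows "act (g mod f) x = act g x"
proof -
  have "act g x = act (g div f * f + g mod f) x" by simp
  also have "\<dots> = act (g div f) (act f x) + act (g mod f) x" by (simp only: act_add_left act_mult)
  finally show ?thesis using assms by simp
qed

lemma krylov_comb:
  obtains g where "g = 0 \<or> Polynomial.degree g < n" "\<And>i. i < n \<Longrightarrow> Polynomial.coeff g i = c i"
    "(\<Sum>i<n. c i *s (u ^^ i) x) = act g x"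
proof -
  define g where "g = (\<Sum>i<n. Polynomial.monom (c i) i)"
  have co: "Polynomial.coeff g i = (if i < n then c i else 0)" for i
    unfolding g_def by (simp add: coeff_sum)
  have d: "g = 0 \<or> Polynomial.degree g < n"
    using co by (metis leading_coeff_0_iff)
  show ?thesis by (rule that[of g]) (use d co act_less[OF d] in auto)
qed

lemma mod_degree_cases: "f \<noteq> 0 \<Longrightarrow> g mod f = 0 \<or> Polynomial.degree (g mod f) < Polynomial.degree f"
  for f :: "'a poly"
  using degree_mod_less by blast

lemma krylov_append_span:
  assumes f: "monic f" "act f x = 0"
  shows "span (set (krylov x (Polynomial.degree f) @ cs)) = U.adjoin x (span (set cs))"
proof -
  let ?n = "Polynomial.degree f"
  have f0: "f \<noteq> 0" using f(1) by auto
  have sum: "(\<Sum>i<length (krylov x ?n @ cs). c i *s (krylov x ?n @ cs) ! i) =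
      (\<Sum>i<?n. c i *s (u ^^ i) x) + (\<Sum>i<length cs. c (?n + i) *s cs ! i)" for c
    by (simp add: sum_lessThan_add nth_append)
  show ?thesis
  proof
    show "span (set (krylov x ?n @ cs)) \<subseteq> U.adjoin x (span (set cs))"
    proof
      fix z assume "z \<in> span (set (krylov x ?n @ cs))"
      then obtain c where "z = (\<Sum>i<length (krylov x ?n @ cs). c i *s (krylov x ?n @ cs) ! i)"
        unfolding span_list by blast
      hence z: "z = (\<Sum>i<?n. c i *s (u ^^ i) x) + (\<Sum>i<length cs. c (?n + i) *s cs ! i)"
        unfolding sum .
      obtain g where g: "(\<Sum>i<?n. c i *s (u ^^ i) x) = act g x" by (rule krylov_comb)
      have "(\<Sum>i<length cs. c (?n + i) *s cs ! i) \<in> span (set cs)" by (rule span_listI)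
      thus "z \<in> U.adjoin x (span (set cs))" unfolding z g by (rule U.adjoinI)
    qed
    show "U.adjoin x (span (set cs)) \<subseteq> span (set (krylov x ?n @ cs))"
    proof
      fix z assume "z \<in> U.adjoin x (span (set cs))"
      then obtain g d where z: "z = act g x + (\<Sum>i<length cs. d i *s cs ! i)"
        unfolding U.adjoin_def span_list by blast
      let ?c = "\<lambda>i. if i < ?n then Polynomial.coeff (g mod f) i else d (i - ?n)"
      have "act g x = (\<Sum>i<?n. ?c i *s (u ^^ i) x)"
        using act_less[OF mod_degree_cases[OF f0]] act_mod[OF f(2)] by simp
      hence "z = (\<Sum>i<length (krylov x ?n @ cs). ?c i *s (krylov x ?n @ cs) ! i)"
        unfolding sum z by simp
      thus "z \<in> span (set (krylov x ?n @ cs))" using span_listI by (simp only:)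
    qed
  qed
qed

text \<open>Remainders modulo \<open>f\<close>, applied to \<open>x\<close>, are exactly the linear
  combinations of the Krylov list. So the condition on \<open>x\<close> in \<open>cyclic_sum\<close>
  is linear independence in disguise.\<close>

lemma krylov_append_independent:
  assumes f: "monic f" "act f x = 0"
  shows "\<not> lindep_list (krylov x (Polynomial.degree f) @ cs) \<longleftrightarrow>
    \<not> lindep_list cs \<and> (\<forall>g. act g x \<in> span (set cs) \<longrightarrow> f dvd g)"
proof -
  let ?n = "Polynomial.degree f"
  have f0: "f \<noteq> 0" using f(1) by auto
  have sum: "(\<Sum>i<length (krylov x ?n @ cs). c i *s (krylov x ?n @ cs) ! i) =
      (\<Sum>i<?n. c i *s (u ^^ i) x) + (\<Sum>i<length cs. c (?n + i) *s cs ! i)" for c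
    by (simp add: sum_lessThan_add nth_append)
  have len: "length (krylov x ?n @ cs) = ?n + length cs" by simp
  show ?thesis
  proof (intro iffI conjI allI impI)
    assume nd: "\<not> lindep_list (krylov x ?n @ cs)"
    show "\<not> lindep_list cs"
    proof
      assume "lindep_list cs"
      then obtain d k where d: "(\<Sum>i<length cs. d i *s cs ! i) = 0" "k < length cs" "d k \<noteq> 0"
        unfolding lindep_list_def by blast
      let ?c = "\<lambda>i. if i < ?n then 0 else d (i - ?n)"
      have "(\<Sum>i<length (krylov x ?n @ cs). ?c i *s (krylov x ?n @ cs) ! i) = 0"
        unfolding sum using d by simp
      from lindep_listD[OF nd this, of "?n + k"] d show False unfolding len by simp
    qed
    fix g assume "act g x \<in> span (set cs)"
    then obtain d where d: "act g x = (\<Sum>i<length cs. d i *s cs ! i)" unfolding span_list by blast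
    let ?c = "\<lambda>i. if i < ?n then Polynomial.coeff (g mod f) i else - d (i - ?n)"
    have "act g x = (\<Sum>i<?n. ?c i *s (u ^^ i) x)"
      using act_less[OF mod_degree_cases[OF f0]] act_mod[OF f(2)] by simp
    hence s: "(\<Sum>i<length (krylov x ?n @ cs). ?c i *s (krylov x ?n @ cs) ! i) = 0"
      unfolding sum by (simp add: d sum_negf)
    have "Polynomial.coeff (g mod f) i = 0" for i
    proof (cases "i < ?n")
      case True thus ?thesis using lindep_listD[OF nd s, of i] unfolding len by simp
    next
      case False thus ?thesis using mod_degree_cases[OF f0, of g] by (auto intro: coeff_eq_0)
    qed
    hence "g mod f = 0" by (simp add: poly_eq_iff)
    thus "f dvd g" by auto
  next
    assume a: "\<not> lindep_list cs \<and> (\<forall>g. act g x \<in> span (set cs) \<longrightarrow> f dvd g)"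
    show "\<not> lindep_list (krylov x ?n @ cs)"
    proof
      assume "lindep_list (krylov x ?n @ cs)"
      then obtain c k where "(\<Sum>i<length (krylov x ?n @ cs). c i *s (krylov x ?n @ cs) ! i) = 0"
        and k: "k < ?n + length cs" "c k \<noteq> 0" unfolding lindep_list_def len by blast
      hence c: "(\<Sum>i<?n. c i *s (u ^^ i) x) + (\<Sum>i<length cs. c (?n + i) *s cs ! i) = 0"
        unfolding sum by simp
      obtain g where g: "g = 0 \<or> Polynomial.degree g < ?n" "\<And>i. i < ?n \<Longrightarrow> Polynomial.coeff g i = c i"
        "(\<Sum>i<?n. c i *s (u ^^ i) x) = act g x" by (rule krylov_comb[of ?n c x]) blast
      have "act g x = (\<Sum>i<length cs. (- c (?n + i)) *s cs ! i)"
        using c by (simp add: g(3) sum_negf eq_neg_iff_add_eq_0)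
      hence "act g x \<in> span (set cs)" using span_listI by (simp only:)
      hence "f dvd g" using a by blast
      hence g0: "g = 0" using g(1) dvd_imp_degree_le[of f g] by (metis not_less)
      hence "(\<Sum>i<length cs. c (?n + i) *s cs ! i) = 0" using c g(3) by simp
      hence "c (?n + i) = 0" if "i < length cs" for i using lindep_listD[of cs "\<lambda>i. c (?n + i)"] a that by blast
      moreover have "c i = 0" if "i < ?n" for i using g(2)[OF that] g0 by simp
      ultimately have "\<forall>i<?n + length cs. c i = 0" unfolding all_less_add_iff by blast
      thus False using k by blast
    qed
  qed
qed

lemma dim_companion: "dim_row (companion f) = Polynomial.degree f" "dim_col (companion f) = Polynomial.degree f"
  by (simp_all add: companion_def Let_def)

lemma diag_companion_carrier:
  "diag_block_mat (map companion fs) \<in> carrier_mat (\<Sum>f\<leftarrow>fs. Polynomial.degree f) (\<Sum>f\<leftarrow>fs. Polynomial.degree f)"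
  by (rule carrier_matI) (simp_all add: dim_diag_block_mat dim_companion o_def)

lemma diag_companion_Cons:
  "diag_block_mat (map companion (f # fs)) =
     four_block_mat (companion f) (0\<^sub>m (Polynomial.degree f) (\<Sum>f\<leftarrow>fs. Polynomial.degree f))
       (0\<^sub>m (\<Sum>f\<leftarrow>fs. Polynomial.degree f) (Polynomial.degree f)) (diag_block_mat (map companion fs))"
  by (simp add: Let_def dim_companion dim_diag_block_mat o_def)

lemma cyclic_sum_imp_basis:
  assumes "U.cyclic_sum S (mset fs)" "\<And>f. f \<in> set fs \<Longrightarrow> monic f"
  shows "\<exists>bs. \<not> lindep_list bs \<and> span (set bs) = S \<and> length bs = (\<Sum>f\<leftarrow>fs. Polynomial.degree f) \<and>
    intertwines bs (diag_block_mat (map companion fs))"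
  using assms
proof (induction fs arbitrary: S)
  case Nil
  hence "S = {0}" using U.cyclic_sum_emptyE by simp
  thus ?case by (intro exI[of _ "[]"]) (auto simp: lindep_list_def intertwines_def)
next
  case (Cons f fs)
  have "U.cyclic_sum S (add_mset f (mset fs))" using Cons.prems by simp
  then obtain x S' where x: "S = U.adjoin x S'" "U.cyclic_sum S' (mset fs)" "U.subspace S'" "act f x = 0"
    "\<And>g. act g x \<in> S' \<Longrightarrow> f dvd g" by (metis U.cyclic_sum_add_msetE)
  have f: "monic f" using Cons.prems by simp
  obtain cs where cs: "\<not> lindep_list cs" "span (set cs) = S'" "length cs = (\<Sum>f\<leftarrow>fs. Polynomial.degree f)"
    "intertwines cs (diag_block_mat (map companion fs))" using Cons.IH[OF x(2)] Cons.prems(2) by auto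
  let ?bs = "krylov x (Polynomial.degree f) @ cs"
  have "\<not> lindep_list ?bs" using krylov_append_independent[OF f x(4)] cs x(5) by simp
  moreover have "span (set ?bs) = S" using krylov_append_span[OF f x(4)] cs x(1) by simp
  moreover have "intertwines ?bs (diag_block_mat (map companion (f # fs)))"
    unfolding diag_companion_Cons
    by (subst intertwines_block[OF companion_carrier diag_companion_carrier])
      (use cs x(4) f intertwines_companion[OF f refl] in auto)
  moreover have "length ?bs = (\<Sum>f\<leftarrow>f # fs. Polynomial.degree f)" using cs by simp
  ultimately show ?case by blast
qed

lemma basis_imp_cyclic_sum:
  assumes "\<not> lindep_list bs" "length bs = (\<Sum>f\<leftarrow>fs. Polynomial.degree f)"
    "intertwines bs (diag_block_mat (map companion fs))" "\<And>f. f \<in> set fs \<Longrightarrow> monic f"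
  shows "U.cyclic_sum (span (set bs)) (mset fs)"
  using assms
proof (induction fs arbitrary: bs)
  case Nil
  thus ?case using U.cyclic_sum_empty by simp
next
  case (Cons f fs)
  have f: "monic f" using Cons.prems by simp
  let ?n = "Polynomial.degree f"
  define as where "as = take ?n bs"
  define cs where "cs = drop ?n bs"
  have l: "length as = ?n" "length cs = (\<Sum>f\<leftarrow>fs. Polynomial.degree f)"
    using Cons.prems(2) by (auto simp: as_def cs_def)
  have bs: "bs = as @ cs" by (simp add: as_def cs_def)
  have it: "intertwines as (companion f)" "intertwines cs (diag_block_mat (map companion fs))"
    using Cons.prems(3) intertwines_block[OF companion_carrier diag_companion_carrier l]
    unfolding diag_companion_Cons bs by blast+
  obtain x where x: "as = krylov x ?n" "act f x = 0"
    using it(1) intertwines_companion[OF f refl l(1)] by blast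
  have ind: "\<not> lindep_list cs" "\<And>g. act g x \<in> span (set cs) \<Longrightarrow> f dvd g"
    using Cons.prems(1) krylov_append_independent[OF f x(2)] unfolding bs x(1) by blast+
  have "U.cyclic_sum (span (set cs)) (mset fs)"
    using Cons.IH[OF ind(1) l(2) it(2)] Cons.prems(4) by simp
  hence "U.cyclic_sum (U.adjoin x (span (set cs))) (add_mset f (mset fs))"
    using x(2) ind(2) by (rule U.cyclic_sum_adjoin)
  thus ?case unfolding bs x(1) krylov_append_span[OF f x(2)] by simp
qed

text \<open>The dictionary that turns (ii) and (iii) into statements about multisets of
  annihilators, in which the order of the blocks is forgotten.\<close>

lemma represented_by_companions_iff:
  assumes "\<And>f. f \<in> set fs \<Longrightarrow> monic f"
  shows "represented_by scale u (diag_block_mat (map companion fs)) \<longleftrightarrow> U.cyclic_sum UNIV (mset fs)"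
proof
  assume "represented_by scale u (diag_block_mat (map companion fs))"
  then obtain bs where bs: "\<not> lindep_list bs" "span (set bs) = UNIV"
    "diag_block_mat (map companion fs) \<in> carrier_mat (length bs) (length bs)"
    "intertwines bs (diag_block_mat (map companion fs))" unfolding represented_by_iff by blast
  have "length bs = (\<Sum>f\<leftarrow>fs. Polynomial.degree f)"
    using carrier_matD(1)[OF bs(3)] carrier_matD(1)[OF diag_companion_carrier[of fs]] by (rule trans[OF sym])
  thus "U.cyclic_sum UNIV (mset fs)" using basis_imp_cyclic_sum[OF bs(1) _ bs(4) assms] bs(2) by simp
next
  assume "U.cyclic_sum UNIV (mset fs)"
  then obtain bs where bs: "\<not> lindep_list bs" "span (set bs) = UNIV"
    "length bs = (\<Sum>f\<leftarrow>fs. Polynomial.degree f)" "intertwines bs (diag_block_mat (map companion fs))"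
    using cyclic_sum_imp_basis[of UNIV fs] assms by auto
  thus "represented_by scale u (diag_block_mat (map companion fs))"
    unfolding represented_by_iff
    by (intro exI[of _ bs] conjI bs(1,2,4) diag_companion_carrier[of fs, folded bs(3)])
qed

end

section \<open>The conic attached to a pair of quadratic polynomials\<close>

lemma subst_quad_add: "subst_quad d (f + g) = subst_quad d f + subst_quad d g"
  and subst_quad_diff: "subst_quad d (f - g) = subst_quad d f - subst_quad d g"
  and subst_quad_mult: "subst_quad d (f * g) = subst_quad d f * subst_quad d g"
  and subst_quad_1 [simp]: "subst_quad d 1 = 1"
  and subst_quad_0 [simp]: "subst_quad d 0 = 0"
  and subst_quad_const [simp]: "subst_quad d [:c:] = [:c:]"
  and subst_quad_prod: "subst_quad d (prod h A) = (\<Prod>a\<in>A. subst_quad d (h a))"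
  by (simp_all add: subst_quad_def pcompose_add pcompose_diff pcompose_mult pcompose_1 pcompose_prod)

lemma subst_quad_X: "subst_quad d [:0, 1:] = [:0, 1:] * [:0, 1:] - [:d:] * [:0, 1:]"
  by (simp add: subst_quad_def pcompose_pCons)

lemma subst_quad_pCons: "subst_quad d (pCons c f) = [:c:] + subst_quad d [:0, 1:] * subst_quad d f"
  by (simp add: subst_quad_def pcompose_pCons)

lemma degree_subst_quad [simp]: "Polynomial.degree (subst_quad d f) = 2 * Polynomial.degree f"
  by (simp add: subst_quad_def degree_pcompose)

lemma monic_subst_quad:
  assumes "monic f" shows "monic (subst_quad d f)"
  using lead_coeff_comp[of "[:0, - d, 1:]" f] assms by (simp add: subst_quad_def)

lemma subst_quad_comax: "comax f g \<Longrightarrow> comax (subst_quad d f) (subst_quad d g)"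
  unfolding comax_def by (metis subst_quad_add subst_quad_mult subst_quad_1)

text \<open>\<open>F[t]\<close> is free over \<open>F[t^2 - d t]\<close> with basis
  \<open>1, t\<close>; existence comes from rewriting \<open>t^2\<close> as
  \<open>d t + (t^2 - d t)\<close>.\<close>

lemma subst_quad_decompose: "\<exists>g0 g1. g = subst_quad d g0 + [:0, 1:] * subst_quad d g1"
proof (induction g)
  case 0
  show ?case by (intro exI[of _ 0]) simp
next
  case (pCons c h)
  then obtain h0 h1 where h: "h = subst_quad d h0 + [:0, 1:] * subst_quad d h1" by blast
  define T :: "'a poly" where "T = [:0, 1:]"
  have XX: "T * T = [:d:] * T + subst_quad d T" by (simp add: T_def subst_quad_X)
  have "pCons c h = [:c:] + T * h" unfolding T_def by simp
  also have "\<dots> = [:c:] + T * subst_quad d h0 + (T * T) * subst_quad d h1"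
    unfolding h T_def[symmetric] by (simp only: distrib_left mult.assoc add.assoc)
  also have "\<dots> = subst_quad d ([:c:] + T * h1) + T * subst_quad d (h0 + [:d:] * h1)"
    unfolding XX by (simp only: subst_quad_add subst_quad_mult subst_quad_const distrib_left distrib_right ac_simps)
  finally show ?case unfolding T_def by blast
qed

lemma subst_quad_eq_0_iff [simp]: "subst_quad d f = 0 \<longleftrightarrow> f = 0"
proof
  assume "subst_quad d f = 0"
  show "f = 0" unfolding subst_quad_def
    using \<open>subst_quad d f = 0\<close> pcompose_eq_0[of f "[:0, - d, 1:]"] by (simp add: subst_quad_def)
qed simp

lemma subst_quad_decompose_unique:
  assumes "subst_quad d g0 + [:0, 1:] * subst_quad d g1 = 0"
  shows "g0 = 0 \<and> g1 = 0"
proof (rule ccontr)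
  assume n: "\<not> (g0 = 0 \<and> g1 = 0)"
  have e: "[:0, 1:] * subst_quad d g1 = - subst_quad d g0" using assms by (simp add: eq_neg_iff_add_eq_0 add.commute)
  have "g1 \<noteq> 0" using n e by auto
  hence "Polynomial.degree ([:0, 1:] * subst_quad d g1) = 1 + 2 * Polynomial.degree g1"
    by (subst degree_mult_eq) auto
  moreover have "Polynomial.degree (- subst_quad d g0) = 2 * Polynomial.degree g0" by simp
  \<comment> \<open>The two summands have degrees of opposite parity, so they cannot cancel.\<close>
  ultimately have "1 + 2 * Polynomial.degree g1 = 2 * Polynomial.degree g0"
    using arg_cong[OF e, of Polynomial.degree] by (simp only:)
  thus False by presburger
qed

text \<open>Divisibility is tested on coordinates in the basis \<open>1, t\<close>. Hence a cyclic
  module with annihilator \<open>s(t^2 - d t)\<close> is free of rank 2 over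
  \<open>F[t]/(s)\<close>, where \<open>t\<close> acts as \<open>t^2 - d t\<close>.\<close>

lemma subst_quad_dvd_decompose:
  assumes "subst_quad d s dvd subst_quad d g0 + [:0, 1:] * subst_quad d g1"
  shows "s dvd g0 \<and> s dvd g1"
proof -
  obtain k where k: "subst_quad d g0 + [:0, 1:] * subst_quad d g1 = subst_quad d s * k"
    using assms by (elim dvdE)
  obtain k0 k1 where k01: "k = subst_quad d k0 + [:0, 1:] * subst_quad d k1"
    using subst_quad_decompose by blast
  have "subst_quad d (g0 - s * k0) + [:0, 1:] * subst_quad d (g1 - s * k1) =
    subst_quad d g0 + [:0, 1:] * subst_quad d g1 - subst_quad d s * k"
    unfolding k01 subst_quad_diff subst_quad_mult by (simp add: algebra_simps)
  also have "\<dots> = 0" using k by simp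
  finally have "g0 - s * k0 = 0 \<and> g1 - s * k1 = 0" by (rule subst_quad_decompose_unique)
  thus ?thesis by auto
qed

section \<open>Evaluation in the algebraic closure\<close>

definition ac_eval :: "'a::field poly \<Rightarrow> 'a alg_closure \<Rightarrow> 'a alg_closure" where
  "ac_eval f z = poly (map_poly to_ac f) z"

lemma ac_eval_0 [simp]: "ac_eval 0 z = 0"
  by (simp add: ac_eval_def)

lemma ac_eval_pCons: "ac_eval (pCons c f) z = to_ac c + z * ac_eval f z"
  by (cases "pCons c f = 0") (auto simp: ac_eval_def map_poly_pCons)

lemma ac_eval_1 [simp]: "ac_eval 1 z = 1"
  by (simp add: one_pCons ac_eval_pCons)

lemma ac_eval_const [simp]: "ac_eval [:c:] z = to_ac c"
  by (simp add: ac_eval_pCons)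

lemma ac_eval_X [simp]: "ac_eval [:0, 1:] z = z"
  by (simp add: ac_eval_pCons)

lemma ac_eval_add: "ac_eval (f + g) z = ac_eval f z + ac_eval g z"
proof (induction f arbitrary: g)
  case (pCons c f)
  obtain e g' where g: "g = pCons e g'" by (cases g)
  show ?case by (simp add: g ac_eval_pCons pCons.IH algebra_simps)
qed simp

lemma ac_eval_smult: "ac_eval (smult c f) z = to_ac c * ac_eval f z"
  by (induction f) (auto simp: ac_eval_pCons algebra_simps)

lemma ac_eval_mult: "ac_eval (f * g) z = ac_eval f z * ac_eval g z"
  by (induction f) (auto simp: ac_eval_pCons ac_eval_add ac_eval_smult algebra_simps)

lemma ac_eval_uminus: "ac_eval (- f) z = - ac_eval f z"
  using ac_eval_smult[of "-1" f z] by simp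

lemma ac_eval_diff: "ac_eval (f - g) z = ac_eval f z - ac_eval g z"
  using ac_eval_add[of f "- g" z] by (simp add: ac_eval_uminus)

lemma ac_eval_subst_quad: "ac_eval (subst_quad d f) z = ac_eval f (z * z - to_ac d * z)"
proof (induction f)
  case (pCons c f)
  have "ac_eval (subst_quad d (pCons c f)) z =
    to_ac c + (z * z - to_ac d * z) * ac_eval (subst_quad d f) z"
    by (subst subst_quad_pCons) (simp add: subst_quad_X ac_eval_add ac_eval_mult ac_eval_diff del: pCons_0_0 mult_pCons_left mult_pCons_right)
  thus ?case using pCons.IH by (simp add: ac_eval_pCons)
qed simp

lemma ac_eval_root_exists:
  assumes "Polynomial.degree f > 0" shows "\<exists>z. ac_eval f z = 0"
  unfolding ac_eval_def
  by (rule alg_closed_imp_poly_has_root) (use assms in \<open>simp add: degree_map_poly\<close>)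

lemma mem_ac_roots: "z \<in> ac_roots f \<longleftrightarrow> ac_eval f z = 0"
  by (simp add: ac_roots_def ac_eval_def)

lemma irreducible_inverse:
  fixes r f :: "'a::field poly"
  assumes "Factorial_Ring.irreducible r" "\<not> r dvd f"
  obtains i m where "i * f = 1 + r * m"
proof -
  obtain g h where "g * f + h * r = 1" using field_poly_bezout[OF assms] .
  hence "g * f = 1 + r * (- h)" by (simp add: algebra_simps eq_diff_eq)
  thus ?thesis by (rule that)
qed

locale quad_pair =
  fixes p q :: "'a::field poly"
  assumes monic_p: "monic p" and deg_p: "Polynomial.degree p = 2"
    and monic_q: "monic q" and deg_q: "Polynomial.degree q = 2"
begin

definition lam where "lam = poly_trace p"
definition mu where "mu = poly_trace q"
definition al where "al = Polynomial.coeff p 0"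
definition be where "be = Polynomial.coeff q 0"
definition dl where "dl = lam - mu"

text \<open>The discriminant of \<open>conic\<close> below. At \<open>t = z\<^sup>2 - \<delta> z\<close> it factors as the product of
  \<open>z - (x - y)\<close> over the roots \<open>x\<close> of \<open>p\<close> and \<open>y\<close> of \<open>q\<close>.\<close>

definition disc :: "'a poly" where
  "disc = (let T = [:0, 1:]; \<kappa> = [:0, 1:] + [:be:] - [:al:] in
     \<kappa> * \<kappa> + [:dl:] * \<kappa> * [:lam:] - T * [:lam:] * [:lam:] + ([:dl:] * [:dl:] + 4 * T) * [:al:])"

text \<open>The norm of \<open>A - y - w u\<close>, where \<open>u = A - B\<close>; the next two definitions are its partial
  derivatives.\<close>

definition conic :: "'a poly \<Rightarrow> 'a poly \<Rightarrow> 'a poly" where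
  "conic y w = y * y - [:lam:] * y + [:dl:] * y * w - [:0, 1:] * (w * w) + ([:0, 1:] + [:be:] - [:al:]) * w + [:al:]"

definition conic_y :: "'a poly \<Rightarrow> 'a poly \<Rightarrow> 'a poly" where
  "conic_y y w = 2 * y - [:lam:] + [:dl:] * w"

definition conic_w :: "'a poly \<Rightarrow> 'a poly \<Rightarrow> 'a poly" where
  "conic_w y w = [:dl:] * y - 2 * [:0, 1:] * w + ([:0, 1:] + [:be:] - [:al:])"

text \<open>The norm in the basis \<open>1, u, A, u A\<close>, in which \<open>u\<^sup>2 - \<delta> u = t\<close>.\<close>

definition unorm :: "'a poly \<Rightarrow> 'a poly \<Rightarrow> 'a poly \<Rightarrow> 'a poly \<Rightarrow> 'a poly" where
  "unorm g0 g1 g2 g3 = (let T = [:0, 1:]; \<kappa> = [:0, 1:] + [:be:] - [:al:]; \<delta> = [:dl:]; L = [:lam:] in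
     g0 * g0 + \<delta> * g0 * g1 - T * (g1 * g1) + [:al:] * (g2 * g2 + \<delta> * g2 * g3 - T * (g3 * g3))
     + L * g0 * g2 + (L * \<delta> + \<kappa>) * g0 * g3 - \<kappa> * g1 * g2 - T * L * g1 * g3)"

definition unorm_isotropic :: "'a poly \<Rightarrow> bool" where
  "unorm_isotropic r \<longleftrightarrow> (\<exists>g0 g1 g2 g3. \<not> (r dvd g0 \<and> r dvd g1 \<and> r dvd g2 \<and> r dvd g3) \<and> r dvd unorm g0 g1 g2 g3)"

lemma p_expand: "p = [:al, - lam, 1:]" and q_expand: "q = [:be, - mu, 1:]"
proof -
  have "f = [:Polynomial.coeff f 0, Polynomial.coeff f 1, 1:]" if "monic f" "Polynomial.degree f = 2" for f :: "'a poly"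
  proof (rule poly_eqI)
    fix n
    show "Polynomial.coeff f n = Polynomial.coeff [:Polynomial.coeff f 0, Polynomial.coeff f 1, 1:] n"
      using that by (cases "n = 0"; cases "n = 1"; cases "n = 2")
        (auto simp: coeff_pCons numeral_2_eq_2 coeff_eq_0 split: nat.splits)
  qed
  from this[OF monic_p deg_p] this[OF monic_q deg_q]
  show "p = [:al, - lam, 1:]" "q = [:be, - mu, 1:]"
    by (simp_all add: al_def lam_def be_def mu_def poly_trace_def deg_p deg_q)
qed

lemma disc_nonzero: "disc \<noteq> 0"
proof
  assume "disc = 0"
  moreover have "Polynomial.coeff disc 2 = 1"
    by (simp add: disc_def Let_def coeff_pCons numeral_2_eq_2 numeral_poly algebra_simps)
  ultimately show False by simp
qed

lemma ac_eval_p: "ac_eval p z = to_ac al + z * (z - to_ac lam)"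
  and ac_eval_q: "ac_eval q z = to_ac be + z * (z - to_ac mu)"
proof -
  have "ac_eval [:a, - b, 1:] z = to_ac a + z * (z - to_ac b)" for a b :: 'a
    by (simp add: ac_eval_pCons)
  from this[of al lam] this[of be mu]
  show "ac_eval p z = to_ac al + z * (z - to_ac lam)" "ac_eval q z = to_ac be + z * (z - to_ac mu)"
    unfolding p_expand[symmetric] q_expand[symmetric] .
qed

text \<open>By Vieta, one root of each polynomial determines the other one; once
  \<open>\<lambda>\<close>, \<open>\<mu>\<close>, \<open>\<alpha>\<close>, \<open>\<beta>\<close>
  are expressed by the roots, the factorization is a polynomial identity in five variables.\<close>

lemma disc_eval_factor:
  assumes "x1 \<in> ac_roots p" "y1 \<in> ac_roots q"
  defines "x2 \<equiv> to_ac lam - x1" and "y2 \<equiv> to_ac mu - y1"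
  shows "x2 \<in> ac_roots p" "y2 \<in> ac_roots q"
    "ac_eval (subst_quad dl disc) z =
      (z - (x1 - y1)) * (z - (x2 - y2)) * ((z - (x1 - y2)) * (z - (x2 - y1)))"
proof -
  have "to_ac al = - (x1 * (x1 - to_ac lam))" "to_ac be = - (y1 * (y1 - to_ac mu))"
    using assms(1,2) unfolding mem_ac_roots ac_eval_p ac_eval_q eq_neg_iff_add_eq_0 by blast+
  hence a: "to_ac al = x1 * x2" and b: "to_ac be = y1 * y2"
    by (simp_all add: x2_def y2_def right_diff_distrib)
  have l: "to_ac lam = x1 + x2" "to_ac mu = y1 + y2" by (simp_all add: x2_def y2_def)
  show "x2 \<in> ac_roots p" "y2 \<in> ac_roots q"
    unfolding mem_ac_roots ac_eval_p ac_eval_q a b l by (simp_all add: algebra_simps)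
  have 4: "ac_eval 4 z = 4" for z :: "'a alg_closure" by (simp add: numeral_poly)
  show "ac_eval (subst_quad dl disc) z =
      (z - (x1 - y1)) * (z - (x2 - y2)) * ((z - (x1 - y2)) * (z - (x2 - y1)))"
    unfolding ac_eval_subst_quad disc_def Let_def ac_eval_add ac_eval_diff ac_eval_mult 4 ac_eval_X
      ac_eval_const a b l dl_def to_ac_diff
    by (simp add: algebra_simps)
qed

lemma disc_root_iff: "ac_eval (subst_quad dl disc) z = 0 \<longleftrightarrow> z \<in> root_diff p q"
proof -
  obtain x1 y1 where xy: "x1 \<in> ac_roots p" "y1 \<in> ac_roots q"
    using ac_eval_root_exists[of p] ac_eval_root_exists[of q] deg_p deg_q by (auto simp: mem_ac_roots)
  show ?thesis
  proof
    assume "ac_eval (subst_quad dl disc) z = 0"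
    hence "z = x1 - y1 \<or> z = (to_ac lam - x1) - (to_ac mu - y1) \<or> z = x1 - (to_ac mu - y1) \<or> z = (to_ac lam - x1) - y1"
      unfolding disc_eval_factor(3)[OF xy] mult_eq_0_iff right_minus_eq by blast
    thus "z \<in> root_diff p q" unfolding root_diff_def
      using xy disc_eval_factor(1,2)[OF xy] by blast
  next
    assume "z \<in> root_diff p q"
    then obtain x y where z: "x \<in> ac_roots p" "y \<in> ac_roots q" "z = x - y" by (auto simp: root_diff_def)
    show "ac_eval (subst_quad dl disc) z = 0" unfolding disc_eval_factor(3)[OF z(1,2)] z(3) by simp
  qed
qed

text \<open>This moves the condition on roots down to \<open>F[t]\<close>: a common factor has a
  root in the closure, while a Bezout relation evaluated at a common root would give
  \<open>1 = 0\<close>.\<close>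

lemma no_root_in_diff_iff:
  assumes "Factorial_Ring.irreducible r"
  shows "no_root_in_diff p q r \<longleftrightarrow> \<not> r dvd disc"
proof -
  have nr: "no_root_in_diff p q r \<longleftrightarrow>
      (\<forall>z. ac_eval (subst_quad dl r) z = 0 \<longrightarrow> ac_eval (subst_quad dl disc) z \<noteq> 0)"
    unfolding no_root_in_diff_def disc_root_iff by (auto simp: mem_ac_roots dl_def lam_def mu_def)
  show ?thesis
  proof
    assume n: "no_root_in_diff p q r"
    show "\<not> r dvd disc"
    proof
      assume "r dvd disc"
      then obtain k where k: "disc = r * k" by (elim dvdE)
      obtain z where z: "ac_eval (subst_quad dl r) z = 0"
        using ac_eval_root_exists[of "subst_quad dl r"] irreducible_poly_degree_pos[OF assms] by auto
      hence "ac_eval (subst_quad dl disc) z = 0" by (simp add: k subst_quad_mult ac_eval_mult)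
      thus False using n nr z by blast
    qed
  next
    assume "\<not> r dvd disc"
    hence "comax (subst_quad dl r) (subst_quad dl disc)"
      using irreducible_comax_iff[OF assms] subst_quad_comax by blast
    then obtain s t where st: "s * subst_quad dl r + t * subst_quad dl disc = 1" unfolding comax_def by blast
    have "False" if "ac_eval (subst_quad dl r) z = 0" "ac_eval (subst_quad dl disc) z = 0" for z
    proof -
      have "ac_eval 1 z = 0" unfolding st[symmetric] by (simp add: ac_eval_add ac_eval_mult that)
      thus False by simp
    qed
    thus "no_root_in_diff p q r" unfolding nr by blast
  qed
qed

text \<open>The left side is the quadratic part of the conic at the tangent vector
  \<open>(conic_w, - conic_y)\<close>. Hence at a point of the conic modulo \<open>r\<close> the
  gradient vanishes modulo \<open>r\<close> only if \<open>r\<close> divides \<open>disc\<close>, in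
  every characteristic.\<close>

lemma conic_gradient:
  "conic_w y w * conic_w y w - [:dl:] * conic_w y w * conic_y y w - [:0, 1:] * (conic_y y w * conic_y y w)
    = disc - ([:dl:] * [:dl:] + 4 * [:0, 1:]) * conic y w"
proof -
  define T L D A B :: "'a poly" where "T = [:0, 1:]" and "L = [:lam:]" and "D = [:dl:]" and "A = [:al:]" and "B = [:be:]"
  show ?thesis
    unfolding conic_w_def conic_y_def conic_def disc_def Let_def
    unfolding T_def[symmetric] L_def[symmetric] D_def[symmetric] A_def[symmetric] B_def[symmetric]
    by (simp add: algebra_simps)
qed

lemma conic_shift:
  "conic (y + a * e) (w + a * f) = conic y w + a * (conic_y y w * e + conic_w y w * f)
    + a * a * (e * e + [:dl:] * e * f - [:0, 1:] * (f * f))"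
proof -
  define T L D A B :: "'a poly" where "T = [:0, 1:]" and "L = [:lam:]" and "D = [:dl:]" and "A = [:al:]" and "B = [:be:]"
  show ?thesis
    unfolding conic_w_def conic_y_def conic_def disc_def Let_def
    unfolding T_def[symmetric] L_def[symmetric] D_def[symmetric] A_def[symmetric] B_def[symmetric]
    by (simp add: algebra_simps)
qed

lemma conic_lift:
  assumes r: "Factorial_Ring.irreducible r" "\<not> r dvd disc" and s: "r dvd conic y0 w0"
  shows "\<exists>y w. r ^ Suc k dvd conic y w"
proof (induction k)
  case 0 thus ?case using s by auto
next
  case (Suc k)
  then obtain y w where yw: "r ^ Suc k dvd conic y w" by blast
  then obtain c where c: "conic y w = r ^ Suc k * c" by (elim dvdE)
  obtain i m where i: "i * disc = 1 + r * m" using irreducible_inverse[OF r] .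
  define T D :: "'a poly" where "T = [:0, 1:]" and "D = [:dl:]"
  define a where "a = r ^ Suc k"
  \<comment> \<open>A Newton step. In the direction \<open>(e, f)\<close> the derivative is the left
    side of \<open>conic_gradient\<close> times \<open>- c * i\<close>, hence \<open>- c\<close>
    modulo \<open>r\<close>, because \<open>i\<close> inverts \<open>disc\<close>. It cancels the
    error \<open>c\<close> modulo one more power of \<open>r\<close>.\<close>
  define f where "f = - c * i * (conic_w y w - D * conic_y y w)"
  define e where "e = c * i * T * conic_y y w"
  have "conic_y y w * e + conic_w y w * f = - c * i *
    (conic_w y w * conic_w y w - D * conic_w y w * conic_y y w - T * (conic_y y w * conic_y y w))"
    unfolding e_def f_def by (simp add: algebra_simps)
  also have "\<dots> = - c * i * (disc - (D * D + 4 * T) * conic y w)"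
    unfolding T_def D_def conic_gradient ..
  also have "\<dots> = - c * (i * disc) + c * i * ((D * D + 4 * T) * conic y w)" by (simp add: algebra_simps)
  finally have "c + (conic_y y w * e + conic_w y w * f) = r * (- c * m + c * i * ((D * D + 4 * T) * (r ^ k * c)))"
    unfolding i c by (simp add: algebra_simps)
  hence d1: "r dvd c + (conic_y y w * e + conic_w y w * f)" by simp
  have d2: "r dvd a" by (simp add: a_def)
  have eq: "conic (y + a * e) (w + a * f) =
    a * ((c + (conic_y y w * e + conic_w y w * f)) + a * (e * e + D * e * f - T * (f * f)))"
    unfolding conic_shift c a_def[symmetric] D_def[symmetric] T_def[symmetric] by (simp add: algebra_simps)
  have "a * r dvd conic (y + a * e) (w + a * f)"
    unfolding eq by (intro mult_dvd_mono dvd_refl dvd_add d1 dvd_mult2[OF d2])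
  moreover have "r ^ Suc (Suc k) = a * r" by (simp add: a_def mult.commute)
  ultimately show ?case by metis
qed

text \<open>Multiplying an isotropic \<open>k\<^sub>1 + k\<^sub>2 A\<close> by the inverse of \<open>k\<^sub>2\<close> gives a point of the conic. If
  \<open>k\<^sub>2\<close> has no inverse, then \<open>u\<^sup>2 - \<delta> u = t\<close> has a root \<open>\<rho>\<close> modulo \<open>r\<close>, and the conic is linear in
  \<open>w\<close> after the substitution \<open>y = s - \<rho> w\<close>.\<close>

lemma conic_solvable:
  assumes r: "Factorial_Ring.irreducible r" "\<not> r dvd disc" and iso: "unorm_isotropic r"
  shows "\<exists>y w. r dvd conic y w"
proof -
  define T L D A K :: "'a poly" where "T = [:0, 1:]" and "L = [:lam:]" and "D = [:dl:]" and "A = [:al:]"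
    and "K = [:0, 1:] + [:be:] - [:al:]"
  have conic: "conic y w = y * y - L * y + D * y * w - T * (w * w) + K * w + A" for y w
    by (simp add: conic_def T_def L_def D_def A_def K_def)
  obtain g0 g1 g2 g3 where g: "\<not> (r dvd g0 \<and> r dvd g1 \<and> r dvd g2 \<and> r dvd g3)" "r dvd unorm g0 g1 g2 g3"
    using iso unfolding unorm_isotropic_def by blast
  define N where "N = unorm g0 g1 g2 g3"
  \<comment> \<open>\<open>n1\<close> and \<open>n2\<close> are the norms over \<open>F[t]\<close>
    of \<open>g0 + g1 u\<close> and \<open>g2 + g3 u\<close>, where
    \<open>u^2 = \<delta> u + t\<close>.\<close>
  define n1 where "n1 = g0 * g0 + D * g0 * g1 - T * (g1 * g1)"
  define n2 where "n2 = g2 * g2 + D * g2 * g3 - T * (g3 * g3)"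
  have N: "N = n1 + A * n2 + L * g0 * g2 + (L * D + K) * g0 * g3 - K * g1 * g2 - T * L * g1 * g3"
    unfolding N_def unorm_def Let_def n1_def n2_def by (simp add: T_def L_def D_def A_def K_def)
  show ?thesis
  proof (cases "r dvd n2")
    case False
    obtain i m where i: "i * n2 = 1 + r * m" using irreducible_inverse[OF r(1) False] .
    \<comment> \<open>\<open>Y + W u\<close> is minus the conjugate of \<open>g2 + g3 u\<close>
      times \<open>g0 + g1 u\<close>; division by the norm \<open>n2\<close> gives the point
      \<open>(Y / n2, W / n2)\<close>.\<close>
    define Y W where "Y = - (g0 * g2 + D * g0 * g3 - T * g1 * g3)" and "W = g0 * g3 - g1 * g2"
    have id: "Y * Y - L * Y * n2 + D * Y * W - T * (W * W) + K * W * n2 + A * n2 * n2 = n2 * N"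
      unfolding Y_def W_def N n2_def n1_def by (simp add: algebra_simps)
    have "conic (i * Y) (i * W) = i * i * (Y * Y - L * Y * n2 + D * Y * W - T * (W * W) + K * W * n2 + A * n2 * n2)
      + L * i * Y * (i * n2 - 1) - K * i * W * (i * n2 - 1) - A * (i * n2 + 1) * (i * n2 - 1)"
      unfolding conic by (simp add: algebra_simps)
    also have "\<dots> = i * i * n2 * N + r * (L * i * Y * m - K * i * W * m - A * (i * n2 + 1) * m)"
      unfolding id unfolding i by (simp add: algebra_simps)
    also have "r dvd \<dots>" using g(2) by (simp add: N_def)
    finally show ?thesis by blast
  next
    case True
    \<comment> \<open>If \<open>r\<close> divides \<open>g2\<close> and \<open>g3\<close>, then
      \<open>g0 + g1 u\<close> is the isotropic vector modulo \<open>r\<close>; otherwise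
      \<open>g2 + g3 u\<close> has norm 0 modulo \<open>r\<close>.\<close>
    have "\<exists>b0 b1. \<not> (r dvd b0 \<and> r dvd b1) \<and> r dvd b0 * b0 + D * b0 * b1 - T * (b1 * b1)"
    proof (cases "r dvd g2 \<and> r dvd g3")
      case False thus ?thesis using True unfolding n2_def by blast
    next
      case True
      then obtain h2 h3 where h: "g2 = r * h2" "g3 = r * h3" by (elim conjE dvdE)
      have "n1 = N - r * (A * (h2 * g2 + D * h2 * g3 - T * (h3 * g3)) + L * g0 * h2 + (L * D + K) * g0 * h3
        - K * g1 * h2 - T * L * g1 * h3)"
        unfolding N n2_def h by (simp add: algebra_simps)
      hence "r dvd n1" using g(2) by (simp add: N_def)
      thus ?thesis using g(1) True unfolding n1_def by blast
    qed
    then obtain b0 b1 where b: "\<not> (r dvd b0 \<and> r dvd b1)" "r dvd b0 * b0 + D * b0 * b1 - T * (b1 * b1)" by blast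
    have "\<not> r dvd b1"
    proof
      assume b1: "r dvd b1"
      have "b0 * b0 = (b0 * b0 + D * b0 * b1 - T * (b1 * b1)) - b1 * (D * b0 - T * b1)" by (simp add: algebra_simps)
      hence "r dvd b0 * b0" using b(2) b1 by (metis dvd_diff dvd_mult2)
      hence "r dvd b0" using irreducible_dvd_multD[OF r(1)] by blast
      thus False using b(1) b1 by blast
    qed
    then obtain i m where i: "i * b1 = 1 + r * m" using irreducible_inverse[OF r(1)] by metis
    define rho where "rho = - b0 * i"
    have "rho * rho - D * rho - T = i * i * (b0 * b0 + D * b0 * b1 - T * (b1 * b1))
      - D * b0 * i * (i * b1 - 1) + T * (i * b1 + 1) * (i * b1 - 1)"
      unfolding rho_def by (simp add: algebra_simps)
    also have "\<dots> = i * i * (b0 * b0 + D * b0 * b1 - T * (b1 * b1))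
      + r * (- D * b0 * i * m + T * (i * b1 + 1) * m)" unfolding i by (simp add: algebra_simps)
    also have "r dvd \<dots>" using b(2) by simp
    finally obtain e3 where e3: "rho * rho - D * rho - T = r * e3" by (elim dvdE)
    \<comment> \<open>On the line \<open>y = s - rho w\<close> the term in \<open>w^2\<close>
      disappears modulo \<open>r\<close>, so a solution exists as soon as the coefficient of
      \<open>w\<close> is invertible.\<close>
    have sol: ?thesis if s: "\<not> r dvd (D - 2 * rho) * s + (L * rho + K)" for s
    proof -
      obtain j m where j: "j * ((D - 2 * rho) * s + (L * rho + K)) = 1 + r * m"
        using irreducible_inverse[OF r(1) s] .
      define c where "c = s * s - L * s + A"
      define w where "w = - j * c"
      have "conic (s - rho * w) w = c + w * ((D - 2 * rho) * s + (L * rho + K)) + w * w * (rho * rho - D * rho - T)"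
        unfolding conic c_def by (simp add: algebra_simps)
      also have "\<dots> = c - c * (j * ((D - 2 * rho) * s + (L * rho + K))) + w * w * (rho * rho - D * rho - T)"
        unfolding w_def by (simp add: algebra_simps)
      also have "\<dots> = r * (- c * m + w * w * e3)" unfolding j e3 by (simp add: algebra_simps)
      finally have "r dvd conic (s - rho * w) w" by simp
      thus ?thesis by blast
    qed
    show ?thesis
    proof (rule ccontr)
      assume no: "\<not> ?thesis"
      \<comment> \<open>That coefficient is affine in \<open>s\<close>. If it vanishes modulo
        \<open>r\<close> at 0 and at 1, it vanishes identically, and this forces \<open>r\<close> to
        divide \<open>disc\<close>.\<close>
      have r1: "r dvd L * rho + K" using sol[of 0] no by auto
      have "r dvd (D - 2 * rho) * 1 + (L * rho + K)" using sol[of 1] no by blast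
      hence "r dvd ((D - 2 * rho) * 1 + (L * rho + K)) - (L * rho + K)" using r1 by (rule dvd_diff)
      hence "r dvd D - 2 * rho" by simp
      then obtain e1 e2 where e: "L * rho + K = r * e1" "D - 2 * rho = r * e2" using r1 by (elim dvdE)
      have KK: "K = r * e1 - L * rho" using e(1) by (simp add: algebra_simps eq_diff_eq)
      have DD: "D = 2 * rho + r * e2" using e(2) by (simp add: algebra_simps diff_eq_eq)
      have XX: "T = rho * rho - D * rho - r * e3" using e3 by (simp add: algebra_simps)
      have "disc = K * K + D * K * L - T * L * L + (D * D + 4 * T) * A"
        unfolding disc_def Let_def by (simp add: T_def L_def D_def A_def K_def)
      also have "\<dots> = r * (r * e1 * e1 + L * r * e1 * e2 + L * L * e3 + A * (r * e2 * e2 - 4 * e3))"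
        unfolding KK XX DD by (simp add: algebra_simps)
      finally show False using r(2) by simp
    qed
  qed
qed

end

section \<open>The norm form over the residue field\<close>

context quad_pair
begin

text \<open>The form \<open>norm_form\<close> at \<open>x = t + \<alpha> + \<beta>\<close>, on
  representatives in \<open>F[t]\<close>.\<close>

definition Wnorm :: "'a poly \<Rightarrow> 'a poly \<Rightarrow> 'a poly \<Rightarrow> 'a poly \<Rightarrow> 'a poly" where
  "Wnorm a b c d = (let L = [:lam:]; M = [:mu:]; A = [:al:]; B = [:be:]; x = [:0, 1:] + [:al:] + [:be:] in
     a * (a + L * b + M * c + (L * M - x) * d) + b * (A * b + x * c + A * M * d) + B * (c * c)
     + (L * B * c + A * B * d) * d)"

text \<open>Change of basis from \<open>1, u, A, u A\<close> to \<open>1, A, B, A B\<close>: here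
  \<open>u = A - B\<close>, and \<open>A B + B A = \<mu> A + \<lambda> B - x\<close> gives \<open>u
  A = (t + \<beta>) + (\<lambda> - \<mu>) A - \<lambda> B + A B\<close>.\<close>

lemma unorm_eq_Wnorm:
  "unorm g0 g1 g2 g3 =
    Wnorm (g0 + ([:0, 1:] + [:be:]) * g3) (g2 + g1 + ([:lam:] - [:mu:]) * g3) (- g1 - [:lam:] * g3) g3"
proof -
  define T L M A B :: "'a poly" where "T = [:0, 1:]" and "L = [:lam:]" and "M = [:mu:]" and "A = [:al:]" and "B = [:be:]"
  have D: "[:dl:] = L - M" by (simp add: dl_def L_def M_def)
  show ?thesis
    unfolding unorm_def Wnorm_def Let_def D
    unfolding T_def[symmetric] L_def[symmetric] M_def[symmetric] A_def[symmetric] B_def[symmetric]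
    by (simp add: algebra_simps)
qed

text \<open>The change of basis is invertible over \<open>F[t]\<close>, so it preserves the vectors
  that are nonzero modulo \<open>r\<close>.\<close>

lemma unorm_isotropic_iff:
  "unorm_isotropic r \<longleftrightarrow> (\<exists>a b c d. \<not> (r dvd a \<and> r dvd b \<and> r dvd c \<and> r dvd d) \<and> r dvd Wnorm a b c d)"
proof
  assume "unorm_isotropic r"
  then obtain g0 g1 g2 g3 where g: "\<not> (r dvd g0 \<and> r dvd g1 \<and> r dvd g2 \<and> r dvd g3)" "r dvd unorm g0 g1 g2 g3"
    unfolding unorm_isotropic_def by blast
  define a b c where "a = g0 + ([:0, 1:] + [:be:]) * g3" and "b = g2 + g1 + ([:lam:] - [:mu:]) * g3"
    and "c = - g1 - [:lam:] * g3"
  have "r dvd Wnorm a b c g3" using g(2) unfolding unorm_eq_Wnorm a_def b_def c_def .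
  moreover have "\<not> (r dvd a \<and> r dvd b \<and> r dvd c \<and> r dvd g3)"
  proof
    assume d: "r dvd a \<and> r dvd b \<and> r dvd c \<and> r dvd g3"
    have "g0 = a - ([:0, 1:] + [:be:]) * g3" "g1 = - c - [:lam:] * g3"
      by (simp_all add: a_def c_def)
    hence "r dvd g0" "r dvd g1" using d by (metis dvd_diff dvd_mult dvd_minus_iff)+
    moreover have "g2 = b - g1 - ([:lam:] - [:mu:]) * g3" by (simp add: b_def)
    hence "r dvd g2" using d \<open>r dvd g1\<close> by (metis dvd_diff dvd_mult)
    ultimately show False using g(1) d by blast
  qed
  ultimately show "\<exists>a b c d. \<not> (r dvd a \<and> r dvd b \<and> r dvd c \<and> r dvd d) \<and> r dvd Wnorm a b c d" by blast
next
  assume "\<exists>a b c d. \<not> (r dvd a \<and> r dvd b \<and> r dvd c \<and> r dvd d) \<and> r dvd Wnorm a b c d"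
  then obtain a b c d where w: "\<not> (r dvd a \<and> r dvd b \<and> r dvd c \<and> r dvd d)" "r dvd Wnorm a b c d" by blast
  define g0 g1 g2 where "g0 = a - ([:0, 1:] + [:be:]) * d" and "g1 = - c - [:lam:] * d"
    and "g2 = b - (- c - [:lam:] * d) - ([:lam:] - [:mu:]) * d"
  have "unorm g0 g1 g2 d = Wnorm a b c d"
    unfolding unorm_eq_Wnorm by (simp add: g0_def g1_def g2_def)
  hence "r dvd unorm g0 g1 g2 d" using w(2) by simp
  moreover have "\<not> (r dvd g0 \<and> r dvd g1 \<and> r dvd g2 \<and> r dvd d)"
  proof
    assume d: "r dvd g0 \<and> r dvd g1 \<and> r dvd g2 \<and> r dvd d"
    have "a = g0 + ([:0, 1:] + [:be:]) * d" "c = - g1 - [:lam:] * d"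
      by (simp_all add: g0_def g1_def)
    hence "r dvd a" "r dvd c" using d by (metis dvd_add dvd_diff dvd_mult dvd_minus_iff)+
    moreover have "b = g2 + g1 + ([:lam:] - [:mu:]) * d" by (simp add: g2_def g1_def)
    hence "r dvd b" using d by (metis dvd_add dvd_mult)
    ultimately show False using w(1) d by blast
  qed
  ultimately show "unorm_isotropic r" unfolding unorm_isotropic_def by blast
qed

end

text \<open>The facts by which computations in \<open>F[t]/(r)\<close> are carried out on
  representatives, vanishing being divisibility by \<open>r\<close>.\<close>

lemma residue_class_hom:
  fixes r :: "'a::field poly"
  shows "cring (residue_field r)"
    and "residue_class r f \<in> carrier (residue_field r)"
    and "carrier (residue_field r) = range (residue_class r)"
    and "residue_class r (f + g) = residue_class r f \<oplus>\<^bsub>residue_field r\<^esub> residue_class r g"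
    and "residue_class r (f - g) = residue_class r f \<ominus>\<^bsub>residue_field r\<^esub> residue_class r g"
    and "residue_class r (f * g) = residue_class r f \<otimes>\<^bsub>residue_field r\<^esub> residue_class r g"
    and "residue_class r f = \<zero>\<^bsub>residue_field r\<^esub> \<longleftrightarrow> r dvd f"
proof -
  define R where "R = (ring_of_type_algebra :: 'a poly ring)"
  define I where "I = PIdl\<^bsub>R\<^esub> r"
  have R: "carrier R = UNIV" "\<And>x y. x \<otimes>\<^bsub>R\<^esub> y = x * y" "\<And>x y. x \<oplus>\<^bsub>R\<^esub> y = x + y" "\<zero>\<^bsub>R\<^esub> = 0"
    by (simp_all add: R_def ring_of_type_algebra_def)
  interpret R: cring R unfolding R_def by (rule cring_from_type_algebra)
  interpret I: ideal I R unfolding I_def by (rule R.cgenideal_ideal) (simp add: R)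
  have L: "residue_field r = R Quot I" by (simp add: residue_field_def R_def I_def)
  have cl: "residue_class r f = I +>\<^bsub>R\<^esub> f" for f by (simp add: residue_class_def R_def I_def)
  note hom = I.rcos_ring_hom
  show cr: "cring (residue_field r)" unfolding L by (rule I.quotient_is_cring) (rule R.is_cring)
  then interpret Q: cring "R Quot I" by (simp add: L)
  show car: "residue_class r f \<in> carrier (residue_field r)" for f
    unfolding L cl by (rule ring_hom_closed[OF hom]) (simp add: R)
  show "carrier (residue_field r) = range (residue_class r)"
    unfolding L by (auto simp: FactRing_def A_RCOSETS_def' R cl)
  show add: "residue_class r (f + g) = residue_class r f \<oplus>\<^bsub>residue_field r\<^esub> residue_class r g" for f g
    using ring_hom_add[OF hom, of f g] by (simp add: R L cl)
  show "residue_class r (f * g) = residue_class r f \<otimes>\<^bsub>residue_field r\<^esub> residue_class r g"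
    using ring_hom_mult[OF hom, of f g] by (simp add: R L cl)
  have "residue_class r f = residue_class r (f - g) \<oplus>\<^bsub>residue_field r\<^esub> residue_class r g"
    using add[of "f - g" g] by simp
  thus "residue_class r (f - g) = residue_class r f \<ominus>\<^bsub>residue_field r\<^esub> residue_class r g"
    using car unfolding L by (simp add: Q.minus_eq Q.a_assoc Q.r_neg)
  have "residue_class r 0 \<oplus>\<^bsub>residue_field r\<^esub> residue_class r 0 = residue_class r 0"
    using add[of 0 0] by simp
  hence z: "residue_class r 0 = \<zero>\<^bsub>residue_field r\<^esub>"
    using car unfolding L by (metis Q.add.r_cancel_one)
  have "f \<ominus>\<^bsub>R\<^esub> 0 = f" using R.minus_eq[of f 0] R.minus_zero R by simp
  hence "residue_class r f = residue_class r 0 \<longleftrightarrow> f \<in> I"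
    unfolding cl using R.quotient_eq_iff_same_a_r_cos[OF I.is_ideal, of f 0] by (simp add: R)
  also have "f \<in> I \<longleftrightarrow> r dvd f" unfolding I_def cgenideal_def by (auto simp: R dvd_def mult.commute)
  finally show "residue_class r f = \<zero>\<^bsub>residue_field r\<^esub> \<longleftrightarrow> r dvd f" by (simp add: z)
qed

context quad_pair
begin

text \<open>Isotropy passes from matrices to their coordinates, which are unique by
  \<open>inj_on_W_elem\<close>, and from these to polynomial representatives.\<close>

lemma type_norm_isotropic_iff: "type_norm_isotropic p q r \<longleftrightarrow> unorm_isotropic r"
proof -
  define L where "L = residue_field r"
  define cl where "cl = residue_class r"
  define e where "e = (\<lambda>c. cl [:c:])"
  define x where "x = [:0, 1:] + [:al:] + [:be:]"
  note h = residue_class_hom[of r, folded L_def cl_def]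
  interpret L: cring L by (rule h(1))
  have re: "range e \<subseteq> carrier L" using h(2) by (auto simp: e_def)
  have xL: "cl x \<in> carrier L" by (rule h(2))
  have norm: "norm_form L e p q (cl x) (cl a, cl b, cl c, cl d) = cl (Wnorm a b c d)" for a b c d
    unfolding norm_form_def Wnorm_def Let_def prod.case e_def lam_def[symmetric] mu_def[symmetric]
      al_def[symmetric] be_def[symmetric] x_def[symmetric] h(4,5,6) ..
  have "type_norm_isotropic p q r \<longleftrightarrow> W_norm_isotropic L e p q (cl x)"
    unfolding type_norm_isotropic_def L_def[symmetric] cl_def[symmetric] e_def[symmetric] x_def h(4)
    by (simp add: al_def be_def poly_0_coeff_0)
  also have "\<dots> \<longleftrightarrow> (\<exists>v\<in>W_coords L. W_elem L e p q (cl x) v \<noteq> mat 4 4 (\<lambda>_. \<zero>\<^bsub>L\<^esub>) \<and>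
      norm_form L e p q (cl x) v = \<zero>\<^bsub>L\<^esub>)"
    unfolding W_norm_isotropic_def W_algebra_def using W_norm_W_elem[OF h(1) re xL] by auto
  also have "\<dots> \<longleftrightarrow> (\<exists>v\<in>W_coords L. v \<noteq> (\<zero>\<^bsub>L\<^esub>, \<zero>\<^bsub>L\<^esub>, \<zero>\<^bsub>L\<^esub>, \<zero>\<^bsub>L\<^esub>) \<and> norm_form L e p q (cl x) v = \<zero>\<^bsub>L\<^esub>)"
  proof -
    have z: "(\<zero>\<^bsub>L\<^esub>, \<zero>\<^bsub>L\<^esub>, \<zero>\<^bsub>L\<^esub>, \<zero>\<^bsub>L\<^esub>) \<in> W_coords L" by (simp add: W_coords_def)
    have elts: "W_A L e p $$ (i, j) \<in> carrier L" "W_B L e p q (cl x) $$ (i, j) \<in> carrier L"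
      if "i < 4" "j < 4" for i j
    proof -
      have "i \<in> {0, 1, 2, 3}" "j \<in> {0, 1, 2, 3}" using that by auto
      moreover have "e c \<in> carrier L" for c using re by auto
      ultimately show "W_A L e p $$ (i, j) \<in> carrier L" "W_B L e p q (cl x) $$ (i, j) \<in> carrier L"
        using xL by (auto simp: W_A_def W_B_def Let_def mat_of_rows_list_def numeral_2_eq_2 numeral_3_eq_3)
    qed
    have dims: "dim_row (W_A L e p) = 4" "dim_col (W_A L e p) = 4" "dim_col (W_B L e p q (cl x)) = 4"
      by (simp_all add: W_A_def W_B_def Let_def mat_of_rows_list_def)
    have prod: "ring_mat_mult L (W_A L e p) (W_B L e p q (cl x)) $$ (i, j) \<in> carrier L"
      if "i < 4" "j < 4" for i j
      using that elts by (auto simp: ring_mat_mult_def dims intro!: L.finsum_closed)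
    have "W_elem L e p q (cl x) (\<zero>\<^bsub>L\<^esub>, \<zero>\<^bsub>L\<^esub>, \<zero>\<^bsub>L\<^esub>, \<zero>\<^bsub>L\<^esub>) = mat 4 4 (\<lambda>_. \<zero>\<^bsub>L\<^esub>)"
      unfolding W_elem_def Let_def prod.case by (rule eq_matI) (simp_all add: elts prod)
    hence "W_elem L e p q (cl x) v = mat 4 4 (\<lambda>_. \<zero>\<^bsub>L\<^esub>) \<longleftrightarrow> v = (\<zero>\<^bsub>L\<^esub>, \<zero>\<^bsub>L\<^esub>, \<zero>\<^bsub>L\<^esub>, \<zero>\<^bsub>L\<^esub>)"
      if "v \<in> W_coords L" for v
      using inj_on_W_elem[OF h(1) re xL, of p q] z that by (metis inj_onD)
    thus ?thesis by blast
  qed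
  also have "\<dots> \<longleftrightarrow> (\<exists>a b c d. (cl a, cl b, cl c, cl d) \<noteq> (\<zero>\<^bsub>L\<^esub>, \<zero>\<^bsub>L\<^esub>, \<zero>\<^bsub>L\<^esub>, \<zero>\<^bsub>L\<^esub>) \<and>
      norm_form L e p q (cl x) (cl a, cl b, cl c, cl d) = \<zero>\<^bsub>L\<^esub>)"
  proof -
    have "(\<exists>v\<in>W_coords L. Q v) \<longleftrightarrow> (\<exists>a b c d. Q (cl a, cl b, cl c, cl d))" for Q
    proof
      assume "\<exists>v\<in>W_coords L. Q v"
      then obtain v1 v2 v3 v4 where v: "Q (v1, v2, v3, v4)" "v1 \<in> range cl" "v2 \<in> range cl"
        "v3 \<in> range cl" "v4 \<in> range cl" unfolding W_coords_def h(3) by auto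
      then obtain a b c d where "v1 = cl a" "v2 = cl b" "v3 = cl c" "v4 = cl d" by (elim rangeE)
      thus "\<exists>a b c d. Q (cl a, cl b, cl c, cl d)" using v(1) by blast
    next
      assume "\<exists>a b c d. Q (cl a, cl b, cl c, cl d)"
      then obtain a b c d where "Q (cl a, cl b, cl c, cl d)" by blast
      moreover have "(cl a, cl b, cl c, cl d) \<in> W_coords L" unfolding W_coords_def using h(2) by simp
      ultimately show "\<exists>v\<in>W_coords L. Q v" by blast
    qed
    thus ?thesis .
  qed
  also have "\<dots> \<longleftrightarrow> unorm_isotropic r"
    unfolding unorm_isotropic_iff norm prod.inject h(7) by blast
  finally show ?thesis .
qed

end

section \<open>Independent generators adjoined one at a time\<close>

context operator_ring
begin

lemma wspan_Suc: "wspan (Suc k) x = {w (x k) + s | w s. w \<in> W \<and> s \<in> wspan k x}"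
proof (intro equalityI subsetI)
  fix z assume "z \<in> wspan (Suc k) x"
  then obtain w where w: "z = (\<Sum>i<Suc k. w i (x i))" "\<forall>i<Suc k. w i \<in> W" unfolding wspan_def by blast
  have "(\<Sum>i<k. w i (x i)) \<in> wspan k x" using w(2) by (intro wspanI[of k w]) simp
  moreover have "z = w k (x k) + (\<Sum>i<k. w i (x i))" unfolding w(1) by (simp add: add.commute)
  moreover have "w k \<in> W" using w(2) by simp
  ultimately show "z \<in> {w (x k) + s | w s. w \<in> W \<and> s \<in> wspan k x}" by blast
next
  fix z assume "z \<in> {w (x k) + s | w s. w \<in> W \<and> s \<in> wspan k x}"
  then obtain w0 s where z: "z = w0 (x k) + s" "w0 \<in> W" "s \<in> wspan k x" by blast
  then obtain w where w: "s = (\<Sum>i<k. w i (x i))" "\<forall>i<k. w i \<in> W" unfolding wspan_def by blast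
  define w' where "w' = (\<lambda>i. if i = k then w0 else w i)"
  have "(\<Sum>i<Suc k. w' i (x i)) \<in> wspan (Suc k) x"
    using w(2) z(2) by (intro wspanI[of _ w']) (simp add: w'_def)
  also have "(\<Sum>i<Suc k. w' i (x i)) = z" by (simp add: z(1) w(1) w'_def add.commute)
  finally show "z \<in> wspan (Suc k) x" .
qed

text \<open>A value in the span of the earlier generators is a relation with coefficient 0 at the
  later ones. This converts independence into the stepwise condition of
  \<open>cyclic_sum\<close>.\<close>

lemma prefix_independent:
  assumes ind: "\<And>w i. (\<And>i. i < n \<Longrightarrow> w i \<in> W) \<Longrightarrow> (\<Sum>i<n. w i (x i)) = 0 \<Longrightarrow> i < n \<Longrightarrow> w i (x i) = 0"
    and k: "k < n" and w0: "w0 \<in> W" and mem: "w0 (x k) \<in> wspan k x"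
  shows "w0 (x k) = 0"
proof -
  obtain w where w: "w0 (x k) = (\<Sum>i<k. w i (x i))" "\<forall>i<k. w i \<in> W" using mem unfolding wspan_def by blast
  define w' where "w' = (\<lambda>i. if i < k then (\<lambda>v. - w i v) else if i = k then w0 else (\<lambda>v. 0))"
  have W': "w' i \<in> W" for i
    using w(2) w0 W_zero W_uminus[of "w i"] by (simp add: w'_def)
  have "(\<Sum>i<n. w' i (x i)) = (\<Sum>i<Suc k. w' i (x i))"
    using k by (intro sum.mono_neutral_right) (auto simp: w'_def)
  also have "\<dots> = 0" using w(1) by (simp add: w'_def sum_negf)
  finally have "w' k (x k) = 0" using ind[of w' k, OF W' _ k] by simp
  thus ?thesis by (simp add: w'_def)
qed

end

section \<open>Primary modules over \<open>F[t]\<close>\<close>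

context poly_module
begin

lemma operator_ring_act: "operator_ring (range act)"
proof
  show "w (x + y) = w x + w y" if "w \<in> range act" for w x y using that by (auto simp: scale_right_distrib)
  have "act 1 = (\<lambda>x. x)" "act 0 = (\<lambda>x. 0)" by auto
  thus "(\<lambda>x. x) \<in> range act" "(\<lambda>x. 0) \<in> range act" by (metis rangeI)+
  show "(\<lambda>x. w (w' x)) \<in> range act" if "w \<in> range act" "w' \<in> range act" for w w'
  proof -
    obtain f g where "w = act f" "w' = act g" using \<open>w \<in> range act\<close> \<open>w' \<in> range act\<close> by (elim rangeE)
    hence "(\<lambda>x. w (w' x)) = act (f * g)" by auto
    thus ?thesis by simp
  qed
  show "(\<lambda>x. w x + w' x) \<in> range act" if "w \<in> range act" "w' \<in> range act" for w w'
  proof -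
    obtain f g where "w = act f" "w' = act g" using \<open>w \<in> range act\<close> \<open>w' \<in> range act\<close> by (elim rangeE)
    hence "(\<lambda>x. w x + w' x) = act (f + g)" by (auto simp: scale_left_distrib)
    thus ?thesis by simp
  qed
  show "(\<lambda>x. - w x) \<in> range act" if w: "w \<in> range act" for w
  proof -
    obtain f where "w = act f" using w by (elim rangeE)
    hence "(\<lambda>x. - w x) = act (- f)" by auto
    thus ?thesis by simp
  qed
qed

lemma funpow_act: "(act r ^^ k) x = act (r ^ k) x"
  by (induction k) auto

text \<open>On an \<open>r\<close>-primary vector the factor of \<open>g\<close> prime to
  \<open>r\<close> acts invertibly, so only the exponent of \<open>r\<close> in \<open>g\<close>
  matters.\<close>

lemma primary_order:
  assumes r: "Factorial_Ring.irreducible r" and x: "act (r ^ N) x = 0"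
  obtains e where "\<And>g. act g x = 0 \<longleftrightarrow> r ^ e dvd g"
proof -
  define e where "e = (LEAST k. act (r ^ k) x = 0)"
  have e0: "act (r ^ e) x = 0" unfolding e_def by (rule LeastI[of "\<lambda>k. act (r ^ k) x = 0", OF x])
  have emin: "act (r ^ k) x = 0 \<Longrightarrow> e \<le> k" for k unfolding e_def by (rule Least_le)
  show ?thesis
  proof (rule that)
    fix g
    show "act g x = 0 \<longleftrightarrow> r ^ e dvd g"
    proof
      assume g: "act g x = 0"
      show "r ^ e dvd g"
      proof (cases "g = 0")
        case False
        then obtain k h where kh: "g = r ^ k * h" "\<not> r dvd h" using irreducible_power_split[OF r] by metis
        have "comax (r ^ e) h" using irreducible_comax_iff[OF r] kh(2) comax_power_left by blast
        then obtain s t where st: "s * r ^ e + t * h = 1" unfolding comax_def by blast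
        have "r ^ k * s * r ^ e + t * g = r ^ k * (s * r ^ e + t * h)" by (simp add: kh(1) algebra_simps)
        hence "act (r ^ k) x = act (r ^ k * s * r ^ e + t * g) x" by (simp add: st)
        also have "\<dots> = act (r ^ k * s) (act (r ^ e) x) + act t (act g x)"
          by (simp add: scale_left_distrib)
        finally have "act (r ^ k) x = 0" using g e0 by simp
        hence "r ^ e dvd r ^ k" using emin le_imp_power_dvd by blast
        thus ?thesis using kh(1) by auto
      qed simp
    next
      assume "r ^ e dvd g"
      thus "act g x = 0" using e0 act_dvd_eq_0 by blast
    qed
  qed
qed

text \<open>The factor of \<open>g\<close> prime to \<open>r\<close> is comaximal with
  \<open>r ^ N\<close> and so acts invertibly on \<open>M\<close>: this is what
  \<open>independent_generators\<close> asks of the commutative ring \<open>F[t]\<close>.\<close>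

lemma primary_generators:
  assumes M: "subspace M" and r: "Factorial_Ring.irreducible r"
    and nil: "\<And>x. x \<in> M \<Longrightarrow> act (r ^ N) x = 0"
    and gen: "\<And>i. i < n \<Longrightarrow> x0 i \<in> M" "\<And>T. subspace T \<Longrightarrow> (\<And>i. i < n \<Longrightarrow> x0 i \<in> T) \<Longrightarrow> M \<subseteq> T"
  obtains x where "operator_ring.wspan (range act) n x = M"
    "\<And>g k. k < n \<Longrightarrow> act g (x k) \<in> operator_ring.wspan (range act) k x \<Longrightarrow> act g (x k) = 0"
proof -
  interpret O: operator_ring "range act" by (rule operator_ring_act)
  have stable: "O.stable T \<longleftrightarrow> subspace T" for T by (auto simp: O.stable_def subspace_def)
  have "O.wspan n x0 = M"
    using O.wspan_least[of M n x0] gen M stable O.stable_wspan[of n x0] O.wspan_generator[of _ n x0] by blast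
  note gen' = this
  have fac: "(\<forall>x\<in>M. w x = 0) \<or> (\<exists>k h h'. h \<in> range act \<and> h' \<in> range act \<and>
      (\<forall>x\<in>M. w x = (act r ^^ k) (h x) \<and> h' (h x) = x))" if w: "w \<in> range act" for w
  proof -
    obtain g where g: "w = act g" using w by (elim rangeE)
    show ?thesis
    proof (cases "g = 0")
      case False
      then obtain k h where kh: "g = r ^ k * h" "\<not> r dvd h" using irreducible_power_split[OF r] by metis
      have "comax (r ^ N) h" using irreducible_comax_iff[OF r] kh(2) comax_power_left by blast
      then obtain s t where st: "s * r ^ N + t * h = 1" unfolding comax_def by blast
      have "act t (act h x) = x" if "x \<in> M" for x
      proof -
        have "act (s * r ^ N + t * h) x = x" by (simp add: st)
        thus ?thesis using nil[OF that] by (simp add: scale_left_distrib flip: scale_scale)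
      qed
      hence "\<forall>x\<in>M. w x = (act r ^^ k) (act h x) \<and> act t (act h x) = x"
        by (simp add: g kh(1) funpow_act)
      thus ?thesis by blast
    qed (simp add: g)
  qed
  have com: "w (act r x) = act r (w x)" if "w \<in> range act" "x \<in> M" for w x
    using that by (auto simp: mult.commute)
  have nil': "(act r ^^ N) x = 0" if "x \<in> M" for x using nil[OF that] by (simp add: funpow_act)
  have "O.stable M" "act r \<in> range act" using M stable by auto
  from O.independent_generators[OF this com nil' fac gen'] obtain x where x: "O.wspan n x = M"
    "\<And>w i. (\<And>i. i < n \<Longrightarrow> w i \<in> range act) \<Longrightarrow> (\<Sum>i<n. w i (x i)) = 0 \<Longrightarrow> i < n \<Longrightarrow> w i (x i) = 0"
    by blast
  show ?thesis
  proof (rule that[of x])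
    show "O.wspan n x = M" by (rule x(1))
    fix g k assume "k < n" "act g (x k) \<in> O.wspan k x"
    thus "act g (x k) = 0" using O.prefix_independent[of n x k "act g"] x(2) by blast
  qed
qed

end

section \<open>Endomorphisms and the quadratic relations\<close>

locale quad_endo = endo scale u + quad_pair p q
  for scale :: "'a::field \<Rightarrow> 'v::ab_group_add \<Rightarrow> 'v" (infixr "*s" 75)
    and u :: "'v \<Rightarrow> 'v" and p q :: "'a poly"
begin

text \<open>Here \<open>t\<close> acts as \<open>u^2 - \<delta> u\<close>, whereas in
  \<open>act\<close> it acts as \<open>u\<close>. Below, the prefixes \<open>V\<close> and
  \<open>U\<close> distinguish these two module structures; a submodule for \<open>U\<close> is one
  for \<open>V\<close>.\<close>

definition actv :: "'a poly \<Rightarrow> 'v \<Rightarrow> 'v" where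
  "actv f x = act (subst_quad dl f) x"

text \<open>Named constants, since \<open>[:c:] * f\<close> and \<open>[:0, 1:] * f\<close> are rewritten by the simplifier, which
  defeats ring normalization.\<close>

definition TT :: "'a poly" where "TT = [:0, 1:]"
definition LL :: "'a poly" where "LL = [:lam:]"
definition DD :: "'a poly" where "DD = [:dl:]"
definition AA :: "'a poly" where "AA = [:al:]"
definition KK :: "'a poly" where "KK = [:0, 1:] + [:be:] - [:al:]"

sublocale V: poly_module actv
  by unfold_locales
    (simp_all add: actv_def subst_quad_add subst_quad_mult U.scale_right_distrib U.scale_left_distrib)

lemma conic_KK: "conic y w = y * y - LL * y + DD * y * w - TT * (w * w) + KK * w + AA"
  by (simp add: conic_def TT_def LL_def DD_def AA_def KK_def)

lemma conic_y_KK: "conic_y y w = 2 * y - LL + DD * w"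
  by (simp add: conic_y_def LL_def DD_def)

lemma conic_w_KK: "conic_w y w = DD * y - 2 * TT * w + KK"
  by (simp add: conic_w_def TT_def DD_def KK_def)

lemma unorm_KK: "unorm g0 g1 g2 g3 = g0 * g0 + DD * g0 * g1 - TT * (g1 * g1)
    + AA * (g2 * g2 + DD * g2 * g3 - TT * (g3 * g3))
     + LL * g0 * g2 + (LL * DD + KK) * g0 * g3 - KK * g1 * g2 - TT * LL * g1 * g3"
  unfolding unorm_def Let_def TT_def LL_def DD_def AA_def KK_def ..

lemma actv_const: "actv [:c:] x = c *s x"
  by (simp add: actv_def)

lemma u_act: "u (act g x) = act g (u x)"
  using act_mult[of "[:0, 1:]" g x] act_mult[of g "[:0, 1:]" x] by (simp only: act_X mult.commute)

lemma u_actv [simp]: "u (actv g x) = actv g (u x)"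
  by (simp add: actv_def u_act)

lemma u_u: "u (u x) = actv DD (u x) + actv TT x"
proof -
  have "actv TT x = u (u x) - dl *s u x"
    unfolding actv_def TT_def subst_quad_X U.scale_left_diff_distrib act_mult[symmetric] act_X act_const ..
  thus ?thesis by (simp add: DD_def actv_const)
qed

lemma act_decompose: "act (subst_quad dl g0 + [:0, 1:] * subst_quad dl g1) x = actv g0 x + actv g1 (u x)"
  unfolding act_add_left actv_def act_mult[symmetric] act_X u_act ..

lemma act_decomposeE:
  obtains g0 g1 where "g = subst_quad dl g0 + [:0, 1:] * subst_quad dl g1"
    "\<And>x. act g x = actv g0 x + actv g1 (u x)"
  using subst_quad_decompose[of g dl] act_decompose by blast

lemma subst_quad_dvdI:
  "s dvd g0 \<Longrightarrow> s dvd g1 \<Longrightarrow> subst_quad d s dvd subst_quad d g0 + [:0, 1:] * subst_quad d g1"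
  by (metis dvd_add dvd_def dvd_mult dvd_mult2 subst_quad_mult)

lemma U_imp_V: "U.subspace S \<Longrightarrow> V.subspace S"
  unfolding U.subspace_def V.subspace_def actv_def by blast

lemma U_subspace_u: "U.subspace S \<Longrightarrow> x \<in> S \<Longrightarrow> u x \<in> S"
  using U.subspace_scale[of S x "[:0, 1:]"] by (simp add: act_X)

lemma U_adjoin: "U.subspace S \<Longrightarrow> U.adjoin x S = V.adjoin (u x) (V.adjoin x S)"
proof (intro equalityI subsetI)
  fix z assume "z \<in> U.adjoin x S"
  then obtain g s where z: "z = act g x + s" "s \<in> S" unfolding U.adjoin_def by blast
  obtain g0 g1 where g: "act g x = actv g0 x + actv g1 (u x)" by (rule act_decomposeE[of g]) blast
  have "z = actv g1 (u x) + (actv g0 x + s)" by (simp add: z(1) g algebra_simps)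
  thus "z \<in> V.adjoin (u x) (V.adjoin x S)" using V.adjoinI[OF V.adjoinI[OF z(2)]] by (simp only:)
next
  fix z assume "z \<in> V.adjoin (u x) (V.adjoin x S)"
  then obtain g0 g1 s where z: "z = actv g1 (u x) + (actv g0 x + s)" "s \<in> S" unfolding V.adjoin_def by blast
  have "z = act (subst_quad dl g0 + [:0, 1:] * subst_quad dl g1) x + s"
    unfolding act_decompose by (simp add: z algebra_simps)
  thus "z \<in> U.adjoin x S" using U.adjoinI[OF z(2)] by (simp only:)
qed

text \<open>The second equation is \<open>q(a - u) = 0\<close> expanded, after \<open>a^2\<close>
  and \<open>u^2\<close> have been eliminated; \<open>KK\<close> is
  \<open>t + \<beta> - \<alpha>\<close>.\<close>

definition relations :: "('v \<Rightarrow> 'v) \<Rightarrow> 'v \<Rightarrow> bool" where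
  "relations a x \<longleftrightarrow> a (a x) = actv LL (a x) - actv AA x \<and>
     a (u x) + u (a x) = actv DD (a x) + actv LL (u x) + actv KK x"

text \<open>The relations satisfied by \<open>a\<close> on a submodule when \<open>a\<close> and \<open>a - u\<close> are annihilated by
  \<open>p\<close> and \<open>q\<close>.\<close>

definition splits_on :: "'v set \<Rightarrow> ('v \<Rightarrow> 'v) \<Rightarrow> bool" where
  "splits_on S a \<longleftrightarrow> V.hom_on S a \<and> (\<forall>x\<in>S. a x \<in> S \<and> relations a x)"

text \<open>The relations are \<open>F[t]\<close>-linear in the vector, so the vectors that satisfy
  them form a submodule and it suffices to check generators.\<close>

lemma splits_onI:
  assumes S: "U.subspace S" and a: "V.hom_on S a" and G: "\<And>g. g \<in> G \<Longrightarrow> g \<in> S \<and> a g \<in> S \<and> relations a g"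
    and gen: "\<And>T. V.subspace T \<Longrightarrow> G \<subseteq> T \<Longrightarrow> S \<subseteq> T"
  shows "splits_on S a"
proof -
  have V: "V.subspace S" using S by (rule U_imp_V)
  have add: "a (x + y) = a x + a y" if "x \<in> S" "y \<in> S" for x y using a that by (auto simp: V.hom_on_def)
  have hom: "a (actv g x) = actv g (a x)" if "x \<in> S" for x g using a that by (auto simp: V.hom_on_def)
  have uS: "u x \<in> S" if "x \<in> S" for x using S that by (rule U_subspace_u)
  have "V.subspace {x \<in> S. a x \<in> S \<and> relations a x}"
  proof (rule V.subspaceI)
    have a0: "a 0 = 0" using hom[OF V.subspace_0[OF V], of 0] by simp
    thus "0 \<in> {x \<in> S. a x \<in> S \<and> relations a x}" using V.subspace_0[OF V] by (simp add: relations_def)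
    fix x assume x: "x \<in> {x \<in> S. a x \<in> S \<and> relations a x}"
    hence xS: "x \<in> S" "a x \<in> S" "u x \<in> S" "u (a x) \<in> S" using uS by auto
    {
      fix y assume y: "y \<in> {x \<in> S. a x \<in> S \<and> relations a x}"
      hence yS: "y \<in> S" "a y \<in> S" "u y \<in> S" "u (a y) \<in> S" using uS by auto
      have r1: "a (a (x + y)) = actv LL (a (x + y)) - actv AA (x + y)"
        using x y xS yS by (simp add: add relations_def V.scale_right_distrib)
      have "a (u (x + y)) + u (a (x + y)) = (a (u x) + u (a x)) + (a (u y) + u (a y))"
        using xS yS by (simp add: add u_add)
      also have "\<dots> = actv DD (a (x + y)) + actv LL (u (x + y)) + actv KK (x + y)"
        using x y xS yS by (simp add: add u_add relations_def V.scale_right_distrib)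
      finally show "x + y \<in> {x \<in> S. a x \<in> S \<and> relations a x}"
        using r1 xS yS V by (simp add: relations_def add V.subspace_add)
    }
    fix g
    have r1: "a (a (actv g x)) = actv LL (a (actv g x)) - actv AA (actv g x)"
      using x xS by (simp add: hom relations_def V.scale_right_diff_distrib mult.commute)
    have "a (u (actv g x)) + u (a (actv g x)) = actv g (a (u x) + u (a x))"
      using xS by (simp add: hom V.scale_right_distrib)
    also have "\<dots> = actv DD (a (actv g x)) + actv LL (u (actv g x)) + actv KK (actv g x)"
      using x xS by (simp add: hom relations_def V.scale_right_distrib mult.commute)
    finally show "actv g x \<in> {x \<in> S. a x \<in> S \<and> relations a x}"
      using r1 xS V by (simp add: relations_def hom V.subspace_scale)
  qed
  moreover have "G \<subseteq> {x \<in> S. a x \<in> S \<and> relations a x}" using G by blast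
  ultimately have "S \<subseteq> {x \<in> S. a x \<in> S \<and> relations a x}" by (rule gen)
  thus ?thesis using a by (auto simp: splits_on_def)
qed

text \<open>For \<open>actv\<close>, the vectors \<open>x\<close> and \<open>u x\<close> are
  independent modulo \<open>S\<close>, each with annihilator \<open>s\<close>. Their images can
  therefore be prescribed freely among the vectors killed by \<open>s\<close>.\<close>

lemma hom_on_extend2:
  assumes S: "U.subspace S" and a: "V.hom_on S a"
    and x: "act (subst_quad dl s) x = 0" "\<And>g. act g x \<in> S \<Longrightarrow> subst_quad dl s dvd g"
    and y: "actv s y = 0" "actv s z = 0"
  obtains a' where "V.hom_on (U.adjoin x S) a'" "\<And>t. t \<in> S \<Longrightarrow> a' t = a t" "a' x = y" "a' (u x) = z"
proof -
  have V: "V.subspace S" using S by (rule U_imp_V)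
  have sx: "actv s x = 0" "actv s (u x) = 0" using x(1) u_actv[of s x] by (simp_all add: actv_def)
  have c1: "s dvd g" if "actv g x \<in> S" for g
  proof -
    have "subst_quad dl s dvd subst_quad dl g + [:0, 1:] * subst_quad dl 0"
      using x(2)[of "subst_quad dl g"] that by (simp add: actv_def)
    thus ?thesis using subst_quad_dvd_decompose by blast
  qed
  have c2: "s dvd g" if gx: "actv g (u x) \<in> V.adjoin x S" for g
  proof -
    obtain h t where h: "actv g (u x) = actv h x + t" "t \<in> S" using gx unfolding V.adjoin_def by blast
    have "act (subst_quad dl (- h) + [:0, 1:] * subst_quad dl g) x = t"
      unfolding act_decompose using h by simp
    hence "subst_quad dl s dvd subst_quad dl (- h) + [:0, 1:] * subst_quad dl g" using x(2) h(2) by simp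
    thus ?thesis using subst_quad_dvd_decompose by blast
  qed
  obtain a1 where a1: "V.hom_on (V.adjoin x S) a1" "\<And>t. t \<in> S \<Longrightarrow> a1 t = a t" "a1 x = y"
    using V.hom_on_extend[OF V a sx(1) c1 y(1)] by blast
  have V1: "V.subspace (V.adjoin x S)" using V by (rule V.subspace_adjoin)
  obtain a2 where a2: "V.hom_on (V.adjoin (u x) (V.adjoin x S)) a2"
    "\<And>t. t \<in> V.adjoin x S \<Longrightarrow> a2 t = a1 t" "a2 (u x) = z"
    using V.hom_on_extend[OF V1 a1(1) sx(2) c2 y(2)] by blast
  show ?thesis
  proof (rule that[of a2])
    show "V.hom_on (U.adjoin x S) a2" using a2(1) by (simp add: U_adjoin[OF S])
    show "a2 t = a t" if "t \<in> S" for t using a2(2)[OF V.adjoin_mono[OF that]] a1(2)[OF that] by simp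
    show "a2 x = y" using a2(2)[OF V.adjoin_self[OF V]] a1(3) by simp
    show "a2 (u x) = z" by (rule a2(3))
  qed
qed

lemma adjoin_gen:
  assumes S: "U.subspace S" and T: "V.subspace T" "S \<subseteq> T" "x \<in> T" "u x \<in> T"
  shows "U.adjoin x S \<subseteq> T"
  unfolding U_adjoin[OF S] by (intro V.adjoin_least T)

lemma splits_on_cong:
  assumes "splits_on S a" "U.subspace S" "\<And>t. t \<in> S \<Longrightarrow> a' t = a t" "x \<in> S"
  shows "a' x \<in> S \<and> relations a' x"
proof -
  have "a x \<in> S" "u x \<in> S" "relations a x" using assms U_subspace_u by (auto simp: splits_on_def)
  thus ?thesis using assms(3) assms(4) by (simp add: relations_def)
qed

text \<open>A point of the conic modulo \<open>s\<close> makes the matrix with rows \<open>(y, z)\<close> and \<open>(w, \<lambda> - y)\<close> a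
  solution \<open>a\<close> on the cyclic module with basis \<open>x, u x\<close> over \<open>F[t]/(s)\<close>.\<close>

lemma splits_on_single:
  assumes S: "U.subspace S" and a: "splits_on S a"
    and x: "act (subst_quad dl s) x = 0" "\<And>g. act g x \<in> S \<Longrightarrow> subst_quad dl s dvd g"
    and conic: "s dvd conic y w"
  shows "\<exists>a'. splits_on (U.adjoin x S) a'"
proof -
  \<comment> \<open>With \<open>a x = y x + w (u x)\<close>, the second relation at \<open>x\<close>
    forces \<open>a (u x) = z x + (\<lambda> - y) (u x)\<close>. The first relation then amounts to
    the vanishing of \<open>conic y w\<close> modulo \<open>s\<close>.\<close>
  define z where "z = DD * y - TT * w + KK"
  define c where "c g h = actv g x + actv h (u x)" for g h
  have sx: "actv s x = 0" "actv s (u x) = 0" using x(1) u_actv[of s x] by (simp_all add: actv_def)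
  have cadd: "c g h + c g' h' = c (g + g') (h + h')" and cdiff: "c g h - c g' h' = c (g - g') (h - h')"
    and cact: "actv k (c g h) = c (k * g) (k * h)" for g h g' h' k
    by (simp_all add: c_def V.scale_left_distrib V.scale_left_diff_distrib V.scale_right_distrib algebra_simps)
  have cu: "u (c g h) = c (TT * h) (g + DD * h)" for g h
    by (simp add: c_def u_add u_u V.scale_left_distrib V.scale_right_distrib algebra_simps)
  have cs: "actv s (c g h) = 0" for g h
    by (simp add: c_def V.scale_right_distrib V.act_dvd_eq_0[OF sx(1), of "s * g"] V.act_dvd_eq_0[OF sx(2), of "s * h"])
  have c0: "c (conic y w * k) 0 = 0" for k
    unfolding c_def using V.act_dvd_eq_0[OF sx(1) dvd_mult2[OF conic]] by simp
  have c01: "c 0 (conic y w * k) = 0" for k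
    unfolding c_def using V.act_dvd_eq_0[OF sx(2) dvd_mult2[OF conic]] by simp
  have xc: "x = c 1 0" "u x = c 0 1" by (simp_all add: c_def)
  let ?S = "U.adjoin x S"
  obtain a' where a': "V.hom_on ?S a'" "\<And>t. t \<in> S \<Longrightarrow> a' t = a t" "a' x = c y w" "a' (u x) = c z (LL - y)"
    using hom_on_extend2[OF S _ x cs[of y w] cs[of z "LL - y"], of a] a unfolding splits_on_def by blast
  have S': "U.subspace ?S" "V.subspace ?S" using S U.subspace_adjoin U_imp_V by blast+
  have xS: "x \<in> ?S" "u x \<in> ?S" using U.adjoin_self[OF S] U_subspace_u[OF S'(1)] by blast+
  have cS: "c g h \<in> ?S" for g h unfolding c_def using S'(2) xS by (intro V.subspace_add V.subspace_scale)
  have ac: "a' (c g h) = c (g * y + h * z) (g * w + h * (LL - y))" for g h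
  proof -
    have "a' (c g h) = actv g (a' x) + actv h (a' (u x))"
      using a'(1) xS V.subspace_scale[OF S'(2)] unfolding c_def V.hom_on_def by simp
    thus ?thesis unfolding a' cact cadd .
  qed
  have "splits_on ?S a'"
  proof (rule splits_onI[OF S'(1) a'(1), of "insert x (insert (u x) S)"])
    fix T assume "V.subspace T" "insert x (insert (u x) S) \<subseteq> T"
    thus "?S \<subseteq> T" using adjoin_gen[OF S] by blast
  next
    fix g assume "g \<in> insert x (insert (u x) S)"
    then consider "g = x" | "g = u x" | "g \<in> S" by blast
    thus "g \<in> ?S \<and> a' g \<in> ?S \<and> relations a' g"
    proof cases
      case 1
      have "a' (a' x) - (actv LL (a' x) - actv AA x) = c (conic y w * 1) 0"
        unfolding xc(1) ac cact cdiff by (simp add: conic_KK z_def algebra_simps)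
      hence "a' (a' x) = actv LL (a' x) - actv AA x" unfolding c0 by simp
      moreover have "a' (u x) + u (a' x) = actv DD (a' x) + actv LL (u x) + actv KK x"
        unfolding xc ac cact cu cadd by (simp add: z_def algebra_simps)
      ultimately show ?thesis using 1 xS cS a' by (simp add: relations_def)
    next
      case 2
      have "a' (a' (u x)) - (actv LL (a' (u x)) - actv AA (u x)) = c 0 (conic y w * 1)"
        unfolding xc(2) ac cact cdiff by (simp add: conic_KK z_def algebra_simps)
      hence "a' (a' (u x)) = actv LL (a' (u x)) - actv AA (u x)" unfolding c01 by simp
      moreover have "a' (u (u x)) + u (a' (u x)) = actv DD (a' (u x)) + actv LL (u (u x)) + actv KK (u x)"
        unfolding xc(2) cu ac cact cu cadd by (simp add: z_def algebra_simps)
      ultimately show ?thesis using 2 xS cS a' by (simp add: relations_def)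
    next
      case 3
      thus ?thesis using splits_on_cong[OF a S a'(2) 3] U.adjoin_mono by blast
    qed
  qed
  thus ?thesis by blast
qed

text \<open>The action of \<open>g0 + g1 u + g2 a + g3 u a\<close>. With a constant function for
  \<open>a\<close>, the same expression describes coordinates with respect to two vectors and their
  images under \<open>u\<close>.\<close>

definition quad_op :: "('v \<Rightarrow> 'v) \<Rightarrow> 'a poly \<Rightarrow> 'a poly \<Rightarrow> 'a poly \<Rightarrow> 'a poly \<Rightarrow> 'v \<Rightarrow> 'v" where
  "quad_op a g0 g1 g2 g3 x = actv g0 x + actv g1 (u x) + actv g2 (a x) + actv g3 (u (a x))"

lemma quad_op_add: "quad_op a g0 g1 g2 g3 x + quad_op a h0 h1 h2 h3 x = quad_op a (g0 + h0) (g1 + h1) (g2 + h2) (g3 + h3) x"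
  by (simp add: quad_op_def V.scale_left_distrib algebra_simps)

lemma quad_op_diff: "quad_op a g0 g1 g2 g3 x - quad_op a h0 h1 h2 h3 x = quad_op a (g0 - h0) (g1 - h1) (g2 - h2) (g3 - h3) x"
  by (simp add: quad_op_def V.scale_left_diff_distrib algebra_simps)

lemma quad_op_act: "actv k (quad_op a g0 g1 g2 g3 x) = quad_op a (k * g0) (k * g1) (k * g2) (k * g3) x"
  by (simp add: quad_op_def V.scale_right_distrib)

lemma quad_op_u: "u (quad_op a g0 g1 g2 g3 x) = quad_op a (TT * g1) (g0 + DD * g1) (TT * g3) (g2 + DD * g3) x"
  by (simp add: quad_op_def u_add u_u V.scale_left_distrib V.scale_right_distrib algebra_simps)

text \<open>Two equal blocks carry the regular representation of the algebra, with \<open>y\<close> in the role of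
  \<open>a x\<close>.\<close>

lemma splits_on_double:
  assumes S: "U.subspace S" and a: "splits_on S a"
    and y: "act (subst_quad dl s) y = 0" "\<And>g. act g y \<in> S \<Longrightarrow> subst_quad dl s dvd g"
    and x: "act (subst_quad dl s) x = 0" "\<And>g. act g x \<in> U.adjoin y S \<Longrightarrow> subst_quad dl s dvd g"
  shows "\<exists>a'. splits_on (U.adjoin x (U.adjoin y S)) a'"
proof -
  define c where "c = (\<lambda>g0 g1 g2 g3. quad_op (\<lambda>_. y) g0 g1 g2 g3 x)"
  have cadd: "c g0 g1 g2 g3 + c h0 h1 h2 h3 = c (g0 + h0) (g1 + h1) (g2 + h2) (g3 + h3)"
    and cdiff: "c g0 g1 g2 g3 - c h0 h1 h2 h3 = c (g0 - h0) (g1 - h1) (g2 - h2) (g3 - h3)"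
    and cact: "actv k (c g0 g1 g2 g3) = c (k * g0) (k * g1) (k * g2) (k * g3)"
    and cu: "u (c g0 g1 g2 g3) = c (TT * g1) (g0 + DD * g1) (TT * g3) (g2 + DD * g3)"
    for k g0 g1 g2 g3 h0 h1 h2 h3
    unfolding c_def by (rule quad_op_add, rule quad_op_diff, rule quad_op_act, rule quad_op_u)
  have sx: "actv s x = 0" "actv s (u x) = 0" "actv s y = 0" "actv s (u y) = 0"
    using x(1) y(1) u_actv[of s x] u_actv[of s y] by (simp_all add: actv_def)
  have cs: "actv s (c g0 g1 g2 g3) = 0" for g0 g1 g2 g3
    unfolding c_def quad_op_def
    by (simp add: V.scale_right_distrib V.act_dvd_eq_0[OF sx(1), of "s * g0"] V.act_dvd_eq_0[OF sx(2), of "s * g1"]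
        V.act_dvd_eq_0[OF sx(3), of "s * g2"] V.act_dvd_eq_0[OF sx(4), of "s * g3"])
  have xc: "x = c 1 0 0 0" "u x = c 0 1 0 0" "y = c 0 0 1 0" "u y = c 0 0 0 1"
    by (simp_all add: c_def quad_op_def)
  let ?S1 = "U.adjoin y S"
  let ?S = "U.adjoin x ?S1"
  have S1: "U.subspace ?S1" using S by (rule U.subspace_adjoin)
  \<comment> \<open>The values are those that the relations give for \<open>a (a x)\<close> and
    \<open>a (u (a x))\<close> when \<open>a x = y\<close>. They involve \<open>x\<close>, which
    lies outside the present submodule; \<open>hom_on\<close> leaves the target free.\<close>
  obtain a1 where a1: "V.hom_on ?S1 a1" "\<And>t. t \<in> S \<Longrightarrow> a1 t = a t"
    "a1 y = c (- AA) 0 LL 0" "a1 (u y) = c (- (DD * AA)) AA (DD * LL + KK) 0"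
    using hom_on_extend2[OF S _ y cs cs] a unfolding splits_on_def by blast
  obtain a' where a': "V.hom_on ?S a'" "\<And>t. t \<in> ?S1 \<Longrightarrow> a' t = a1 t"
    "a' x = c 0 0 1 0" "a' (u x) = c KK LL DD (- 1)"
    using hom_on_extend2[OF S1 a1(1) x cs cs] by blast
  have S': "U.subspace ?S" "V.subspace ?S" using S1 U.subspace_adjoin U_imp_V by blast+
  have yS1: "y \<in> ?S1" "u y \<in> ?S1" using U.adjoin_self[OF S] U_subspace_u[OF S1] by blast+
  have xS: "x \<in> ?S" "u x \<in> ?S" "y \<in> ?S" "u y \<in> ?S"
    using U.adjoin_self[OF S1] U_subspace_u[OF S'(1)] yS1 U.adjoin_mono by blast+
  have cS: "c g0 g1 g2 g3 \<in> ?S" for g0 g1 g2 g3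
    unfolding c_def quad_op_def using S'(2) xS by (intro V.subspace_add V.subspace_scale)
  have ay: "a' y = c (- AA) 0 LL 0" "a' (u y) = c (- (DD * AA)) AA (DD * LL + KK) 0"
    using a'(2) yS1 a1 by simp_all
  have ac: "a' (c g0 g1 g2 g3) = c (KK * g1 - AA * g2 - DD * AA * g3) (LL * g1 + AA * g3)
     (g0 + DD * g1 + LL * g2 + (DD * LL + KK) * g3) (- g1)" for g0 g1 g2 g3
  proof -
    have "a' (c g0 g1 g2 g3) = actv g0 (a' x) + actv g1 (a' (u x)) + actv g2 (a' y) + actv g3 (a' (u y))"
      using a'(1) xS V.subspace_scale[OF S'(2)] V.subspace_add[OF S'(2)] unfolding c_def quad_op_def V.hom_on_def by simp
    also have "\<dots> = c (KK * g1 - AA * g2 - DD * AA * g3) (LL * g1 + AA * g3)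
     (g0 + DD * g1 + LL * g2 + (DD * LL + KK) * g3) (- g1)"
      unfolding a'(3,4) ay cact cadd by (simp add: algebra_simps)
    finally show ?thesis .
  qed
  have relc: "relations a' (c g0 g1 g2 g3)" for g0 g1 g2 g3
    unfolding relations_def
  proof
    show "a' (a' (c g0 g1 g2 g3)) = actv LL (a' (c g0 g1 g2 g3)) - actv AA (c g0 g1 g2 g3)"
      unfolding ac cact cdiff by (simp add: algebra_simps)
    show "a' (u (c g0 g1 g2 g3)) + u (a' (c g0 g1 g2 g3)) =
        actv DD (a' (c g0 g1 g2 g3)) + actv LL (u (c g0 g1 g2 g3)) + actv KK (c g0 g1 g2 g3)"
      unfolding ac cu cact cadd by (simp add: algebra_simps)
  qed
  have "splits_on ?S a'"
  proof (rule splits_onI[OF S'(1) a'(1), of "{x, u x, y, u y} \<union> S"])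
    fix T assume T: "V.subspace T" "{x, u x, y, u y} \<union> S \<subseteq> T"
    show "?S \<subseteq> T" by (intro adjoin_gen S S1) (use T in auto)
  next
    fix g assume "g \<in> {x, u x, y, u y} \<union> S"
    then consider "g \<in> {c 1 0 0 0, c 0 1 0 0, c 0 0 1 0, c 0 0 0 1}" | "g \<in> S" using xc by auto
    thus "g \<in> ?S \<and> a' g \<in> ?S \<and> relations a' g"
    proof cases
      case 1
      then obtain g0 g1 g2 g3 where "g = c g0 g1 g2 g3" by blast
      thus ?thesis using cS relc ac by simp
    next
      case 2
      have "a' t = a t" if "t \<in> S" for t using a'(2)[OF U.adjoin_mono[OF that]] a1(2)[OF that] by simp
      thus ?thesis using splits_on_cong[OF a S _ 2, of a'] U.adjoin_mono 2 by blast
    qed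
  qed
  thus ?thesis by blast
qed

end

section \<open>Primary components of a difference\<close>

text \<open>Splits off the \<open>r\<close>-part of the content of a quadruple; anisotropy is then
  applied to the quadruple that remains.\<close>

lemma common_power:
  fixes g0 g1 g2 g3 :: "'a::field poly"
  assumes r: "Factorial_Ring.irreducible r" and nz: "\<not> (g0 = 0 \<and> g1 = 0 \<and> g2 = 0 \<and> g3 = 0)"
  obtains k h0 h1 h2 h3 where "g0 = r ^ k * h0" "g1 = r ^ k * h1" "g2 = r ^ k * h2" "g3 = r ^ k * h3"
    "\<not> (r dvd h0 \<and> r dvd h1 \<and> r dvd h2 \<and> r dvd h3)"
proof -
  define P where "P k \<longleftrightarrow> r ^ k dvd g0 \<and> r ^ k dvd g1 \<and> r ^ k dvd g2 \<and> r ^ k dvd g3" for k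
  define b where "b = Polynomial.degree g0 + Polynomial.degree g1 + Polynomial.degree g2 + Polynomial.degree g3"
  have bound: "k \<le> Polynomial.degree g" if "r ^ k dvd g" "g \<noteq> 0" for k g
  proof -
    have "Polynomial.degree (r ^ k) = k * Polynomial.degree r" by (rule Polynomial.degree_power_eq) (use r in auto)
    moreover have "Polynomial.degree (r ^ k) \<le> Polynomial.degree g" using that by (rule dvd_imp_degree_le)
    ultimately show ?thesis using irreducible_poly_degree_pos[OF r] by (metis le_trans mult_le_mono2 nat_mult_1_right Suc_leI One_nat_def)
  qed
  have Pb: "k \<le> b" if "P k" for k
    using that nz bound unfolding P_def b_def by (metis add.assoc le_add1 le_add2 le_trans)
  have "P 0" by (simp add: P_def)
  define k where "k = (GREATEST k. P k)"
  have Pk: "P k" unfolding k_def by (rule GreatestI_nat[of P 0 b, OF \<open>P 0\<close> Pb])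
  have max: "P j \<Longrightarrow> j \<le> k" for j unfolding k_def by (rule Greatest_le_nat[of P _ b]) (auto intro: Pb)
  obtain h0 h1 h2 h3 where h: "g0 = r ^ k * h0" "g1 = r ^ k * h1" "g2 = r ^ k * h2" "g3 = r ^ k * h3"
    using Pk unfolding P_def by (elim conjE dvdE)
  have "\<not> (r dvd h0 \<and> r dvd h1 \<and> r dvd h2 \<and> r dvd h3)"
  proof
    assume "r dvd h0 \<and> r dvd h1 \<and> r dvd h2 \<and> r dvd h3"
    hence "P (Suc k)" unfolding P_def h power_Suc2 by (auto intro!: mult_dvd_mono)
    thus False using max[of "Suc k"] by simp
  qed
  with h show ?thesis by (rule that)
qed

locale split_endo = quad_endo +
  fixes a :: "'b \<Rightarrow> 'b"
  assumes splits: "splits_on UNIV a"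
begin

lemma a_add: "a (x + y) = a x + a y" and a_act: "a (actv g x) = actv g (a x)"
  and a_a: "a (a x) = actv LL (a x) - actv AA x"
  using splits by (auto simp: splits_on_def V.hom_on_def relations_def)

lemma a_u: "a (u x) = actv DD (a x) + actv LL (u x) + actv KK x - u (a x)"
  using splits by (auto simp: splits_on_def relations_def eq_diff_eq)

lemma a_zero: "a 0 = 0"
  using a_add[of 0 0] by simp

lemma a_uminus: "a (- x) = - a x"
  using a_act[of "-1" x] by simp

lemma a_diff: "a (x - y) = a x - a y"
  using a_add[of x "- y"] by (simp add: a_uminus)

lemma quad_op_a: "a (quad_op a g0 g1 g2 g3 x) =
    quad_op a (KK * g1 - AA * g2 - DD * AA * g3) (LL * g1 + AA * g3)
      (g0 + DD * g1 + LL * g2 + (DD * LL + KK) * g3) (- g1) x"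
proof -
  have "a (quad_op a g0 g1 g2 g3 x) = quad_op a 0 0 g0 0 x + quad_op a (g1 * KK) (g1 * LL) (g1 * DD) (- g1) x
    + quad_op a (- g2 * AA) 0 (g2 * LL) 0 x + quad_op a (- g3 * (DD * AA)) (g3 * AA) (g3 * (DD * LL + KK)) 0 x"
    unfolding quad_op_def
    by (simp add: a_add a_act a_u a_a u_diff V.scale_right_distrib V.scale_left_distrib
        V.scale_right_diff_distrib algebra_simps)
  thus ?thesis unfolding quad_op_add by (simp add: algebra_simps)
qed

lemma quad_op_compose:
  "quad_op a h0 h1 h2 h3 (quad_op a g0 g1 g2 g3 x) = actv h0 (quad_op a g0 g1 g2 g3 x) + actv h1 (u (quad_op a g0 g1 g2 g3 x))
    + actv h2 (a (quad_op a g0 g1 g2 g3 x)) + actv h3 (u (a (quad_op a g0 g1 g2 g3 x)))"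
  by (simp add: quad_op_def)

text \<open>The left operator is the conjugate, trace minus element: \<open>DD\<close>,
  \<open>LL\<close> and \<open>LL * DD + KK\<close> are the traces of \<open>u\<close>,
  \<open>a\<close> and \<open>u a\<close>. So an element with norm prime to \<open>r\<close> is
  invertible on the \<open>r\<close>-primary part.\<close>

lemma quad_op_conj:
  "quad_op a (g0 + DD * g1 + LL * g2 + (LL * DD + KK) * g3) (- g1) (- g2) (- g3) (quad_op a g0 g1 g2 g3 x) =
    actv (unorm g0 g1 g2 g3) x"
proof -
  have "actv (unorm g0 g1 g2 g3) x = quad_op a (unorm g0 g1 g2 g3) 0 0 0 x" by (simp add: quad_op_def)
  thus ?thesis unfolding quad_op_compose quad_op_a quad_op_u quad_op_act quad_op_add unorm_KK by (simp add: algebra_simps)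
qed

lemma ker_subspace: "V.subspace {x. actv f x = 0}"
proof (rule V.subspaceI)
  show "actv c x \<in> {x. actv f x = 0}" if "x \<in> {x. actv f x = 0}" for c x
    using V.act_dvd_eq_0[of f x "f * c"] that by simp
qed (auto simp: V.scale_right_distrib)

lemma ker_stable: "actv f x = 0 \<Longrightarrow> actv f (u x) = 0" "actv f x = 0 \<Longrightarrow> actv f (a x) = 0"
  by (metis u_actv u_zero, metis a_act a_zero)

lemma quad_op_ker: "actv f x = 0 \<Longrightarrow> actv f (quad_op a g0 g1 g2 g3 x) = 0"
  unfolding quad_op_def V.scale_right_distrib
  by (simp add: V.scale_left_commute[of f] ker_stable del: V.scale_scale)

lemma finitely_generated:
  assumes fin: "finite_dimensional_vector_space scale Bas" and M: "V.subspace M"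
  obtains n :: nat and x0 where "\<And>i. i < n \<Longrightarrow> x0 i \<in> M"
    "\<And>T. V.subspace T \<Longrightarrow> (\<And>i. i < n \<Longrightarrow> x0 i \<in> T) \<Longrightarrow> M \<subseteq> T"
proof -
  interpret F: finite_dimensional_vector_space scale Bas by (rule fin)
  have sub: "subspace T" if "V.subspace T" for T
    using that unfolding V.subspace_def subspace_def by (metis actv_const)
  obtain B where B: "finite B" "B \<subseteq> M" "span B = M"
    using F.basis_subspace_exists[OF sub[OF M]] by metis
  obtain h where h: "bij_betw h {0..<card B} B" using ex_bij_betw_nat_finite[OF B(1)] by blast
  show ?thesis
  proof (rule that[of "card B" h])
    show "h i \<in> M" if "i < card B" for i using bij_betw_imp_surj_on[OF h] B(2) that by auto
    fix T assume T: "V.subspace T" "\<And>i. i < card B \<Longrightarrow> h i \<in> T"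
    have "h ` {0..<card B} \<subseteq> T" using T(2) by auto
    hence "B \<subseteq> T" using bij_betw_imp_surj_on[OF h] by simp
    thus "M \<subseteq> T" using span_minimal[OF _ sub[OF T(1)]] B(3) by blast
  qed
qed

text \<open>\<open>cb\<close> is the conjugate of \<open>a - y - w u\<close>. Their product is
  \<open>conic y w\<close>, which kills \<open>S\<close>, so \<open>cb\<close> maps \<open>S\<close>
  into \<open>M\<close>. By \<open>conic_gradient\<close>, \<open>G\<close> is invertible on
  \<open>S\<close>; this yields both the existence and the uniqueness in
  \<open>S = M \<oplus> u M\<close>.\<close>

lemma primary_isotropic:
  assumes fin: "finite_dimensional_vector_space scale Bas"
    and r: "Factorial_Ring.irreducible r" "\<not> r dvd disc" and cn: "r ^ N dvd conic y w"
  shows "\<exists>n e. U.cyclic_sum {x. actv (r ^ N) x = 0} (\<Sum>i<n::nat. {#subst_quad dl (r ^ e i)#})"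
proof -
  define S where "S = {x. actv (r ^ N) x = 0}"
  define cy where "cy = conic_y y w"
  define cw where "cw = conic_w y w"
  define G where "G = cw * cw - DD * cw * cy - TT * (cy * cy)"
  define cb where "cb x = quad_op a (LL - y - DD * w) w (- 1) 0 x" for x
  define M where "M = {m \<in> S. a m = quad_op a y w 0 0 m}"
  have S: "V.subspace S" unfolding S_def by (rule ker_subspace)
  have qS: "quad_op a g0 g1 g2 g3 x \<in> S" if "x \<in> S" for g0 g1 g2 g3 x using quad_op_ker that by (simp add: S_def)
  have conic0: "actv (k * conic y w) x = 0" if "x \<in> S" for k x
    using V.act_dvd_eq_0[of "r ^ N" x "k * conic y w"] that cn by (simp add: S_def)
  have "V.subspace M"
  proof (rule V.subspaceI)
    show "0 \<in> M" using V.subspace_0[OF S] by (simp add: M_def a_zero quad_op_def)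
    show "x + z \<in> M" if "x \<in> M" "z \<in> M" for x z
      using that V.subspace_add[OF S] by (simp add: M_def a_add quad_op_def u_add V.scale_right_distrib)
    show "actv c x \<in> M" if "x \<in> M" for c x
      using that V.subspace_scale[OF S] by (simp add: M_def a_act quad_op_def V.scale_right_distrib mult.commute)
  qed
  have cbM: "cb x \<in> M" if x: "x \<in> S" for x
  proof -
    have "a (cb x) - quad_op a y w 0 0 (cb x) = quad_op a (1 * conic y w) 0 0 0 x"
      unfolding cb_def quad_op_compose quad_op_a quad_op_u quad_op_act quad_op_add quad_op_diff
      by (simp add: conic_KK algebra_simps)
    also have "\<dots> = 0" using conic0[OF x, of 1] by (simp add: quad_op_def)
    finally show ?thesis using qS[OF x] by (simp add: M_def cb_def)
  qed
  have "comax G (r ^ N)"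
  proof (cases N)
    case (Suc N')
    have "G = disc - (DD * DD + 4 * TT) * conic y w"
      unfolding G_def cy_def cw_def TT_def DD_def by (rule conic_gradient)
    hence disc: "disc = G + (DD * DD + 4 * TT) * conic y w" by simp
    have "r dvd r ^ N" using Suc by simp
    hence rc: "r dvd conic y w" using cn by (rule dvd_trans)
    have "\<not> r dvd G"
    proof
      assume "r dvd G"
      hence "r dvd G + (DD * DD + 4 * TT) * conic y w" using rc by (intro dvd_add dvd_mult)
      thus False using r(2) disc by simp
    qed
    hence "comax r G" using irreducible_comax_iff[OF r(1)] by simp
    thus ?thesis by (intro comax_sym[OF comax_power_left])
  qed simp
  then obtain i j where ij: "i * G + j * r ^ N = 1" unfolding comax_def by blast
  have inv: "actv (i * G) x = x" if "x \<in> S" for x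
  proof -
    have "actv (i * G + j * r ^ N) x = x" by (simp add: ij)
    thus ?thesis using that by (simp add: S_def V.scale_left_distrib flip: V.scale_scale)
  qed
  have surj: "\<exists>m0\<in>M. \<exists>m1\<in>M. x = m0 + u m1" if x: "x \<in> S" for x
  proof -
    \<comment> \<open>\<open>cb (\<delta> - u) - u cb\<close> equals
      \<open>(cw - \<delta> cy) + cy u\<close>, the conjugate of \<open>cw - cy u\<close>, and the
      product of the two is \<open>G\<close>. So applying it to \<open>x'\<close> returns
      \<open>x\<close>.\<close>
    define x' where "x' = quad_op a (i * cw) (- i * cy) 0 0 x"
    define xb where "xb = quad_op a DD (- 1) 0 0 x'"
    have "cb xb - u (cb x') = quad_op a (cw - DD * cy) cy 0 0 x'"
      unfolding xb_def cb_def quad_op_compose quad_op_a quad_op_u quad_op_act quad_op_add quad_op_diff cw_def cy_def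
      by (simp add: conic_y_KK conic_w_KK algebra_simps)
    also have "\<dots> = quad_op a (i * G) 0 0 0 x"
      unfolding x'_def quad_op_compose quad_op_a quad_op_u quad_op_act quad_op_add by (simp add: G_def algebra_simps)
    also have "\<dots> = x" using inv[OF x] by (simp add: quad_op_def)
    finally have "x = cb xb + u (- cb x')" by (simp add: u_uminus)
    moreover have "x' \<in> S" "xb \<in> S" using qS x by (simp_all add: x'_def xb_def)
    ultimately show ?thesis using cbM V.subspace_neg[OF \<open>V.subspace M\<close>] by blast
  qed
  have inj: "m0 = 0 \<and> m1 = 0" if m: "m0 \<in> M" "m1 \<in> M" "m0 + u m1 = 0" for m0 m1
  proof -
    \<comment> \<open>When \<open>m0 = - u m1\<close> with both vectors in \<open>M\<close>, the
      relation for \<open>a u + u a\<close> leaves \<open>(cw - cy u) m1 = 0\<close>; multiplication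
      by the conjugate gives \<open>G m1 = 0\<close>.\<close>
    have m0: "m0 = quad_op a 0 (- 1) 0 0 m1" using m(3) by (simp add: quad_op_def eq_neg_iff_add_eq_0)
    have am1: "a m1 = quad_op a y w 0 0 m1" using m(2) by (simp add: M_def)
    have "a m0 = - a (u m1)" unfolding m0 by (simp add: quad_op_def a_uminus)
    also have "\<dots> = - (actv DD (a m1) + actv LL (u m1) + actv KK m1 - u (a m1))" by (simp add: a_u)
    also have "\<dots> = quad_op a 0 0 0 0 m1 - (actv DD (quad_op a y w 0 0 m1) + quad_op a KK LL 0 0 m1 - u (quad_op a y w 0 0 m1))"
      unfolding am1 by (simp add: quad_op_def)
    finally have "a m0 = quad_op a 0 0 0 0 m1 - (actv DD (quad_op a y w 0 0 m1) + quad_op a KK LL 0 0 m1 - u (quad_op a y w 0 0 m1))" .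
    moreover have "a m0 = quad_op a y w 0 0 m0" using m(1) by (simp add: M_def)
    ultimately have e: "quad_op a y w 0 0 (quad_op a 0 (- 1) 0 0 m1) -
        (quad_op a 0 0 0 0 m1 - (actv DD (quad_op a y w 0 0 m1) + quad_op a KK LL 0 0 m1 - u (quad_op a y w 0 0 m1))) = 0"
      unfolding m0 by simp
    have "quad_op a cw (- cy) 0 0 m1 = 0"
      using e unfolding quad_op_compose quad_op_u quad_op_act quad_op_a quad_op_add quad_op_diff cw_def cy_def conic_y_KK conic_w_KK
      by (simp add: algebra_simps)
    hence "quad_op a (cw - DD * cy) cy 0 0 (quad_op a cw (- cy) 0 0 m1) = 0" by (simp add: quad_op_def a_zero)
    hence "quad_op a G 0 0 0 m1 = 0"
      unfolding quad_op_compose quad_op_u quad_op_act quad_op_a quad_op_add by (simp add: G_def algebra_simps)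
    hence "actv G m1 = 0" by (simp add: quad_op_def)
    hence "actv (i * G) m1 = 0" by (simp flip: V.scale_scale)
    hence "m1 = 0" using inv m(2) by (simp add: M_def)
    thus ?thesis using m(3) by simp
  qed
  interpret O: operator_ring "range actv" by (rule V.operator_ring_act)
  obtain n x0 where "\<And>i. i < (n::nat) \<Longrightarrow> x0 i \<in> M"
    "\<And>T. V.subspace T \<Longrightarrow> (\<And>i. i < n \<Longrightarrow> x0 i \<in> T) \<Longrightarrow> M \<subseteq> T"
    using finitely_generated[OF fin \<open>V.subspace M\<close>] by blast
  moreover have "actv (r ^ N) x = 0" if "x \<in> M" for x using that by (simp add: M_def S_def)
  ultimately obtain x where x: "O.wspan n x = M"
    "\<And>g k. k < n \<Longrightarrow> actv g (x k) \<in> O.wspan k x \<Longrightarrow> actv g (x k) = 0"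
    using V.primary_generators[OF \<open>V.subspace M\<close> r(1)] by metis
  have xM: "x k \<in> M" if "k < n" for k using O.wspan_generator[OF that, of x] x(1) by simp
  have "\<forall>k\<in>{..<n}. \<exists>e. \<forall>g. actv g (x k) = 0 \<longleftrightarrow> r ^ e dvd g"
  proof
    fix k assume "k \<in> {..<n}"
    hence "actv (r ^ N) (x k) = 0" using xM by (simp add: M_def S_def)
    thus "\<exists>e. \<forall>g. actv g (x k) = 0 \<longleftrightarrow> r ^ e dvd g" by (metis V.primary_order[OF r(1)])
  qed
  from bchoice[OF this] obtain e where "\<forall>k\<in>{..<n}. \<forall>g. actv g (x k) = 0 \<longleftrightarrow> r ^ e k dvd g" by blast
  hence e: "actv g (x k) = 0 \<longleftrightarrow> r ^ e k dvd g" if "k < n" for k g using that by simp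
  have stable: "V.subspace (O.wspan k x)" for k
    using O.stable_wspan[of k x] by (auto simp: O.stable_def V.subspace_def)
  have wM: "O.wspan k x \<subseteq> M" if "k \<le> n" for k
    using that xM \<open>V.subspace M\<close> by (intro O.wspan_least) (auto simp: O.stable_def V.subspace_def)
  \<comment> \<open>A generator of \<open>M\<close> over \<open>F[t]\<close> contributes
    \<open>x k\<close> and \<open>u (x k)\<close>, which together make one cyclic module for
    \<open>u\<close>: one block per generator.\<close>
  define T where "T k = {s0 + u s1 | s0 s1. s0 \<in> O.wspan k x \<and> s1 \<in> O.wspan k x}" for k
  have "U.cyclic_sum (T k) (\<Sum>i<k. {#subst_quad dl (r ^ e i)#})" if "k \<le> n" for k
    using that
  proof (induction k)
    case 0
    have "O.wspan 0 x = {0}" by (auto simp: O.wspan_def)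
    hence "T 0 = {0}" by (simp add: T_def)
    thus ?case using U.cyclic_sum_empty by simp
  next
    case (Suc k)
    hence k: "k < n" by simp
    have Tk: "T (Suc k) = U.adjoin (x k) (T k)"
    proof (intro equalityI subsetI)
      fix z assume "z \<in> T (Suc k)"
      then obtain s0 s1 where z: "z = s0 + u s1" "s0 \<in> O.wspan (Suc k) x" "s1 \<in> O.wspan (Suc k) x"
        unfolding T_def by blast
      then obtain g0 g1 t0 t1 where t: "s0 = actv g0 (x k) + t0" "s1 = actv g1 (x k) + t1"
        "t0 \<in> O.wspan k x" "t1 \<in> O.wspan k x" unfolding O.wspan_Suc by blast
      have "z = act (subst_quad dl g0 + [:0, 1:] * subst_quad dl g1) (x k) + (t0 + u t1)"
        unfolding act_decompose z(1) t(1,2) by (simp add: u_add algebra_simps)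
      moreover have "t0 + u t1 \<in> T k" using t(3,4) unfolding T_def by blast
      ultimately show "z \<in> U.adjoin (x k) (T k)" using U.adjoinI by (simp only:)
    next
      fix z assume "z \<in> U.adjoin (x k) (T k)"
      then obtain g t0 t1 where z: "z = act g (x k) + (t0 + u t1)" "t0 \<in> O.wspan k x" "t1 \<in> O.wspan k x"
        unfolding U.adjoin_def T_def by blast
      obtain g0 g1 where g: "act g (x k) = actv g0 (x k) + actv g1 (u (x k))" by (rule act_decomposeE[of g]) blast
      have "z = (actv g0 (x k) + t0) + u (actv g1 (x k) + t1)"
        unfolding z(1) g by (simp add: u_add algebra_simps)
      moreover have "actv g0 (x k) + t0 \<in> O.wspan (Suc k) x" "actv g1 (x k) + t1 \<in> O.wspan (Suc k) x"
        unfolding O.wspan_Suc using z(2,3) by blast+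
      ultimately show "z \<in> T (Suc k)" unfolding T_def by blast
    qed
    have "U.cyclic_sum (U.adjoin (x k) (T k)) (add_mset (subst_quad dl (r ^ e k)) (\<Sum>i<k. {#subst_quad dl (r ^ e i)#}))"
    proof (rule U.cyclic_sum_adjoin)
      show "U.cyclic_sum (T k) (\<Sum>i<k. {#subst_quad dl (r ^ e i)#})" using Suc by simp
      show "act (subst_quad dl (r ^ e k)) (x k) = 0" using e[OF k, of "r ^ e k"] by (simp add: actv_def)
      fix g assume gT: "act g (x k) \<in> T k"
      then obtain t0 t1 where t: "act g (x k) = t0 + u t1" "t0 \<in> O.wspan k x" "t1 \<in> O.wspan k x"
        unfolding T_def by blast
      obtain g0 g1 where g: "g = subst_quad dl g0 + [:0, 1:] * subst_quad dl g1"
        "act g (x k) = actv g0 (x k) + actv g1 (u (x k))" by (rule act_decomposeE[of g]) blast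
      have "(actv g0 (x k) - t0) + u (actv g1 (x k) - t1) = 0"
        using t(1) g(2) by (simp add: u_diff algebra_simps)
      moreover have "actv g0 (x k) - t0 \<in> M" "actv g1 (x k) - t1 \<in> M"
        using \<open>V.subspace M\<close> xM[OF k] wM[of k] k t(2,3)
        by (auto intro!: V.subspace_diff V.subspace_scale)
      ultimately have "actv g0 (x k) = t0" "actv g1 (x k) = t1" using inj by fastforce+
      hence "actv g0 (x k) = 0" "actv g1 (x k) = 0"
        using x(2)[OF k, of g0] x(2)[OF k, of g1] t(2,3) by simp_all
      thus "subst_quad dl (r ^ e k) dvd g" unfolding g(1) using e[OF k] by (intro subst_quad_dvdI) simp_all
    qed
    thus ?case unfolding Tk by (simp add: add.commute)
  qed
  moreover have "T n = S"
  proof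
    show "T n \<subseteq> S" unfolding T_def x(1) using V.subspace_add[OF S] ker_stable(1) by (auto simp: M_def S_def)
    show "S \<subseteq> T n" unfolding T_def x(1) using surj by blast
  qed
  ultimately show ?thesis unfolding S_def[symmetric] by (metis order_refl)
qed

text \<open>Once the \<open>r\<close>-part of its coefficients is split off, an operator has norm
  prime to \<open>r\<close>, and its conjugate divided by the norm inverts it on \<open>S\<close>.
  This is the factorization required by \<open>independent_generators\<close>.\<close>

lemma primary_anisotropic:
  assumes fin: "finite_dimensional_vector_space scale Bas"
    and r: "Factorial_Ring.irreducible r" and an: "\<not> unorm_isotropic r"
  shows "\<exists>n e. U.cyclic_sum {x. actv (r ^ N) x = 0}
    (\<Sum>i<n::nat. {#subst_quad dl (r ^ e i), subst_quad dl (r ^ e i)#})"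
proof -
  define S where "S = {x. actv (r ^ N) x = 0}"
  define W where "W = {quad_op a g0 g1 g2 g3 | g0 g1 g2 g3. True}"
  have WI: "(\<And>x. w x = quad_op a g0 g1 g2 g3 x) \<Longrightarrow> w \<in> W" for w g0 g1 g2 g3
    unfolding W_def by (intro CollectI exI[of _ g0] exI[of _ g1] exI[of _ g2] exI[of _ g3]) auto
  have WE: "\<exists>g0 g1 g2 g3. w = quad_op a g0 g1 g2 g3" if "w \<in> W" for w using that unfolding W_def by blast
  interpret O: operator_ring W
  proof
    show "w (x + z) = w x + w z" if "w \<in> W" for w x z
      using WE[OF that] by (auto simp: quad_op_def u_add a_add V.scale_right_distrib)
    show "(\<lambda>x. x) \<in> W" by (rule WI[of _ 1 0 0 0]) (simp add: quad_op_def)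
    show "(\<lambda>x. 0) \<in> W" by (rule WI[of _ 0 0 0 0]) (simp add: quad_op_def)
    show "(\<lambda>x. w (w' x)) \<in> W" if "w \<in> W" "w' \<in> W" for w w'
    proof -
      obtain g0 g1 g2 g3 h0 h1 h2 h3 where w: "w = quad_op a g0 g1 g2 g3" "w' = quad_op a h0 h1 h2 h3"
        using WE[OF \<open>w \<in> W\<close>] WE[OF \<open>w' \<in> W\<close>] by blast
      show ?thesis unfolding w quad_op_compose quad_op_a quad_op_u quad_op_act quad_op_add by (rule WI) (rule refl)
    qed
    show "(\<lambda>x. w x + w' x) \<in> W" if "w \<in> W" "w' \<in> W" for w w'
    proof -
      obtain g0 g1 g2 g3 h0 h1 h2 h3 where w: "w = quad_op a g0 g1 g2 g3" "w' = quad_op a h0 h1 h2 h3"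
        using WE[OF \<open>w \<in> W\<close>] WE[OF \<open>w' \<in> W\<close>] by blast
      show ?thesis unfolding w quad_op_add by (rule WI) (rule refl)
    qed
    show "(\<lambda>x. - w x) \<in> W" if wW: "w \<in> W" for w
    proof -
      obtain g0 g1 g2 g3 where w: "w = quad_op a g0 g1 g2 g3" using WE[OF wW] by blast
      have "- w x = quad_op a (- g0) (- g1) (- g2) (- g3) x" for x unfolding w by (simp add: quad_op_def)
      thus ?thesis by (rule WI)
    qed
  qed
  have uW: "u \<in> W" by (rule WI[of _ 0 1 0 0]) (simp add: quad_op_def)
  have aW: "a \<in> W" by (rule WI[of _ 0 0 1 0]) (simp add: quad_op_def)
  have actW: "actv g \<in> W" for g by (rule WI[of _ g 0 0 0]) (simp add: quad_op_def)
  have wsubV: "V.subspace T" if "O.stable T" for T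
    using that actW by (auto simp: O.stable_def V.subspace_def)
  have S: "O.stable S"
    unfolding O.stable_def
  proof (intro conjI ballI)
    show "0 \<in> S" by (simp add: S_def)
    show "x + z \<in> S" if "x \<in> S" "z \<in> S" for x z using that by (simp add: S_def V.scale_right_distrib)
    show "w x \<in> S" if "w \<in> W" "x \<in> S" for w x using WE[OF that(1)] that(2) quad_op_ker by (auto simp: S_def)
  qed
  have unit: "\<exists>t. \<forall>x\<in>S. actv t (quad_op a (g0 + DD * g1 + LL * g2 + (LL * DD + KK) * g3) (- g1) (- g2) (- g3)
      (quad_op a g0 g1 g2 g3 x)) = x"
    if "\<not> (r dvd g0 \<and> r dvd g1 \<and> r dvd g2 \<and> r dvd g3)" for g0 g1 g2 g3
  proof -
    have "\<not> r dvd unorm g0 g1 g2 g3" using an that unfolding unorm_isotropic_def by blast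
    hence "comax (r ^ N) (unorm g0 g1 g2 g3)" using irreducible_comax_iff[OF r] comax_power_left by blast
    then obtain s t where st: "s * r ^ N + t * unorm g0 g1 g2 g3 = 1" unfolding comax_def by blast
    have "actv t (actv (unorm g0 g1 g2 g3) x) = x" if "x \<in> S" for x
    proof -
      have "actv (s * r ^ N + t * unorm g0 g1 g2 g3) x = x" by (simp add: st)
      thus ?thesis using that by (simp add: S_def V.scale_left_distrib flip: V.scale_scale)
    qed
    thus ?thesis unfolding quad_op_conj by blast
  qed
  have factor: "(\<forall>x\<in>S. w x = 0) \<or> (\<exists>k h h'. h \<in> W \<and> h' \<in> W \<and>
      (\<forall>x\<in>S. w x = (actv r ^^ k) (h x) \<and> h' (h x) = x))" if wW: "w \<in> W" for w
  proof -
    obtain g0 g1 g2 g3 where w: "w = quad_op a g0 g1 g2 g3" using WE[OF wW] by blast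
    show ?thesis
    proof (cases "g0 = 0 \<and> g1 = 0 \<and> g2 = 0 \<and> g3 = 0")
      case True thus ?thesis by (simp add: w quad_op_def)
    next
      case False
      obtain k h0 h1 h2 h3 where h: "g0 = r ^ k * h0" "g1 = r ^ k * h1" "g2 = r ^ k * h2" "g3 = r ^ k * h3"
        "\<not> (r dvd h0 \<and> r dvd h1 \<and> r dvd h2 \<and> r dvd h3)" by (rule common_power[OF r False])
      obtain t where t: "\<And>x. x \<in> S \<Longrightarrow> actv t (quad_op a (h0 + DD * h1 + LL * h2 + (LL * DD + KK) * h3) (- h1) (- h2) (- h3)
        (quad_op a h0 h1 h2 h3 x)) = x" using unit[OF h(5)] by blast
      define h' where "h' x = actv t (quad_op a (h0 + DD * h1 + LL * h2 + (LL * DD + KK) * h3) (- h1) (- h2) (- h3) x)" for x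
      have "h' \<in> W" unfolding h'_def quad_op_act by (rule WI) (rule refl)
      moreover have "quad_op a h0 h1 h2 h3 \<in> W" by (rule WI) (rule refl)
      moreover have "\<forall>x\<in>S. w x = (actv r ^^ k) (quad_op a h0 h1 h2 h3 x) \<and> h' (quad_op a h0 h1 h2 h3 x) = x"
        unfolding V.funpow_act quad_op_act w h(1-4) h'_def using t by (simp add: quad_op_act)
      ultimately show ?thesis by blast
    qed
  qed
  have central: "w (actv r x) = actv r (w x)" if "w \<in> W" "x \<in> S" for w x
    using WE[OF that(1)] by (auto simp: quad_op_def a_act V.scale_right_distrib mult.commute)
  have nil: "(actv r ^^ N) x = 0" if "x \<in> S" for x using that by (simp add: V.funpow_act S_def)
  obtain n x0 where x0: "\<And>i. i < (n::nat) \<Longrightarrow> x0 i \<in> S"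
    "\<And>T. V.subspace T \<Longrightarrow> (\<And>i. i < n \<Longrightarrow> x0 i \<in> T) \<Longrightarrow> S \<subseteq> T"
    using finitely_generated[OF fin wsubV[OF S]] by blast
  have gen: "O.wspan n x0 = S"
  proof
    show "O.wspan n x0 \<subseteq> S" using S x0(1) by (rule O.wspan_least)
    show "S \<subseteq> O.wspan n x0" by (rule x0(2)[OF wsubV[OF O.stable_wspan]]) (rule O.wspan_generator)
  qed
  from O.independent_generators[OF S actW central nil factor gen] obtain x where x: "O.wspan n x = S"
    and ind: "\<And>w i. (\<And>i. i < n \<Longrightarrow> w i \<in> W) \<Longrightarrow> (\<Sum>i<n. w i (x i)) = 0 \<Longrightarrow> i < n \<Longrightarrow> w i (x i) = 0"
    by blast
  have xS: "x k \<in> S" if "k < n" for k using O.wspan_generator[OF that, of x] x by simp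
  have "\<forall>k\<in>{..<n}. \<exists>e. \<forall>g. actv g (x k) = 0 \<longleftrightarrow> r ^ e dvd g"
  proof
    fix k assume "k \<in> {..<n}"
    hence "actv (r ^ N) (x k) = 0" using xS by (simp add: S_def)
    thus "\<exists>e. \<forall>g. actv g (x k) = 0 \<longleftrightarrow> r ^ e dvd g" by (metis V.primary_order[OF r])
  qed
  from bchoice[OF this] obtain e where "\<forall>k\<in>{..<n}. \<forall>g. actv g (x k) = 0 \<longleftrightarrow> r ^ e k dvd g" by blast
  hence e: "actv g (x k) = 0 \<longleftrightarrow> r ^ e k dvd g" if "k < n" for k g using that by simp
  \<comment> \<open>An element of the algebra, not only of \<open>F[t]\<close>, that kills
    \<open>x k\<close> has all its coefficients divisible by \<open>r ^ e k\<close>, because its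
    primitive part is invertible on \<open>S\<close>. So both blocks of \<open>x k\<close> have the
    same annihilator.\<close>
  have ord: "r ^ e k dvd g0 \<and> r ^ e k dvd g1 \<and> r ^ e k dvd g2 \<and> r ^ e k dvd g3"
    if k: "k < n" and q0: "quad_op a g0 g1 g2 g3 (x k) = 0" for k g0 g1 g2 g3
  proof (cases "g0 = 0 \<and> g1 = 0 \<and> g2 = 0 \<and> g3 = 0")
    case False
    obtain j h0 h1 h2 h3 where h: "g0 = r ^ j * h0" "g1 = r ^ j * h1" "g2 = r ^ j * h2" "g3 = r ^ j * h3"
      "\<not> (r dvd h0 \<and> r dvd h1 \<and> r dvd h2 \<and> r dvd h3)" by (rule common_power[OF r False])
    obtain t where t: "\<And>x. x \<in> S \<Longrightarrow> actv t (quad_op a (h0 + DD * h1 + LL * h2 + (LL * DD + KK) * h3) (- h1) (- h2) (- h3)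
      (quad_op a h0 h1 h2 h3 x)) = x" using unit[OF h(5)] by blast
    have "actv (r ^ j) (quad_op a h0 h1 h2 h3 (x k)) = 0" using q0 unfolding h(1-4) quad_op_act .
    hence "actv (r ^ j) (quad_op a (h0 + DD * h1 + LL * h2 + (LL * DD + KK) * h3) (- h1) (- h2) (- h3)
      (quad_op a h0 h1 h2 h3 (x k))) = 0" by (rule quad_op_ker)
    hence "actv (r ^ j) (actv t (quad_op a (h0 + DD * h1 + LL * h2 + (LL * DD + KK) * h3) (- h1) (- h2) (- h3)
      (quad_op a h0 h1 h2 h3 (x k)))) = 0"
      using V.scale_left_commute[of "r ^ j" t] by (simp del: V.scale_scale)
    hence "actv (r ^ j) (x k) = 0" using t[OF xS[OF k]] by simp
    hence "r ^ e k dvd r ^ j" using e[OF k] by blast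
    thus ?thesis unfolding h(1-4) by simp
  qed simp
  have pre: "w (x k) = 0" if "k < n" "w \<in> W" "w (x k) \<in> O.wspan k x" for k w
  proof (rule O.prefix_independent[of n x k w])
    fix w i assume "\<And>i. i < n \<Longrightarrow> w i \<in> W" "(\<Sum>i<n. w i (x i)) = 0" "i < n"
    thus "w i (x i) = 0" by (rule ind)
  qed (use that in auto)
  have "U.cyclic_sum (O.wspan k x) (\<Sum>i<k. {#subst_quad dl (r ^ e i), subst_quad dl (r ^ e i)#})" if "k \<le> n" for k
    using that
  proof (induction k)
    case 0
    have "O.wspan 0 x = {0}" by (auto simp: O.wspan_def)
    thus ?case using U.cyclic_sum_empty by simp
  next
    case (Suc k)
    hence k: "k < n" by simp
    define f where "f = subst_quad dl (r ^ e k)"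
    let ?y = "a (x k)"
    let ?T = "O.wspan k x"
    have T: "V.subspace ?T" by (rule wsubV[OF O.stable_wspan])
    \<comment> \<open>\<open>x k\<close>, \<open>u (x k)\<close>, \<open>a (x k)\<close> and
      \<open>u (a (x k))\<close> group into two cyclic modules for \<open>u\<close>, generated by
      \<open>x k\<close> and \<open>a (x k)\<close>.\<close>
    have Tk: "O.wspan (Suc k) x = U.adjoin (x k) (U.adjoin ?y ?T)"
    proof (intro equalityI subsetI)
      fix z assume "z \<in> O.wspan (Suc k) x"
      then obtain w t where z: "z = w (x k) + t" "w \<in> W" "t \<in> ?T" unfolding O.wspan_Suc by blast
      obtain g0 g1 g2 g3 where w: "w = quad_op a g0 g1 g2 g3" using WE[OF z(2)] by blast
      have "z = act (subst_quad dl g0 + [:0, 1:] * subst_quad dl g1) (x k)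
          + (act (subst_quad dl g2 + [:0, 1:] * subst_quad dl g3) ?y + t)"
        unfolding act_decompose z(1) w quad_op_def by (simp add: algebra_simps)
      thus "z \<in> U.adjoin (x k) (U.adjoin ?y ?T)" using U.adjoinI[OF U.adjoinI[OF z(3)]] by (simp only:)
    next
      fix z assume "z \<in> U.adjoin (x k) (U.adjoin ?y ?T)"
      then obtain g h t where z: "z = act g (x k) + (act h ?y + t)" "t \<in> ?T" unfolding U.adjoin_def by blast
      obtain g0 g1 where g: "act g (x k) = actv g0 (x k) + actv g1 (u (x k))" by (rule act_decomposeE[of g]) blast
      obtain h0 h1 where h: "act h ?y = actv h0 ?y + actv h1 (u ?y)" by (rule act_decomposeE[of h]) blast
      have "z = quad_op a g0 g1 h0 h1 (x k) + t" unfolding z(1) g h quad_op_def by (simp add: algebra_simps)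
      moreover have "quad_op a g0 g1 h0 h1 \<in> W" by (rule WI) (rule refl)
      ultimately show "z \<in> O.wspan (Suc k) x" unfolding O.wspan_Suc using z(2) by blast
    qed
    have ann: "actv (r ^ e k) (x k) = 0" using e[OF k, of "r ^ e k"] by simp
    have D1: "U.cyclic_sum (U.adjoin ?y ?T) (add_mset f (\<Sum>i<k. {#subst_quad dl (r ^ e i), subst_quad dl (r ^ e i)#}))"
    proof (rule U.cyclic_sum_adjoin)
      show "U.cyclic_sum ?T (\<Sum>i<k. {#subst_quad dl (r ^ e i), subst_quad dl (r ^ e i)#})" using Suc by simp
      show "act f ?y = 0" using ker_stable(2)[OF ann] by (simp add: f_def actv_def)
      fix g assume gT: "act g ?y \<in> ?T"
      obtain g0 g1 where g: "g = subst_quad dl g0 + [:0, 1:] * subst_quad dl g1"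
        "act g ?y = actv g0 ?y + actv g1 (u ?y)" by (rule act_decomposeE[of g]) blast
      have "act g ?y = quad_op a 0 0 g0 g1 (x k)" unfolding g(2) by (simp add: quad_op_def)
      moreover have "quad_op a 0 0 g0 g1 \<in> W" by (rule WI) (rule refl)
      ultimately have "quad_op a 0 0 g0 g1 (x k) = 0" using pre[OF k] gT by metis
      thus "f dvd g" unfolding g(1) f_def using ord[OF k] by (intro subst_quad_dvdI) blast+
    qed
    have "U.cyclic_sum (U.adjoin (x k) (U.adjoin ?y ?T))
      (add_mset f (add_mset f (\<Sum>i<k. {#subst_quad dl (r ^ e i), subst_quad dl (r ^ e i)#})))"
    proof (rule U.cyclic_sum_adjoin[OF D1])
      show "act f (x k) = 0" using ann by (simp add: f_def actv_def)
      fix g assume "act g (x k) \<in> U.adjoin ?y ?T"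
      then obtain h t where ht: "act g (x k) = act h ?y + t" "t \<in> ?T" unfolding U.adjoin_def by blast
      obtain g0 g1 where g: "g = subst_quad dl g0 + [:0, 1:] * subst_quad dl g1"
        "act g (x k) = actv g0 (x k) + actv g1 (u (x k))" by (rule act_decomposeE[of g]) blast
      obtain h0 h1 where h: "act h ?y = actv h0 ?y + actv h1 (u ?y)" by (rule act_decomposeE[of h]) blast
      have "quad_op a g0 g1 (- h0) (- h1) (x k) = act g (x k) - act h ?y"
        unfolding g(2) h quad_op_def by (simp add: algebra_simps)
      hence "quad_op a g0 g1 (- h0) (- h1) (x k) \<in> ?T" using ht by simp
      moreover have "quad_op a g0 g1 (- h0) (- h1) \<in> W" by (rule WI) (rule refl)
      ultimately have "quad_op a g0 g1 (- h0) (- h1) (x k) = 0" using pre[OF k] by blast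
      thus "f dvd g" unfolding g(1) f_def using ord[OF k] by (intro subst_quad_dvdI) blast+
    qed
    thus ?case unfolding Tk f_def by (simp add: add.commute)
  qed
  from this[OF order_refl] show ?thesis unfolding x S_def by blast
qed

end

section \<open>Regularity and differences\<close>

context endo
begin

text \<open>One Krylov vector more than the dimension gives an annihilator of a single vector; the
  product over a basis kills the space. It will be applied to
  \<open>u^2 - \<delta> u\<close>.\<close>

lemma annihilator_exists:
  assumes fin: "finite_dimensional_vector_space scale Bas"
  shows "\<exists>m. m \<noteq> 0 \<and> (\<forall>x. act m x = 0)"
proof -
  interpret F: finite_dimensional_vector_space scale Bas by (rule fin)
  have "\<exists>g. g \<noteq> 0 \<and> act g x = 0" for x
  proof -
    let ?n = "Suc F.dimension"
    have "lindep_list (krylov x ?n)"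
    proof (rule ccontr)
      assume "\<not> lindep_list (krylov x ?n)"
      hence d: "distinct (krylov x ?n)" "\<not> dependent (set (krylov x ?n))" by (simp_all add: lindep_list_iff)
      have "card (set (krylov x ?n)) \<le> F.dimension"
        using F.independent_card_le_dim[of "set (krylov x ?n)" UNIV] d(2) F.dim_UNIV by (simp add: F.dimension_def)
      thus False using distinct_card[OF d(1)] by simp
    qed
    then obtain c i where c: "(\<Sum>i<?n. c i *s (u ^^ i) x) = 0" "i < ?n" "c i \<noteq> 0"
      unfolding lindep_list_def by auto
    obtain g where g: "\<And>i. i < ?n \<Longrightarrow> Polynomial.coeff g i = c i" "(\<Sum>i<?n. c i *s (u ^^ i) x) = act g x"
      by (rule krylov_comb[of ?n c x]) blast
    have "g \<noteq> 0" using g(1)[OF c(2)] c(3) by auto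
    thus ?thesis using g(2) c(1) by auto
  qed
  then obtain g where g: "\<And>x. g x \<noteq> 0" "\<And>x. act (g x) x = 0" by metis
  define m where "m = (\<Prod>b\<in>Bas. g b)"
  have "m \<noteq> 0" using g(1) F.finite_Basis by (simp add: m_def)
  moreover have "act m x = 0" for x
  proof -
    have "subspace {x. act m x = 0}"
      by (rule subspaceI) (auto simp: act_add_right act_scale)
    moreover have "Bas \<subseteq> {x. act m x = 0}"
    proof
      fix b assume "b \<in> Bas"
      hence "g b dvd m" unfolding m_def using F.finite_Basis by (intro dvd_prodI)
      thus "b \<in> {x. act m x = 0}" using U.act_dvd_eq_0[OF g(2)] by simp
    qed
    ultimately have "span Bas \<subseteq> {x. act m x = 0}" by (intro span_minimal)
    thus ?thesis using F.span_Basis by blast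
  qed
  ultimately show ?thesis by blast
qed

text \<open>Either the cofactor of an irreducible factor \<open>s\<close> still kills
  \<open>x\<close>, and the degree drops, or it sends \<open>x\<close> to a nonzero vector killed by
  \<open>s\<close>.\<close>

lemma irreducible_torsion:
  assumes "f \<noteq> 0" "act f x = 0" "x \<noteq> 0"
  shows "\<exists>s y. Factorial_Ring.irreducible s \<and> monic s \<and> s dvd f \<and> y \<noteq> 0 \<and> act s y = 0"
  using assms
proof (induction "Polynomial.degree f" arbitrary: f rule: less_induct)
  case (less f)
  have "\<not> is_unit f"
  proof
    assume "is_unit f"
    then obtain k where "1 = f * k" by (elim dvdE)
    hence "x = act k (act f x)" by (simp add: act_mult mult.commute)
    thus False using less.prems by simp
  qed
  then obtain s where s: "Factorial_Ring.irreducible s" "monic s" "s dvd f"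
    using monic_irreducible_factor[OF less.prems(1)] by blast
  then obtain k where k: "f = s * k" by (elim dvdE)
  show ?case
  proof (cases "act k x = 0")
    case True
    have "k \<noteq> 0" using k less.prems(1) by auto
    hence "Polynomial.degree k < Polynomial.degree f"
      using irreducible_poly_degree_pos[OF s(1)] k s(1) by (subst k, subst degree_mult_eq) auto
    from less.hyps[OF this \<open>k \<noteq> 0\<close> True less.prems(3)] obtain s' y
      where s': "Factorial_Ring.irreducible s'" "monic s'" "s' dvd k" "y \<noteq> 0" "act s' y = 0" by blast
    have "s' dvd f" unfolding k using s'(3) by (rule dvd_mult)
    thus ?thesis using s' by blast
  next
    case False
    have "act s (act k x) = 0" using less.prems(2) k by simp
    thus ?thesis using s False by blast
  qed
qed

text \<open>If \<open>s\<close> annihilates \<open>y\<close>, then the matrix of \<open>u\<close> in a basis that extends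
  \<open>y, u y, \<dots>\<close> maps the coefficient vector of \<open>s / (t - \<zeta>)\<close> to \<open>\<zeta>\<close> times itself.\<close>

lemma eigenvalue_of_torsion:
  assumes fin: "finite_dimensional_vector_space scale Bas"
    and s: "Factorial_Ring.irreducible s" "monic s" and y: "y \<noteq> 0" "act s y = 0" and z: "ac_eval s z = 0"
  shows "ac_eigenvalue scale u z"
proof -
  interpret F: finite_dimensional_vector_space scale Bas by (rule fin)
  define n where "n = Polynomial.degree s"
  have n0: "n > 0" using irreducible_poly_degree_pos[OF s(1)] by (simp add: n_def)
  \<comment> \<open>As \<open>s\<close> is irreducible, it generates the annihilator of
    \<open>y\<close>, so the first \<open>n\<close> Krylov vectors are independent.\<close>
  have "s dvd g" if "act g y = 0" for g
  proof (rule ccontr)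
    assume "\<not> s dvd g"
    then obtain i j where ij: "i * g + j * s = 1" using field_poly_bezout[OF s(1)] by blast
    have "act (i * g + j * s) y = 0" using that y(2) by (simp add: act_add_left flip: act_mult)
    thus False using y(1) by (simp add: ij)
  qed
  hence "\<not> lindep_list (krylov y n @ [])"
    unfolding n_def krylov_append_independent[OF s(2) y(2)] by (simp add: lindep_list_def)
  hence ind: "distinct (krylov y n)" "\<not> dependent (set (krylov y n))" by (simp_all add: lindep_list_iff)
  define B where "B = extend_basis (set (krylov y n))"
  have B: "set (krylov y n) \<subseteq> B" "\<not> dependent B" "span B = UNIV"
    unfolding B_def using extend_basis_superset[OF ind(2)] independent_extend_basis[OF ind(2)]
      span_extend_basis[OF ind(2)] by simp_all
  have "finite B" using F.finiteI_independent[OF B(2)] .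
  then obtain cs where cs: "set cs = B - set (krylov y n)" "distinct cs"
    using finite_distinct_list[of "B - set (krylov y n)"] by auto
  define bs where "bs = krylov y n @ cs"
  define N where "N = length bs"
  have setbs: "set bs = B" using B(1) cs(1) by (auto simp: bs_def)
  have "distinct bs" using ind(1) cs by (auto simp: bs_def)
  hence nd: "\<not> lindep_list bs" using B(2) setbs by (simp add: lindep_list_iff)
  have nN: "n \<le> N" by (simp add: N_def bs_def)
  have "\<exists>c. u (bs ! j) = (\<Sum>i<N. c i *s bs ! i)" for j
  proof -
    have "u (bs ! j) \<in> span (set bs)" using B(3) setbs by simp
    thus ?thesis unfolding span_list N_def by blast
  qed
  then obtain c where c: "\<And>j. u (bs ! j) = (\<Sum>i<N. c j i *s bs ! i)" by metis
  \<comment> \<open>The Krylov vectors span a stable subspace, so the first \<open>n\<close> columns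
    show the companion matrix above zeros. The eigenvector below is supported on these
    columns.\<close>
  define M where "M = mat N N (\<lambda>(i, j). if j < n then (if i < n then companion s $$ (i, j) else 0) else c j i)"
  have "intertwines (krylov y n) (companion s)"
    using intertwines_companion[OF s(2), of n "krylov y n"] y(2) n_def by auto
  hence comp: "u ((u ^^ j) y) = (\<Sum>i<n. companion s $$ (i, j) *s (u ^^ i) y)" if "j < n" for j
    using that unfolding intertwines_def by simp
  have "intertwines bs M" unfolding intertwines_def N_def[symmetric]
  proof (intro allI impI)
    fix j assume j: "j < N"
    show "u (bs ! j) = (\<Sum>i<N. M $$ (i, j) *s bs ! i)"
    proof (cases "j < n")
      case True
      have "(\<Sum>i<N. M $$ (i, j) *s bs ! i) = (\<Sum>i<n. M $$ (i, j) *s bs ! i)"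
        using True nN j by (intro sum.mono_neutral_right) (auto simp: M_def)
      also have "\<dots> = (\<Sum>i<n. companion s $$ (i, j) *s (u ^^ i) y)"
        using True nN j by (intro sum.cong) (auto simp: M_def bs_def nth_append)
      also have "\<dots> = u (bs ! j)" using comp[OF True] True by (simp add: bs_def nth_append)
      finally show ?thesis by simp
    next
      case False
      have "(\<Sum>i<N. M $$ (i, j) *s bs ! i) = (\<Sum>i<N. c j i *s bs ! i)"
        using False j by (intro sum.cong) (auto simp: M_def)
      thus ?thesis using c by simp
    qed
  qed
  moreover have "M \<in> carrier_mat (length bs) (length bs)" by (simp add: M_def N_def)
  ultimately have rep: "represented_by scale u M"
    unfolding represented_by_iff using nd B(3) setbs by blast
  have "[:- z, 1:] dvd map_poly to_ac s" using z by (simp add: ac_eval_def poly_eq_0_iff_dvd)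
  then obtain t where t: "map_poly to_ac s = [:- z, 1:] * t" by (elim dvdE)
  \<comment> \<open>Comparing coefficients in \<open>s = (X - z) t\<close> gives, row by row, the
    eigenvector equation of the companion matrix.\<close>
  have st: "to_ac (Polynomial.coeff s i) = Polynomial.coeff (pCons 0 t) i - z * Polynomial.coeff t i" for i
  proof -
    have "to_ac (Polynomial.coeff s i) = Polynomial.coeff (map_poly to_ac s) i" by (simp add: coeff_map_poly)
    thus ?thesis unfolding t by simp
  qed
  have t0: "t \<noteq> 0" using t s(2) by auto
  have degS: "Polynomial.degree (map_poly to_ac s) = n" by (simp add: degree_map_poly n_def)
  hence degt: "Polynomial.degree t = n - 1" using t0 unfolding t by (subst (asm) degree_mult_eq) auto
  have tn: "Polynomial.coeff t n = 0" using degt n0 by (intro coeff_eq_0) simp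
  have tlead: "Polynomial.coeff t (n - 1) = 1"
    using st[of n] s(2) n0 tn by (simp add: n_def[symmetric] coeff_pCons split: nat.splits)
  define w where "w = vec N (\<lambda>i. if i < n then Polynomial.coeff t i else 0)"
  have "w $ (n - 1) = 1" using n0 nN tlead by (simp add: w_def)
  hence w0: "w \<noteq> 0\<^sub>v N" using n0 nN by auto
  have "map_mat to_ac M *\<^sub>v w = z \<cdot>\<^sub>v w"
  proof (rule eq_vecI)
    show "dim_vec (map_mat to_ac M *\<^sub>v w) = dim_vec (z \<cdot>\<^sub>v w)" by (simp add: M_def w_def)
    fix i assume "i < dim_vec (z \<cdot>\<^sub>v w)"
    hence i: "i < N" by (simp add: w_def)
    have "(map_mat to_ac M *\<^sub>v w) $ i = (\<Sum>j<N. to_ac (M $$ (i, j)) * w $ j)"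
      using i by (simp add: M_def w_def scalar_prod_def atLeast0LessThan)
    also have "\<dots> = (\<Sum>j<n. to_ac (M $$ (i, j)) * w $ j)"
      using nN by (intro sum.mono_neutral_right) (auto simp: w_def)
    also have "\<dots> = z * w $ i"
    proof (cases "i < n")
      case True
      have "(\<Sum>j<n. to_ac (M $$ (i, j)) * w $ j) =
        to_ac (M $$ (i, n - 1)) * w $ (n - 1) + (\<Sum>j<n - 1. to_ac (M $$ (i, j)) * w $ j)"
        using n0 by (cases n) (simp_all add: add.commute)
      also have "to_ac (M $$ (i, n - 1)) * w $ (n - 1) = - to_ac (Polynomial.coeff s i)"
        using True n0 nN tlead i by (simp add: M_def w_def companion_def n_def[symmetric] Let_def)
      also have "(\<Sum>j<n - 1. to_ac (M $$ (i, j)) * w $ j) = (\<Sum>j<n - 1. if i = Suc j then Polynomial.coeff t j else 0)"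
        using True nN i by (intro sum.cong) (auto simp: M_def w_def companion_def n_def[symmetric] Let_def)
      also have "\<dots> = Polynomial.coeff (pCons 0 t) i"
        using True by (cases i) (simp_all add: less_diff_conv)
      finally show ?thesis using st[of i] True i by (simp add: w_def)
    next
      case False
      thus ?thesis using i nN by (simp add: M_def w_def)
    qed
    finally show "(map_mat to_ac M *\<^sub>v w) $ i = (z \<cdot>\<^sub>v w) $ i" using i by (simp add: w_def)
  qed
  hence "eigenvalue (map_mat to_ac M) z"
    unfolding eigenvalue_def eigenvector_def using w0
    by (intro exI[of _ w]) (simp add: M_def w_def)
  thus ?thesis unfolding ac_eigenvalue_def using rep by blast
qed

end

context quad_endo
begin

text \<open>The form in which regularity enters: a kernel would give torsion for an irreducible
  factor of \<open>disc(t^2 - \<delta> t)\<close>, and the roots of that factor would be eigenvalues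
  in \<open>root_diff p q\<close>.\<close>

lemma disc_injective:
  assumes fin: "finite_dimensional_vector_space scale Bas" and reg: "d_regular scale p q u"
    and x: "actv disc x = 0"
  shows "x = 0"
proof (rule ccontr)
  assume "x \<noteq> 0"
  hence "\<exists>s y. Factorial_Ring.irreducible s \<and> monic s \<and> s dvd subst_quad dl disc \<and> y \<noteq> 0 \<and> act s y = 0"
    using irreducible_torsion[of "subst_quad dl disc" x] x disc_nonzero by (simp add: actv_def)
  then obtain s y where s: "Factorial_Ring.irreducible s" "monic s" "s dvd subst_quad dl disc" "y \<noteq> 0" "act s y = 0"
    by blast
  obtain z where z: "ac_eval s z = 0" using ac_eval_root_exists[OF irreducible_poly_degree_pos[OF s(1)]] by blast
  have "ac_eigenvalue scale u z" using eigenvalue_of_torsion[OF fin s(1,2,4,5) z] .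
  hence "z \<notin> root_diff p q" using reg by (simp add: d_regular_def)
  moreover have "ac_eval (subst_quad dl disc) z = 0" using s(3) z by (auto simp: dvd_def ac_eval_mult)
  ultimately show False by (simp add: disc_root_iff)
qed

lemma actv_scale: "actv f (c *s x) = c *s actv f x"
  by (simp add: actv_def act_scale)

lemma actv_annihilator:
  assumes fin: "finite_dimensional_vector_space scale Bas"
  shows "\<exists>m. m \<noteq> 0 \<and> (\<forall>x. actv m x = 0)"
proof -
  define v where "v x = actv TT x" for x
  interpret E: endo scale v
  proof (rule endo.intro[OF vector_space_axioms endo_axioms.intro])
    show "Vector_Spaces.linear scale scale v"
      unfolding Vector_Spaces.linear_iff v_def using vector_space_axioms
      by (simp add: V.scale_right_distrib actv_scale)
  qed
  have "E.act f x = actv f x" for f x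
  proof (induction f)
    case (pCons c f)
    have "pCons c f = [:c:] + TT * f" by (simp add: TT_def)
    hence "actv (pCons c f) x = c *s x + actv TT (actv f x)"
      by (simp add: V.scale_left_distrib actv_const)
    thus ?case unfolding E.act_pCons pCons.IH by (simp add: v_def)
  qed simp
  thus ?thesis using E.annihilator_exists[OF fin] by simp
qed

lemma poly_end_quadratic:
  assumes "f = [:c0, - c1, 1:]"
  shows "poly_end scale f g x = c0 *s x - c1 *s g x + g (g x)"
  unfolding assms poly_end_def by (simp add: numeral_2_eq_2)

lemma poly_end_p: "poly_end scale p g x = al *s x - lam *s g x + g (g x)"
  using p_expand by (rule poly_end_quadratic)

lemma poly_end_q: "poly_end scale q g x = be *s x - mu *s g x + g (g x)"
  using q_expand by (rule poly_end_quadratic)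

lemma actv_LL: "actv LL x = lam *s x" and actv_AA: "actv AA x = al *s x" and actv_DD: "actv DD x = lam *s x - mu *s x"
  by (simp_all add: LL_def AA_def DD_def actv_const dl_def scale_left_diff_distrib)

lemma actv_TT: "actv TT x = u (u x) - actv DD (u x)"
  using u_u[of x] by simp

lemma actv_KK: "actv KK x = actv TT x + be *s x - al *s x"
proof -
  have "KK = TT + [:be:] - [:al:]" by (simp add: KK_def TT_def)
  thus ?thesis by (simp add: V.scale_left_distrib V.scale_left_diff_distrib actv_const)
qed

lemma pq_difference_iff_splits: "pq_difference scale p q u \<longleftrightarrow> (\<exists>a. splits_on UNIV a)"
proof
  assume "pq_difference scale p q u"
  then obtain a b where ab: "Vector_Spaces.linear scale scale a"
    "\<And>v. poly_end scale p a v = 0" "\<And>v. poly_end scale q b v = 0" "\<And>v. u v = a v - b v"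
    unfolding pq_difference_def by blast
  have a_add: "a (x + y) = a x + a y" and a_scale: "a (c *s x) = c *s a x" for x y c
    using ab(1) by (simp_all add: Vector_Spaces.linear_iff)
  have a_diff: "a (x - y) = a x - a y" for x y using a_add[of "x - y" y] by (simp add: algebra_simps)
  have b: "b v = a v - u v" for v using ab(4)[of v] by simp
  have aa: "a (a v) = lam *s a v - al *s v" for v
    using ab(2)[of v] by (simp add: poly_end_p algebra_simps)
  have "be *s v - mu *s (a v - u v) + ((a (a v) - u (a v)) - (a (u v) - u (u v))) = 0" for v
    using ab(3)[of v] unfolding poly_end_q b a_diff u_diff by (simp add: algebra_simps)
  hence au: "a (u v) + u (a v) = actv DD (a v) + actv LL (u v) + actv KK v" for v
    unfolding aa actv_KK actv_TT actv_DD actv_LL by (simp add: algebra_simps scale_right_diff_distrib)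
  \<comment> \<open>The relation is applied twice to move \<open>a\<close> past \<open>u u\<close>.
    The terms in \<open>LL\<close> and \<open>KK\<close> cancel, and those in \<open>DD\<close> are
    absorbed by \<open>u^2 - \<delta> u\<close>.\<close>
  have aT: "a (actv TT x) = actv TT (a x)" for x
  proof -
    have au': "a (u v) = actv DD (a v) + actv LL (u v) + actv KK v - u (a v)" for v
      using au[of v] by (simp add: eq_diff_eq)
    have "a (u (u x)) = actv DD (a (u x)) + actv LL (u (u x)) + actv KK (u x) - u (a (u x))"
      by (rule au')
    also have "u (a (u x)) = actv DD (u (a x)) + actv LL (u (u x)) + actv KK (u x) - u (u (a x))"
      unfolding au' by (simp add: u_add u_diff)
    finally have "a (u (u x)) = actv DD (a (u x)) - actv DD (u (a x)) + u (u (a x))" by simp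
    moreover have "a (actv DD z) = actv DD (a z)" for z unfolding actv_DD a_diff a_scale ..
    ultimately show ?thesis unfolding actv_TT a_diff by simp
  qed
  have "a (actv f x) = actv f (a x)" for f x
  proof (induction f)
    case 0 show ?case using a_scale[of 0 0] by simp
  next
    case (pCons c f)
    have e: "actv (pCons c f) z = c *s z + actv TT (actv f z)" for z
    proof -
      have "pCons c f = [:c:] + TT * f" by (simp add: TT_def)
      thus ?thesis by (simp add: V.scale_left_distrib actv_const)
    qed
    show ?case unfolding e a_add a_scale aT pCons.IH ..
  qed
  hence "splits_on UNIV a"
    unfolding splits_on_def V.hom_on_def relations_def using a_add aa au by (simp add: actv_LL actv_AA)
  thus "\<exists>a. splits_on UNIV a" by blast
next
  assume "\<exists>a. splits_on UNIV a"
  then obtain a where s: "splits_on UNIV a" by blast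
  have a_add: "a (x + y) = a x + a y" and a_act: "a (actv g x) = actv g (a x)"
    and aa: "a (a x) = actv LL (a x) - actv AA x"
    and au: "a (u x) + u (a x) = actv DD (a x) + actv LL (u x) + actv KK x" for x y g
    using s by (auto simp: splits_on_def V.hom_on_def relations_def)
  have a_scale: "a (c *s x) = c *s a x" for c x using a_act[of "[:c:]" x] by (simp add: actv_const)
  have a_diff: "a (x - y) = a x - a y" for x y using a_add[of "x - y" y] by (simp add: algebra_simps)
  define b where "b x = a x - u x" for x
  have "Vector_Spaces.linear scale scale a"
    unfolding Vector_Spaces.linear_iff by (simp add: vector_space_axioms a_add a_scale)
  moreover have "Vector_Spaces.linear scale scale b"
    unfolding Vector_Spaces.linear_iff
    by (simp add: vector_space_axioms b_def a_add a_scale u_add u_scale scale_right_diff_distrib)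
  moreover have "poly_end scale p a x = 0" for x
    unfolding poly_end_p aa actv_LL actv_AA by simp
  moreover have "poly_end scale q b x = 0" for x
  proof -
    have "poly_end scale q b x = be *s x - mu *s (a x - u x) + (a (a x) - (a (u x) + u (a x)) + u (u x))"
      unfolding poly_end_q b_def a_diff u_diff by (simp add: algebra_simps)
    also have "\<dots> = 0"
      unfolding au aa actv_KK actv_TT actv_DD actv_LL actv_AA by (simp add: algebra_simps)
    finally show ?thesis .
  qed
  moreover have "u x = a x - b x" for x by (simp add: b_def)
  ultimately show "pq_difference scale p q u" unfolding pq_difference_def by blast
qed

end

section \<open>Elementary divisors and invariant factors\<close>

lemma finite_irreducible_divisors:
  fixes f :: "'a::field poly"
  assumes "f \<noteq> 0"
  shows "\<exists>R. finite R \<and> (\<forall>r\<in>R. Factorial_Ring.irreducible r \<and> monic r) \<and>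
    (\<forall>r. Factorial_Ring.irreducible r \<longrightarrow> monic r \<longrightarrow> r dvd f \<longrightarrow> r \<in> R)"
  using assms
proof (induction "Polynomial.degree f" arbitrary: f rule: less_induct)
  case (less f)
  show ?case
  proof (cases "is_unit f")
    case True
    have "\<not> r dvd f" if "Factorial_Ring.irreducible r" for r
      using True that by (meson dvd_trans irreducible_not_unit)
    thus ?thesis by (intro exI[of _ "{}"]) auto
  next
    case False
    then obtain s where s: "Factorial_Ring.irreducible s" "monic s" "s dvd f"
      using monic_irreducible_factor[OF less.prems] by blast
    then obtain k where k: "f = s * k" by (elim dvdE)
    have k0: "k \<noteq> 0" "s \<noteq> 0" using k less.prems by auto
    have "Polynomial.degree k < Polynomial.degree f"
      using irreducible_poly_degree_pos[OF s(1)] k0 by (simp add: k degree_mult_eq)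
    from less.hyps[OF this k0(1)] obtain R where R: "finite R" "\<forall>r\<in>R. Factorial_Ring.irreducible r \<and> monic r"
      "\<forall>r. Factorial_Ring.irreducible r \<longrightarrow> monic r \<longrightarrow> r dvd k \<longrightarrow> r \<in> R" by blast
    have "r \<in> insert s R" if r: "Factorial_Ring.irreducible r" "monic r" "r dvd f" for r
    proof -
      have "r dvd s \<or> r dvd k" using irreducible_dvd_multD[OF r(1)] r(3) k by blast
      thus ?thesis using irreducible_dvd_irreducible_monic[OF r(1,2) s(1,2)] R(3) r by blast
    qed
    thus ?thesis using R s by (intro exI[of _ "insert s R"]) auto
  qed
qed

text \<open>Exponents of successive invariant factors: positions count from 1, and the value 0
  beyond the end stands for the factor 1.\<close>

definition padded_nth :: "nat list \<Rightarrow> nat \<Rightarrow> nat" where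
  "padded_nth l i = (if 1 \<le> i \<and> i \<le> length l then l ! (i - 1) else 0)"

lemma padded_nth_antimono:
  assumes "sorted_wrt (\<ge>) l" "i \<ge> 1" shows "padded_nth l (Suc i) \<le> padded_nth l i"
  using assms sorted_wrt_nth_less[OF assms(1), of "i - 1" i] by (auto simp: padded_nth_def)

text \<open>Each entry of a decreasing list is written twice in succession; positions
  \<open>2 n - 1\<close> and \<open>2 n\<close> then agree, also beyond the end.\<close>

lemma double_list_exists:
  "\<exists>l. mset l = M + M \<and> sorted_wrt (\<ge>) l \<and> (\<forall>n\<ge>1. padded_nth l (2 * n - 1) = padded_nth l (2 * n))"
  for M :: "nat multiset"
proof -
  define d where "d = (\<lambda>xs :: nat list. concat (map (\<lambda>x. [x, x]) xs))"
  have "mset (d xs) = mset xs + mset xs \<and> (sorted_wrt (\<ge>) xs \<longrightarrow> sorted_wrt (\<ge>) (d xs)) \<and>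
      set (d xs) = set xs \<and> length (d xs) = 2 * length xs \<and> (\<forall>k<length xs. d xs ! (2 * k) = xs ! k \<and> d xs ! Suc (2 * k) = xs ! k)" for xs
  proof (induction xs)
    case (Cons x xs)
    have e: "d (x # xs) = x # x # d xs" by (simp add: d_def)
    have "d (x # xs) ! (2 * k) = (x # xs) ! k \<and> d (x # xs) ! Suc (2 * k) = (x # xs) ! k" if "k < length (x # xs)" for k
      using Cons that by (cases k) (auto simp: e)
    thus ?case using Cons by (auto simp: e)
  qed (simp add: d_def)
  note d = this
  define xs where "xs = rev (sorted_list_of_multiset M)"
  have xs: "mset xs = M" "sorted_wrt (\<ge>) xs"
    using sorted_sorted_list_of_multiset[of M] by (simp_all add: xs_def sorted_wrt_rev)
  have "padded_nth (d xs) (2 * n - 1) = padded_nth (d xs) (2 * n)" if n: "n \<ge> 1" for n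
  proof -
    obtain k where k: "n = Suc k" using n by (cases n) auto
    show ?thesis
    proof (cases "k < length xs")
      case True
      thus ?thesis using d[of xs] by (simp add: k padded_nth_def)
    qed (use d[of xs] in \<open>simp add: k padded_nth_def\<close>)
  qed
  thus ?thesis using d[of xs] xs by (intro exI[of _ "d xs"]) auto
qed

lemma sorted_list_exists: "\<exists>l. mset l = C \<and> sorted_wrt (\<ge>) l" for C :: "nat multiset"
  using sorted_sorted_list_of_multiset[of C]
  by (intro exI[of _ "rev (sorted_list_of_multiset C)"]) (simp add: sorted_wrt_rev)

lemma sum_padded_nth_mset: "(\<Sum>i\<in>{1..length l}. {#h (padded_nth l i)#}) = image_mset h (mset l)"
proof -
  have "(\<Sum>i\<in>{1..length l}. {#h (padded_nth l i)#}) = (\<Sum>i<length l. {#h (l ! i)#})"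
    by (rule sum.reindex_bij_witness[of _ Suc "\<lambda>i. i - 1"]) (auto simp: padded_nth_def)
  also have "\<dots> = image_mset h (mset l)"
    by (induction l rule: rev_induct) (auto simp: nth_append)
  finally show ?thesis .
qed

lemma sum_pairs: "(\<Sum>i\<in>{1..2 * N}. g i) = (\<Sum>n\<in>{1..N}. g (2 * n - 1) + g (2 * n))"
  for g :: "nat \<Rightarrow> 'b::comm_monoid_add"
  by (induction N) (auto simp: add.assoc)

lemma diag_block_mat_flatten: "diag_block_mat (diag_block_mat As # Bs) = diag_block_mat (As @ Bs)"
  by (simp add: diag_block_mat_append Let_def)

section \<open>Admissible multisets of annihilators\<close>

context quad_pair
begin

lemma has_type1_iff:
  "has_type1 p q r \<longleftrightarrow> Factorial_Ring.irreducible r \<and> monic r \<and> \<not> r dvd disc \<and> unorm_isotropic r"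
  unfolding has_type1_def type_norm_isotropic_iff using no_root_in_diff_iff by blast

lemma has_type2_iff:
  "has_type2 p q r \<longleftrightarrow> Factorial_Ring.irreducible r \<and> monic r \<and> \<not> r dvd disc \<and> \<not> unorm_isotropic r"
  unfolding has_type2_def type_norm_isotropic_iff using no_root_in_diff_iff by blast

text \<open>The annihilators of the blocks in (iii), except that the exponent 0 is allowed. It
  yields the annihilator 1, hence a zero summand, and avoids case distinctions.\<close>

inductive admissible :: "'a poly multiset \<Rightarrow> bool" where
  admissible_empty: "admissible {#}"
| admissible_single: "admissible F \<Longrightarrow> has_type1 p q r \<Longrightarrow> admissible (add_mset (subst_quad dl (r ^ n)) F)"
| admissible_double: "admissible F \<Longrightarrow> Factorial_Ring.irreducible r \<Longrightarrow> monic r \<Longrightarrow>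
    admissible (add_mset (subst_quad dl (r ^ n)) (add_mset (subst_quad dl (r ^ n)) F))"

lemma admissible_add: "admissible F \<Longrightarrow> admissible G \<Longrightarrow> admissible (F + G)"
  by (induction rule: admissible.induct) (auto intro: admissible.intros)

lemma admissible_sum: "(\<And>i. i \<in> I \<Longrightarrow> admissible (F i)) \<Longrightarrow> admissible (\<Sum>i\<in>I. F i)"
  by (induction I rule: infinite_finite_induct) (auto intro: admissible_add admissible_empty)

definition admissible_block :: "'a mat \<Rightarrow> bool" where
  "admissible_block M \<longleftrightarrow> (\<exists>r n. has_type1 p q r \<and> n \<ge> 1 \<and> M = companion (subst_quad dl (r ^ n))) \<or>
     (\<exists>r n. Factorial_Ring.irreducible r \<and> monic r \<and> n \<ge> 1 \<and>
        M = diag_block_mat [companion (subst_quad dl (r ^ n)), companion (subst_quad dl (r ^ n))])"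

lemma monic_subst_power: "monic r \<Longrightarrow> monic (subst_quad dl (r ^ n))"
  by (intro monic_subst_quad monic_power)

lemma admissible_of_blocks:
  assumes "\<And>M. M \<in> set Bs \<Longrightarrow> admissible_block M"
  shows "\<exists>fs. admissible (mset fs) \<and> (\<forall>f\<in>set fs. monic f) \<and> diag_block_mat Bs = diag_block_mat (map companion fs)"
  using assms
proof (induction Bs)
  case Nil
  show ?case by (intro exI[of _ "[]"]) (auto intro: admissible_empty)
next
  case (Cons M Bs)
  then obtain fs where fs: "admissible (mset fs)" "\<forall>f\<in>set fs. monic f"
    "diag_block_mat Bs = diag_block_mat (map companion fs)" by auto
  have "admissible_block M" using Cons.prems by simp
  thus ?case unfolding admissible_block_def
  proof (elim disjE exE conjE)
    fix r n assume r: "has_type1 p q r" "M = companion (subst_quad dl (r ^ n))"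
    let ?f = "subst_quad dl (r ^ n)"
    have "admissible (mset (?f # fs))" using admissible_single[OF fs(1) r(1)] by simp
    moreover have "\<forall>f\<in>set (?f # fs). monic f" using fs(2) r(1) monic_subst_power by (simp add: has_type1_def)
    moreover have "diag_block_mat (M # Bs) = diag_block_mat (map companion (?f # fs))" using fs(3) r(2) by simp
    ultimately show ?thesis by blast
  next
    fix r n assume r: "Factorial_Ring.irreducible r" "monic r"
      "M = diag_block_mat [companion (subst_quad dl (r ^ n)), companion (subst_quad dl (r ^ n))]"
    let ?f = "subst_quad dl (r ^ n)"
    have "admissible (mset (?f # ?f # fs))" using admissible_double[OF fs(1) r(1,2)] by simp
    moreover have "\<forall>f\<in>set (?f # ?f # fs). monic f" using fs(2) r(2) monic_subst_power by simp
    moreover have "diag_block_mat (M # Bs) = diag_block_mat (map companion (?f # ?f # fs))"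
      unfolding r(3) diag_block_mat_flatten using fs(3) by simp
    ultimately show ?thesis by blast
  qed
qed

lemma type1_not_type2: "has_type1 p q r \<Longrightarrow> \<not> has_type2 p q r"
  by (simp add: has_type1_iff has_type2_iff)

text \<open>A polynomial of Type 2 enters only through doubled members, so its exponents form a
  multiset \<open>M + M\<close>. This parity is the source of the condition in (ii).\<close>

lemma admissible_grading:
  assumes "admissible F"
  shows "\<exists>R C. finite R \<and> (\<forall>r\<in>R. Factorial_Ring.irreducible r \<and> monic r) \<and> (\<forall>r. r \<notin> R \<longrightarrow> C r = {#}) \<and>
    F = (\<Sum>r\<in>R. image_mset (\<lambda>n. subst_quad dl (r ^ n)) (C r)) \<and> (\<forall>r. has_type2 p q r \<longrightarrow> (\<exists>M. C r = M + M))"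
  using assms
proof (induction rule: admissible.induct)
  case admissible_empty
  show ?case by (intro exI[of _ "{}"] exI[of _ "\<lambda>_. {#}"]) auto
next
  have upd: "(\<Sum>s\<in>insert r R. image_mset (\<lambda>n. subst_quad dl (s ^ n)) ((C(r := D + C r)) s)) =
      image_mset (\<lambda>n. subst_quad dl (r ^ n)) D + (\<Sum>s\<in>R. image_mset (\<lambda>n. subst_quad dl (s ^ n)) (C s))"
    if R: "finite R" "\<forall>r. r \<notin> R \<longrightarrow> C r = {#}" for r R D and C :: "'a poly \<Rightarrow> nat multiset"
  proof -
    let ?h = "\<lambda>s. image_mset (\<lambda>n. subst_quad dl (s ^ n))"
    have "(\<Sum>s\<in>insert r R. ?h s ((C(r := D + C r)) s)) = ?h r (D + C r) + (\<Sum>s\<in>R - {r}. ?h s ((C(r := D + C r)) s))"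
      using R(1) by (simp add: sum.insert_remove)
    also have "(\<Sum>s\<in>R - {r}. ?h s ((C(r := D + C r)) s)) = (\<Sum>s\<in>R - {r}. ?h s (C s))"
      by (intro sum.cong) auto
    finally have "(\<Sum>s\<in>insert r R. ?h s ((C(r := D + C r)) s)) = ?h r D + (?h r (C r) + (\<Sum>s\<in>R - {r}. ?h s (C s)))"
      by (simp add: add.assoc)
    also have "?h r (C r) + (\<Sum>s\<in>R - {r}. ?h s (C s)) = (\<Sum>s\<in>R. ?h s (C s))"
      using R by (cases "r \<in> R") (simp_all add: sum.remove)
    finally show ?thesis .
  qed
  {
    case (admissible_single F r n)
    then obtain R C where RC: "finite R" "\<forall>r\<in>R. Factorial_Ring.irreducible r \<and> monic r" "\<forall>r. r \<notin> R \<longrightarrow> C r = {#}"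
      "F = (\<Sum>r\<in>R. image_mset (\<lambda>n. subst_quad dl (r ^ n)) (C r))" "\<forall>r. has_type2 p q r \<longrightarrow> (\<exists>M. C r = M + M)" by blast
    have "\<forall>s. has_type2 p q s \<longrightarrow> (\<exists>M. (C(r := {#n#} + C r)) s = M + M)"
      using RC(5) type1_not_type2[OF admissible_single.hyps(2)] by auto
    moreover have "add_mset (subst_quad dl (r ^ n)) F =
        (\<Sum>s\<in>insert r R. image_mset (\<lambda>n. subst_quad dl (s ^ n)) ((C(r := {#n#} + C r)) s))"
      unfolding upd[OF RC(1,3)] RC(4)[symmetric] by simp
    moreover have "\<forall>s\<in>insert r R. Factorial_Ring.irreducible s \<and> monic s"
      using RC(2) admissible_single.hyps(2) by (simp add: has_type1_iff)
    ultimately show ?case using RC(1,3)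
      by (intro exI[of _ "insert r R"] exI[of _ "C(r := {#n#} + C r)"]) simp
  next
    case (admissible_double F r n)
    then obtain R C where RC: "finite R" "\<forall>r\<in>R. Factorial_Ring.irreducible r \<and> monic r" "\<forall>r. r \<notin> R \<longrightarrow> C r = {#}"
      "F = (\<Sum>r\<in>R. image_mset (\<lambda>n. subst_quad dl (r ^ n)) (C r))" "\<forall>r. has_type2 p q r \<longrightarrow> (\<exists>M. C r = M + M)" by blast
    have "\<exists>M. (C(r := {#n, n#} + C r)) s = M + M" if "has_type2 p q s" for s
    proof -
      obtain M where M: "C s = M + M" using RC(5) \<open>has_type2 p q s\<close> by blast
      show ?thesis
      proof (cases "s = r")
        case True
        thus ?thesis using M by (intro exI[of _ "add_mset n M"]) simp
      qed (use M in auto)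
    qed
    moreover have "add_mset (subst_quad dl (r ^ n)) (add_mset (subst_quad dl (r ^ n)) F) =
        (\<Sum>s\<in>insert r R. image_mset (\<lambda>n. subst_quad dl (s ^ n)) ((C(r := {#n, n#} + C r)) s))"
      unfolding upd[OF RC(1,3)] RC(4)[symmetric] by simp
    moreover have "\<forall>s\<in>insert r R. Factorial_Ring.irreducible s \<and> monic s"
      using RC(2) admissible_double.hyps(2,3) by simp
    ultimately show ?case using RC(1,3)
      by (intro exI[of _ "insert r R"] exI[of _ "C(r := {#n, n#} + C r)"]) simp
  }
qed

end

context poly_module
begin

lemma cyclic_equiv_empty_sum: "(\<And>i. i \<in> I \<Longrightarrow> F i = {#1#}) \<Longrightarrow> cyclic_equiv (\<Sum>i\<in>I. F i) {#}"
  using cyclic_equiv_sum[of I F "\<lambda>_. {#}"] cyclic_equiv_one by simp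

end

section \<open>From admissible multisets to blocks and to differences\<close>

context quad_endo
begin

text \<open>Since (iii) asks for exponents at least 1, summands with exponent 0 are dropped;
  therefore \<open>fs\<close> is only equivalent to \<open>F\<close>.\<close>

lemma blocks_of_admissible:
  assumes "admissible F"
  shows "\<exists>Bs fs. (\<forall>M\<in>set Bs. admissible_block M) \<and> (\<forall>f\<in>set fs. monic f) \<and>
    diag_block_mat Bs = diag_block_mat (map companion fs) \<and> U.cyclic_equiv F (mset fs)"
  using assms
proof (induction rule: admissible.induct)
  case admissible_empty
  show ?case by (intro exI[of _ "[]"]) auto
next
  case (admissible_single F r n)
  then obtain Bs fs where IH: "\<forall>M\<in>set Bs. admissible_block M" "\<forall>f\<in>set fs. monic f"
    "diag_block_mat Bs = diag_block_mat (map companion fs)" "U.cyclic_equiv F (mset fs)" by blast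
  let ?f = "subst_quad dl (r ^ n)"
  have cyclic_equiv: "U.cyclic_equiv (add_mset ?f F) (mset (?f # fs))"
    using U.cyclic_equiv_add[OF U.cyclic_equiv_refl IH(4), of "{#?f#}"] by simp
  show ?case
  proof (cases "n = 0")
    case True
    have "U.cyclic_equiv ({#1#} + F) ({#} + mset fs)" by (intro U.cyclic_equiv_add U.cyclic_equiv_one IH(4))
    thus ?thesis using IH True by (intro exI[of _ Bs] exI[of _ fs]) simp
  next
    case False
    have "admissible_block (companion ?f)" unfolding admissible_block_def using admissible_single.hyps(2) False by (metis One_nat_def Suc_leI neq0_conv)
    moreover have "monic ?f" using admissible_single.hyps(2) monic_subst_power by (simp add: has_type1_def)
    ultimately show ?thesis using IH cyclic_equiv
      by (intro exI[of _ "companion ?f # Bs"] exI[of _ "?f # fs"]) simp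
  qed
next
  case (admissible_double F r n)
  then obtain Bs fs where IH: "\<forall>M\<in>set Bs. admissible_block M" "\<forall>f\<in>set fs. monic f"
    "diag_block_mat Bs = diag_block_mat (map companion fs)" "U.cyclic_equiv F (mset fs)" by blast
  let ?f = "subst_quad dl (r ^ n)"
  let ?M = "diag_block_mat [companion ?f, companion ?f]"
  have cyclic_equiv: "U.cyclic_equiv (add_mset ?f (add_mset ?f F)) (mset (?f # ?f # fs))"
    using U.cyclic_equiv_add[OF U.cyclic_equiv_refl IH(4), of "{#?f, ?f#}"] by simp
  show ?case
  proof (cases "n = 0")
    case True
    have "U.cyclic_equiv ({#1#} + ({#1#} + F)) ({#} + ({#} + mset fs))" by (intro U.cyclic_equiv_add U.cyclic_equiv_one IH(4))
    thus ?thesis using IH True by (intro exI[of _ Bs] exI[of _ fs]) simp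
  next
    case False
    have "admissible_block ?M" unfolding admissible_block_def using admissible_double.hyps(2,3) False by (metis One_nat_def Suc_leI neq0_conv)
    moreover have "monic ?f" using admissible_double.hyps(3) monic_subst_power by simp
    moreover have "diag_block_mat (?M # Bs) = diag_block_mat (map companion (?f # ?f # fs))"
      unfolding diag_block_mat_flatten using IH(3) by simp
    ultimately show ?thesis using IH(1,2) cyclic_equiv
      by (intro exI[of _ "?M # Bs"] exI[of _ "?f # ?f # fs"]) (simp del: diag_block_mat.simps)
  qed
qed

lemma blocks_iff:
  "(\<exists>Bs. represented_by scale u (diag_block_mat Bs) \<and> (\<forall>M\<in>set Bs. admissible_block M)) \<longleftrightarrow>
   (\<exists>F. admissible F \<and> U.cyclic_sum UNIV F)"
proof
  assume "\<exists>Bs. represented_by scale u (diag_block_mat Bs) \<and> (\<forall>M\<in>set Bs. admissible_block M)"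
  then obtain Bs where Bs: "represented_by scale u (diag_block_mat Bs)" "\<forall>M\<in>set Bs. admissible_block M" by blast
  obtain fs where fs: "admissible (mset fs)" "\<forall>f\<in>set fs. monic f" "diag_block_mat Bs = diag_block_mat (map companion fs)"
    using admissible_of_blocks[of Bs] Bs(2) by blast
  have "U.cyclic_sum UNIV (mset fs)" using represented_by_companions_iff[of fs] fs(2,3) Bs(1) by simp
  thus "\<exists>F. admissible F \<and> U.cyclic_sum UNIV F" using fs(1) by blast
next
  assume "\<exists>F. admissible F \<and> U.cyclic_sum UNIV F"
  then obtain F where F: "admissible F" "U.cyclic_sum UNIV F" by blast
  obtain Bs fs where b: "\<forall>M\<in>set Bs. admissible_block M" "\<forall>f\<in>set fs. monic f"
    "diag_block_mat Bs = diag_block_mat (map companion fs)" "U.cyclic_equiv F (mset fs)"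
    using blocks_of_admissible[OF F(1)] by blast
  have "U.cyclic_sum UNIV (mset fs)" using U.cyclic_equiv_sum_iff[OF b(4)] F(2) by blast
  hence "represented_by scale u (diag_block_mat Bs)" using represented_by_companions_iff[of fs] b(2,3) by simp
  thus "\<exists>Bs. represented_by scale u (diag_block_mat Bs) \<and> (\<forall>M\<in>set Bs. admissible_block M)" using b(1) by blast
qed

lemma splits_of_admissible:
  assumes "admissible F" "U.cyclic_sum S F"
  shows "\<exists>a. splits_on S a"
  using assms
proof (induction arbitrary: S rule: admissible.induct)
  case admissible_empty
  hence "S = {0}" using U.cyclic_sum_emptyE by blast
  thus ?case by (intro exI[of _ "\<lambda>_. 0"]) (simp add: splits_on_def V.hom_on_def relations_def)
next
  case (admissible_single F r n)
  from admissible_single.prems obtain x S' where x: "S = U.adjoin x S'" "U.cyclic_sum S' F" "U.subspace S'"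
    "act (subst_quad dl (r ^ n)) x = 0" "\<And>g. act g x \<in> S' \<Longrightarrow> subst_quad dl (r ^ n) dvd g"
    by (metis U.cyclic_sum_add_msetE)
  obtain a where a: "splits_on S' a" using admissible_single.IH[OF x(2)] by blast
  have r: "Factorial_Ring.irreducible r" "\<not> r dvd disc" "unorm_isotropic r"
    using admissible_single.hyps(2) by (simp_all add: has_type1_iff)
  obtain y0 w0 where "r dvd conic y0 w0" using conic_solvable[OF r] by blast
  from conic_lift[OF r(1,2) this] obtain y w where "r ^ Suc n dvd conic y w" by blast
  hence "r ^ n dvd conic y w" by (metis dvd_trans dvd_triv_right power_Suc)
  thus ?case using splits_on_single[OF x(3) a x(4,5)] x(1) by blast
next
  case (admissible_double F r n)
  let ?f = "subst_quad dl (r ^ n)"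
  from admissible_double.prems obtain x S1 where x: "S = U.adjoin x S1" "U.cyclic_sum S1 (add_mset ?f F)"
    "act ?f x = 0" "\<And>g. act g x \<in> S1 \<Longrightarrow> ?f dvd g"
    by (metis U.cyclic_sum_add_msetE)
  from x(2) obtain y S' where y: "S1 = U.adjoin y S'" "U.cyclic_sum S' F" "U.subspace S'"
    "act ?f y = 0" "\<And>g. act g y \<in> S' \<Longrightarrow> ?f dvd g"
    by (metis U.cyclic_sum_add_msetE)
  obtain a where a: "splits_on S' a" using admissible_double.IH[OF y(2)] by blast
  show ?case unfolding x(1) y(1)
    by (rule splits_on_double[OF y(3) a y(4,5) x(3)]) (use x(4) y(1) in auto)
qed

end

section \<open>From a difference to an admissible multiset\<close>

context split_endo
begin

text \<open>Stated for kernels of arbitrary \<open>m\<close>, so that an induction on the degree can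
  peel off one primary component at a time.\<close>

lemma kernel_admissible:
  assumes fin: "finite_dimensional_vector_space scale Bas" and inj: "\<And>x. actv disc x = 0 \<Longrightarrow> x = 0"
    and "m \<noteq> 0"
  shows "\<exists>F. admissible F \<and> U.cyclic_sum {x. actv m x = 0} F"
  using \<open>m \<noteq> 0\<close>
proof (induction "Polynomial.degree m" arbitrary: m rule: less_induct)
  case (less m)
  show ?case
  proof (cases "is_unit m")
    case True
    have "x = 0" if "actv m x = 0" for x using V.act_dvd_eq_0[OF that True] by simp
    hence "{x. actv m x = 0} = {0}" by auto
    thus ?thesis using U.cyclic_sum_empty admissible_empty by auto
  next
    case False
    then obtain r where r: "Factorial_Ring.irreducible r" "monic r" "r dvd m"
      using monic_irreducible_factor[OF less.prems] by blast
    obtain k g where kg: "m = r ^ k * g" "\<not> r dvd g" using irreducible_power_split[OF r(1) less.prems] by blast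
    obtain k' where k': "k = Suc k'" using kg r(3) by (cases k) auto
    have nz: "g \<noteq> 0" "r \<noteq> 0" "r ^ k \<noteq> 0" using less.prems kg(1) r(2) by auto
    have "Polynomial.degree (r ^ k) > 0"
      using irreducible_poly_degree_pos[OF r(1)] nz unfolding k' power_Suc by (subst degree_mult_eq) auto
    hence "Polynomial.degree g < Polynomial.degree m" using nz by (simp add: kg(1) degree_mult_eq)
    from less.hyps[OF this nz(1)] obtain G where G: "admissible G" "U.cyclic_sum {x. actv g x = 0} G" by blast
    have "\<exists>F. admissible F \<and> U.cyclic_sum {x. actv (r ^ k) x = 0} F"
    proof (cases "r dvd disc")
      case True
      \<comment> \<open>\<open>r\<close> divides \<open>disc\<close>, whose action is injective, so
        \<open>r\<close> acts injectively and its primary component is zero.\<close>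
      have "actv (r ^ j) x = 0 \<Longrightarrow> x = 0" for j x
      proof (induction j)
        case (Suc j)
        have "actv r (actv (r ^ j) x) = 0" using Suc.prems by simp
        hence "actv disc (actv (r ^ j) x) = 0" using V.act_dvd_eq_0 True by blast
        thus ?case using inj Suc.IH by blast
      qed simp
      hence "{x. actv (r ^ k) x = 0} = {0}" by auto
      thus ?thesis using U.cyclic_sum_empty admissible_empty by auto
    next
      case nd: False
      show ?thesis
      proof (cases "unorm_isotropic r")
        case True
        obtain y0 w0 where "r dvd conic y0 w0" using conic_solvable[OF r(1) nd True] by blast
        from conic_lift[OF r(1) nd this] obtain y w where "r ^ k dvd conic y w" unfolding k' by blast
        then obtain n e where D: "U.cyclic_sum {x. actv (r ^ k) x = 0} (\<Sum>i<n::nat. {#subst_quad dl (r ^ e i)#})"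
          using primary_isotropic[OF fin r(1) nd] by blast
        have "has_type1 p q r" using r nd True by (simp add: has_type1_iff)
        hence "admissible (\<Sum>i<n. {#subst_quad dl (r ^ e i)#})"
          by (intro admissible_sum admissible_single admissible_empty)
        thus ?thesis using D by blast
      next
        case False
        then obtain n e where D: "U.cyclic_sum {x. actv (r ^ k) x = 0}
            (\<Sum>i<n::nat. {#subst_quad dl (r ^ e i), subst_quad dl (r ^ e i)#})"
          using primary_anisotropic[OF fin r(1)] by blast
        have "admissible (\<Sum>i<n. {#subst_quad dl (r ^ e i), subst_quad dl (r ^ e i)#})"
          by (intro admissible_sum admissible_double admissible_empty r)
        thus ?thesis using D by blast
      qed
    qed
    then obtain F where F: "admissible F" "U.cyclic_sum {x. actv (r ^ k) x = 0} F" by blast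
    have cm: "comax (r ^ k) g" using irreducible_comax_iff[OF r(1)] kg(2) comax_power_left by blast
    have "U.cyclic_sum (U.ssum {x. actv (r ^ k) x = 0} {x. actv g x = 0}) (F + G)"
      using F(2) G(2) V.ker_split(2)[OF cm] by (rule U.cyclic_sum_ssum)
    moreover have "U.ssum {x. actv (r ^ k) x = 0} {x. actv g x = 0} = {x. actv m x = 0}"
      unfolding kg(1) V.ker_split(1)[OF cm] U.ssum_def V.ssum_def ..
    ultimately show ?thesis using admissible_add[OF F(1) G(1)] by auto
  qed
qed

end

context quad_endo
begin

lemma difference_iff_admissible:
  assumes fin: "finite_dimensional_vector_space scale Bas" and reg: "d_regular scale p q u"
  shows "pq_difference scale p q u \<longleftrightarrow> (\<exists>F. admissible F \<and> U.cyclic_sum UNIV F)"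
proof
  assume "pq_difference scale p q u"
  then obtain a where "splits_on UNIV a" unfolding pq_difference_iff_splits by blast
  then interpret split_endo scale u p q a by unfold_locales
  obtain m where m: "m \<noteq> 0" "\<forall>x. actv m x = 0" using actv_annihilator[OF fin] by blast
  hence "{x. actv m x = 0} = UNIV" by auto
  thus "\<exists>F. admissible F \<and> U.cyclic_sum UNIV F" using kernel_admissible[OF fin disc_injective[OF fin reg] m(1)] by simp
next
  assume "\<exists>F. admissible F \<and> U.cyclic_sum UNIV F"
  thus "pq_difference scale p q u" unfolding pq_difference_iff_splits using splits_of_admissible by blast
qed

text \<open>The exponents form a table indexed by irreducible polynomials and by invariant factors.
  The Chinese remainder theorem splits each factor, and the table is then read in the other
  direction.\<close>

lemma cyclic_equiv_grid:
  assumes R: "finite R" "\<And>r. r \<in> R \<Longrightarrow> Factorial_Ring.irreducible r \<and> monic r"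
    and P: "\<And>i. i \<in> I \<Longrightarrow> P i = (\<Prod>r\<in>R. r ^ e r i)"
  shows "U.cyclic_equiv (\<Sum>i\<in>I. {#subst_quad dl (P i)#}) (\<Sum>r\<in>R. \<Sum>i\<in>I. {#subst_quad dl (r ^ e r i)#})"
proof -
  have "U.cyclic_equiv {#subst_quad dl (P i)#} (\<Sum>r\<in>R. {#subst_quad dl (r ^ e r i)#})" if "i \<in> I" for i
    unfolding P[OF that] subst_quad_prod
  proof (rule U.cyclic_equiv_sym, rule U.cyclic_equiv_prod[OF R(1)])
    fix r s assume "r \<in> R" "s \<in> R" "r \<noteq> s"
    thus "comax (subst_quad dl (r ^ e r i)) (subst_quad dl (s ^ e s i))"
      using R(2) by (intro subst_quad_comax comax_power irreducible_comax) auto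
  qed
  hence "U.cyclic_equiv (\<Sum>i\<in>I. {#subst_quad dl (P i)#}) (\<Sum>i\<in>I. \<Sum>r\<in>R. {#subst_quad dl (r ^ e r i)#})"
    by (rule U.cyclic_equiv_sum)
  also have "(\<Sum>i\<in>I. \<Sum>r\<in>R. {#subst_quad dl (r ^ e r i)#}) = (\<Sum>r\<in>R. \<Sum>i\<in>I. {#subst_quad dl (r ^ e r i)#})"
    by (rule sum.swap)
  finally show ?thesis .
qed

lemma represented_factors_iff:
  assumes "\<And>i. i \<ge> 1 \<Longrightarrow> monic (P i)"
  shows "represented_by scale u (diag_block_mat (map (\<lambda>i. companion (subst_quad dl (P i))) [1..<Suc N])) \<longleftrightarrow>
    U.cyclic_sum UNIV (\<Sum>i\<in>{1..N}. {#subst_quad dl (P i)#})"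
proof -
  let ?fs = "map (\<lambda>i. subst_quad dl (P i)) [1..<Suc N]"
  have "map (\<lambda>i. companion (subst_quad dl (P i))) [1..<Suc N] = map companion ?fs" by simp
  moreover have "mset ?fs = (\<Sum>i\<in>{1..N}. {#subst_quad dl (P i)#})"
    by (induction N) auto
  moreover have "monic f" if "f \<in> set ?fs" for f
  proof -
    obtain i where i: "f = subst_quad dl (P i)" "i \<ge> 1" using \<open>f \<in> set ?fs\<close> by auto
    show ?thesis unfolding i(1) by (rule monic_subst_quad[OF assms[OF i(2)]])
  qed
  ultimately show ?thesis using represented_by_companions_iff[of ?fs] by (simp only:)
qed

text \<open>The length is even, so that the factors pair up as \<open>2 n - 1\<close> and
  \<open>2 n\<close>. Type 1 needs no pairing, Type 2 is paired by the equal valuations, and any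
  other irreducible polynomial divides \<open>disc\<close> and cannot occur.\<close>

lemma factors_imp_admissible:
  fixes P :: "nat \<Rightarrow> 'a poly"
  assumes inj: "\<And>x. actv disc x = 0 \<Longrightarrow> x = 0"
    and monic: "\<And>i. i \<ge> 1 \<Longrightarrow> monic (P i)"
    and D: "U.cyclic_sum UNIV (\<Sum>i\<in>{1..2 * N}. {#subst_quad dl (P i)#})"
    and val: "\<And>r n. has_type2 p q r \<Longrightarrow> n \<ge> 1 \<Longrightarrow> poly_valuation r (P (2 * n - 1)) = poly_valuation r (P (2 * n))"
  shows "\<exists>F. admissible F \<and> U.cyclic_sum UNIV F"
proof -
  define f where "f = (\<Prod>i\<in>{1..2 * N}. P i)"
  have P0: "P i \<noteq> 0" if "i \<ge> 1" for i using monic[OF that] by auto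
  hence "f \<noteq> 0" by (simp add: f_def)
  from finite_irreducible_divisors[OF this] obtain R where R: "finite R" "\<forall>r\<in>R. Factorial_Ring.irreducible r \<and> monic r"
    "\<forall>r. Factorial_Ring.irreducible r \<longrightarrow> monic r \<longrightarrow> r dvd f \<longrightarrow> r \<in> R"
    by (elim exE conjE)
  have "\<forall>i\<in>{1..2 * N}. \<exists>e. P i = (\<Prod>r\<in>R. r ^ e r)"
  proof
    fix i assume i: "i \<in> {1..2 * N}"
    hence "P i dvd f" unfolding f_def by (rule dvd_prodI[OF finite_atLeastAtMost])
    thus "\<exists>e. P i = (\<Prod>r\<in>R. r ^ e r)"
      using R monic[of i] i by (intro prod_power_decomposition) (auto intro: dvd_trans)
  qed
  from bchoice[OF this] obtain e where e: "\<forall>i\<in>{1..2 * N}. P i = (\<Prod>r\<in>R. r ^ e i r)" by blast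
  let ?F = "\<Sum>r\<in>R. \<Sum>i\<in>{1..2 * N}. {#subst_quad dl (r ^ e i r)#}"
  have "U.cyclic_equiv (\<Sum>i\<in>{1..2 * N}. {#subst_quad dl (P i)#}) ?F"
    using R e by (intro cyclic_equiv_grid[where e = "\<lambda>r i. e i r"]) auto
  hence "U.cyclic_sum UNIV ?F" using U.cyclic_equiv_sum_iff D by blast
  moreover have "admissible ?F"
  proof (rule admissible_sum)
    fix r assume rR: "r \<in> R"
    hence r: "Factorial_Ring.irreducible r" "monic r" using R(2) by auto
    have ev: "poly_valuation r (P i) = e i r" if "i \<in> {1..2 * N}" for i
      using poly_valuation_prod_power[OF R(1) _ r, of "e i"] R(2) e that rR by simp
    show "admissible (\<Sum>i\<in>{1..2 * N}. {#subst_quad dl (r ^ e i r)#})"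
    proof (cases "has_type1 p q r")
      case True
      thus ?thesis by (intro admissible_sum admissible_single admissible_empty)
    next
      case False
      have pair: "e (2 * n - 1) r = e (2 * n) r" if n: "n \<in> {1..N}" for n
      proof -
        have mem: "2 * n - 1 \<in> {1..2 * N}" "2 * n \<in> {1..2 * N}" using n by auto
        show ?thesis
        proof (cases "has_type2 p q r")
          case True
          thus ?thesis using val[OF True, of n] n ev mem by simp
        next
          case False2: False
          hence rd: "r dvd disc" using False r by (auto simp: has_type1_iff has_type2_iff)
          \<comment> \<open>A positive exponent would give a nonzero vector killed by
            \<open>r\<close>, hence by \<open>disc\<close>.\<close>
          have "e i r = 0" if i: "i \<in> {1..2 * N}" for i
          proof (rule ccontr)
            assume ne: "e i r \<noteq> 0"
            have "P i = r ^ e i r * (\<Prod>s\<in>R - {r}. s ^ e i s)"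
              using e i rR R(1) by (simp add: prod.remove)
            hence "r dvd P i" using ne by (cases "e i r") auto
            then obtain k where k: "P i = r * k" by (elim dvdE)
            have "(\<Sum>i\<in>{1..2 * N}. {#subst_quad dl (P i)#}) =
                add_mset (subst_quad dl (P i)) (\<Sum>i\<in>{1..2 * N} - {i}. {#subst_quad dl (P i)#})"
              using i by (simp add: sum.remove)
            hence D': "U.cyclic_sum UNIV (add_mset (subst_quad dl (P i)) (\<Sum>i\<in>{1..2 * N} - {i}. {#subst_quad dl (P i)#}))"
              using D by simp
            have nz: "subst_quad dl (P i) \<noteq> 0" using P0[of i] i by simp
            have "r \<noteq> 0" using r(1) by auto
            hence nu: "\<not> is_unit (subst_quad dl r)"
              using irreducible_poly_degree_pos[OF r(1)] is_unit_iff_degree[of "subst_quad dl r"] by simp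
            have dv: "subst_quad dl r dvd subst_quad dl (P i)" by (simp add: k subst_quad_mult)
            obtain y where "y \<noteq> 0" "act (subst_quad dl r) y = 0"
              using U.cyclic_sum_torsion[OF D' dv nz nu] .
            hence "actv r y = 0" "y \<noteq> 0" by (simp_all add: actv_def)
            thus False using inj V.act_dvd_eq_0[OF _ rd] by blast
          qed
          thus ?thesis using mem by simp
        qed
      qed
      have "(\<Sum>i\<in>{1..2 * N}. {#subst_quad dl (r ^ e i r)#}) =
          (\<Sum>n\<in>{1..N}. {#subst_quad dl (r ^ e (2 * n) r), subst_quad dl (r ^ e (2 * n) r)#})"
        unfolding sum_pairs using pair by (intro sum.cong) simp_all
      thus ?thesis using r by (simp only:) (intro admissible_sum admissible_double admissible_empty)
    qed
  qed
  ultimately show ?thesis by blast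
qed

text \<open>The \<open>i\<close>-th factor collects the \<open>i\<close>-th largest exponent of
  every irreducible polynomial. Decreasing order gives the divisibility chain, and the doubled lists
  give the equal valuations for Type 2.\<close>

lemma admissible_imp_factors:
  assumes F: "admissible F" "U.cyclic_sum UNIV F"
  shows "\<exists>P N. (\<forall>i\<ge>1. monic (P i)) \<and> (\<forall>i\<ge>1. P (Suc i) dvd P i) \<and> (\<forall>i>N. P i = 1) \<and>
    U.cyclic_sum UNIV (\<Sum>i\<in>{1..N}. {#subst_quad dl (P i)#}) \<and>
    (\<forall>r. has_type2 p q r \<longrightarrow> (\<forall>n\<ge>1. poly_valuation r (P (2 * n - 1)) = poly_valuation r (P (2 * n))))"
proof -
  obtain R C where RC: "finite R" "\<forall>r\<in>R. Factorial_Ring.irreducible r \<and> monic r"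
    "F = (\<Sum>r\<in>R. image_mset (\<lambda>n. subst_quad dl (r ^ n)) (C r))"
    "\<forall>r. has_type2 p q r \<longrightarrow> (\<exists>M. C r = M + M)" using admissible_grading[OF F(1)] by blast
  have "\<exists>l. mset l = C r \<and> sorted_wrt (\<ge>) l \<and> (has_type2 p q r \<longrightarrow> (\<forall>n\<ge>1. padded_nth l (2 * n - 1) = padded_nth l (2 * n)))" for r
    using RC(4) double_list_exists sorted_list_exists[of "C r"] by (cases "has_type2 p q r") metis+
  then obtain l where l: "\<And>r. mset (l r) = C r" "\<And>r. sorted_wrt (\<ge>) (l r)"
    "\<And>r n. has_type2 p q r \<Longrightarrow> n \<ge> 1 \<Longrightarrow> padded_nth (l r) (2 * n - 1) = padded_nth (l r) (2 * n)" by metis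
  \<comment> \<open>A common bound for the lengths of the lists; beyond it all exponents are
    0.\<close>
  define N where "N = (\<Sum>r\<in>R. length (l r))"
  have lN: "length (l r) \<le> N" if "r \<in> R" for r
    unfolding N_def using RC(1) that by (intro member_le_sum) auto
  define P where "P i = (\<Prod>r\<in>R. r ^ padded_nth (l r) i)" for i
  have "monic (P i)" for i
    unfolding P_def using RC(2) by (intro monic_prod monic_power) auto
  moreover have "P (Suc i) dvd P i" if "i \<ge> 1" for i
    unfolding P_def using padded_nth_antimono[OF l(2) that] by (intro prod_dvd_prod le_imp_power_dvd)
  moreover have "P i = 1" if "i > N" for i
  proof -
    have "padded_nth (l r) i = 0" if "r \<in> R" for r using lN[OF that] \<open>i > N\<close> by (simp add: padded_nth_def)
    thus ?thesis by (simp add: P_def)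
  qed
  moreover have "U.cyclic_sum UNIV (\<Sum>i\<in>{1..N}. {#subst_quad dl (P i)#})"
  proof -
    have "U.cyclic_equiv (\<Sum>i\<in>{1..N}. {#subst_quad dl (P i)#}) (\<Sum>r\<in>R. \<Sum>i\<in>{1..N}. {#subst_quad dl (r ^ padded_nth (l r) i)#})"
      using RC(1,2) by (intro cyclic_equiv_grid) (auto simp: P_def)
    also have "U.cyclic_equiv \<dots> (\<Sum>r\<in>R. image_mset (\<lambda>n. subst_quad dl (r ^ n)) (C r))"
    proof (rule U.cyclic_equiv_sum)
      fix r assume r: "r \<in> R"
      have split: "{1..N} = {1..length (l r)} \<union> {Suc (length (l r))..N}" using lN[OF r] by auto
      have "(\<Sum>i\<in>{1..N}. {#subst_quad dl (r ^ padded_nth (l r) i)#}) =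
          image_mset (\<lambda>n. subst_quad dl (r ^ n)) (C r) + (\<Sum>i\<in>{Suc (length (l r))..N}. {#subst_quad dl (r ^ padded_nth (l r) i)#})"
        unfolding split l(1)[symmetric] sum_padded_nth_mset[symmetric, of "\<lambda>n. subst_quad dl (r ^ n)"]
        by (rule sum.union_disjoint) auto
      moreover have "U.cyclic_equiv (\<Sum>i\<in>{Suc (length (l r))..N}. {#subst_quad dl (r ^ padded_nth (l r) i)#}) {#}"
        by (rule U.cyclic_equiv_empty_sum) (simp add: padded_nth_def)
      ultimately show "U.cyclic_equiv (\<Sum>i\<in>{1..N}. {#subst_quad dl (r ^ padded_nth (l r) i)#})
          (image_mset (\<lambda>n. subst_quad dl (r ^ n)) (C r))"
        using U.cyclic_equiv_add[OF U.cyclic_equiv_refl] by (metis add.right_neutral)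
    qed
    finally show ?thesis using U.cyclic_equiv_sum_iff F(2) RC(3) by blast
  qed
  moreover have "poly_valuation r (P (2 * n - 1)) = poly_valuation r (P (2 * n))" if "has_type2 p q r" "n \<ge> 1" for r n
  proof -
    have r: "Factorial_Ring.irreducible r" "monic r" using that(1) by (simp_all add: has_type2_def)
    have "poly_valuation r (P i) = (if r \<in> R then padded_nth (l r) i else 0)" for i
      unfolding P_def using poly_valuation_prod_power[OF RC(1) _ r, of "\<lambda>r. padded_nth (l r) i"] RC(2) by blast
    thus ?thesis using l(3)[OF that] by simp
  qed
  ultimately show ?thesis by blast
qed

lemma invariant_factors_iff_admissible:
  assumes inj: "\<And>x. actv disc x = 0 \<Longrightarrow> x = 0"
  shows "(\<exists>P. (\<forall>i\<ge>1. monic (P i)) \<and> invariant_factors scale u (\<lambda>i. subst_quad dl (P i)) \<and>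
      (\<forall>r. has_type2 p q r \<longrightarrow> (\<forall>n\<ge>1. poly_valuation r (P (2 * n - 1)) = poly_valuation r (P (2 * n)))))
    \<longleftrightarrow> (\<exists>F. admissible F \<and> U.cyclic_sum UNIV F)"
proof
  assume "\<exists>P. (\<forall>i\<ge>1. monic (P i)) \<and> invariant_factors scale u (\<lambda>i. subst_quad dl (P i)) \<and>
      (\<forall>r. has_type2 p q r \<longrightarrow> (\<forall>n\<ge>1. poly_valuation r (P (2 * n - 1)) = poly_valuation r (P (2 * n))))"
  then obtain P where P: "\<forall>i\<ge>1. monic (P i)" "invariant_factors scale u (\<lambda>i. subst_quad dl (P i))"
    "\<forall>r. has_type2 p q r \<longrightarrow> (\<forall>n\<ge>1. poly_valuation r (P (2 * n - 1)) = poly_valuation r (P (2 * n)))" by blast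
  obtain N where N: "\<forall>i>N. subst_quad dl (P i) = 1"
    "represented_by scale u (diag_block_mat (map (\<lambda>i. companion (subst_quad dl (P i))) [1..<Suc N]))"
    using P(2) unfolding invariant_factors_def by blast
  have D: "U.cyclic_sum UNIV (\<Sum>i\<in>{1..N}. {#subst_quad dl (P i)#})"
    using N(2) represented_factors_iff[of P N] P(1) by blast
  \<comment> \<open>The factors beyond \<open>N\<close> are 1, so doubling the length adds only
    trivial summands and makes the pairing possible.\<close>
  have split: "{1..2 * N} = {1..N} \<union> {Suc N..2 * N}" by auto
  have sum: "(\<Sum>i\<in>{1..2 * N}. {#subst_quad dl (P i)#}) =
      (\<Sum>i\<in>{1..N}. {#subst_quad dl (P i)#}) + (\<Sum>i\<in>{Suc N..2 * N}. {#subst_quad dl (P i)#})"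
    unfolding split by (rule sum.union_disjoint) auto
  have "U.cyclic_equiv (\<Sum>i\<in>{Suc N..2 * N}. {#subst_quad dl (P i)#}) {#}"
    by (rule U.cyclic_equiv_empty_sum) (use N(1) in simp)
  hence "U.cyclic_equiv (\<Sum>i\<in>{1..2 * N}. {#subst_quad dl (P i)#}) (\<Sum>i\<in>{1..N}. {#subst_quad dl (P i)#})"
    unfolding sum using U.cyclic_equiv_add[OF U.cyclic_equiv_refl] by (metis add.right_neutral)
  hence "U.cyclic_sum UNIV (\<Sum>i\<in>{1..2 * N}. {#subst_quad dl (P i)#})" using U.cyclic_equiv_sum_iff D by blast
  thus "\<exists>F. admissible F \<and> U.cyclic_sum UNIV F" using factors_imp_admissible[of P N] inj P(1,3) by blast
next
  assume "\<exists>F. admissible F \<and> U.cyclic_sum UNIV F"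
  then obtain F where F: "admissible F" "U.cyclic_sum UNIV F" by blast
  obtain P N where P: "\<forall>i\<ge>1. monic (P i)" "\<forall>i\<ge>1. P (Suc i) dvd P i" "\<forall>i>N. P i = 1"
    "U.cyclic_sum UNIV (\<Sum>i\<in>{1..N}. {#subst_quad dl (P i)#})"
    "\<forall>r. has_type2 p q r \<longrightarrow> (\<forall>n\<ge>1. poly_valuation r (P (2 * n - 1)) = poly_valuation r (P (2 * n)))"
    using admissible_imp_factors[OF F] by blast
  have dvd: "subst_quad dl (P (Suc i)) dvd subst_quad dl (P i)" if "i \<ge> 1" for i
    using P(2) that by (metis dvd_def subst_quad_mult)
  have "represented_by scale u (diag_block_mat (map (\<lambda>i. companion (subst_quad dl (P i))) [1..<Suc N]))"
    using P(4) represented_factors_iff[of P N] P(1) by blast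
  moreover have "\<forall>i>N. subst_quad dl (P i) = 1" using P(3) by simp
  moreover have "\<forall>i\<ge>1. monic (subst_quad dl (P i))" using P(1) monic_subst_quad by blast
  ultimately have "invariant_factors scale u (\<lambda>i. subst_quad dl (P i))"
    unfolding invariant_factors_def using dvd by blast
  thus "\<exists>P. (\<forall>i\<ge>1. monic (P i)) \<and> invariant_factors scale u (\<lambda>i. subst_quad dl (P i)) \<and>
      (\<forall>r. has_type2 p q r \<longrightarrow> (\<forall>n\<ge>1. poly_valuation r (P (2 * n - 1)) = poly_valuation r (P (2 * n))))"
    using P(1,5) by blast
qed

end

theorem theorem3p9:
  fixes scale :: "'a::field \<Rightarrow> 'v::ab_group_add \<Rightarrow> 'v"
    and Bas :: "'v set"
    and p q :: "'a poly"
    and u :: "'v \<Rightarrow> 'v"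
    and \<delta> :: 'a
  assumes "finite_dimensional_vector_space scale Bas"
    and "Vector_Spaces.linear scale scale u"
    and "monic p" and "Polynomial.degree p = 2"
    and "monic q" and "Polynomial.degree q = 2"
    and "d_regular scale p q u"
    and "\<delta> = poly_trace p - poly_trace q"
  shows
    "(pq_difference scale p q u \<longleftrightarrow>
        (\<exists>P :: nat \<Rightarrow> 'a poly.
           (\<forall>i\<ge>1. monic (P i)) \<and>
           invariant_factors scale u (\<lambda>i. subst_quad \<delta> (P i)) \<and>
           (\<forall>r. has_type2 p q r \<longrightarrow>
              (\<forall>n\<ge>1. poly_valuation r (P (2 * n - 1)) = poly_valuation r (P (2 * n))))))
     \<and>
     (pq_difference scale p q u \<longleftrightarrow>
        (\<exists>Bs :: 'a mat list.
           represented_by scale u (diag_block_mat Bs) \<and>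
           (\<forall>M\<in>set Bs.
              (\<exists>r n. has_type1 p q r \<and> n \<ge> 1 \<and> M = companion (subst_quad \<delta> (r ^ n))) \<or>
              (\<exists>r n. Factorial_Ring.irreducible r \<and> monic r \<and> n \<ge> 1 \<and>
                 M = diag_block_mat [companion (subst_quad \<delta> (r ^ n)),
                                     companion (subst_quad \<delta> (r ^ n))]))))"
proof -
  have "vector_space scale" using assms(1) by (simp add: finite_dimensional_vector_space_def)
  then interpret quad_endo scale u p q
    using assms(2-6) by (intro quad_endo.intro endo.intro endo_axioms.intro quad_pair.intro)
  have \<delta>: "\<delta> = dl" using assms(8) by (simp add: dl_def lam_def mu_def)
  \<comment> \<open>Both equivalences go through the same intermediate condition, the existence of
    an admissible multiset.\<close>
  note admissible = difference_iff_admissible[OF assms(1,7)]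
  show ?thesis
    unfolding \<delta>
    by (intro conjI trans[OF admissible invariant_factors_iff_admissible[OF disc_injective[OF assms(1,7)], symmetric]]
        trans[OF admissible blocks_iff[unfolded admissible_block_def, symmetric]])
qed

end
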